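(* The $k$-centre problem for $\mathcal{N}_q^n$ (one-dimensional necklaces of length $n$ over an alphabet of size $q$) can be approximated in $O(n\cdot k)$ time with an approximation factor of $1+f(n,k)$, where $$f(n,k)=\frac{\log_q(k\cdot n)}{n-\log_q(k\cdot n)}-\frac{\log_q^2(k\cdot n)}{2n\,(n-\log_q(k\cdot n))}$$ and $f(n,k)\to 0$ for $n\to\infty$.
   Context: A necklace of length $n$ over an alphabet $\Sigma$ of size $q$ is an equivalence class of words of $\Sigma^n$ under cyclic shift; $\mathcal{N}_q^n$ is the set of all of them. For $1\le m\le n$, the cyclic subwords of length $m$ of a word $w$ of length $n$ are the $n$ words of length $m$ read cyclically from $w$, one for each starting position. The multiset of subwords of a necklace is the union over all $m=1,\dots,n$ of the multisets of its cyclic subwords of length $m$ (counted with multiplicity, one for each starting position); it has $n^2$ elements. For multisets $A,B$, $\mathfrak{C}(A,B)=|A\cap B|/\min(|A|,|B|)$ (multiset intersection), and $\mathfrak{C}(\tilde{w},\tilde{v})$ denotes this quantity for the multisets of subwords of $\tilde{w},\tilde{v}$. The overlap distance is $\mathfrak{O}(\tilde{w},\tilde{v})=1-\mathfrak{C}(\tilde{w},\tilde{v})$. For $\mathbf{S}\subseteq\mathcal{N}_q^n$ let $\mathfrak{D}(\mathbf{S},\mathcal{N}_q^n)=\max_{\tilde{w}\in\mathcal{N}_q^n}\min_{\tilde{s}\in\mathbf{S}}\mathfrak{O}(\tilde{w},\tilde{s})$. The $k$-centre problem for $\mathcal{N}_q^n$: given $n$, $\Sigma$ (of size $q$) and a positive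 integer $k$, find $\mathbf{S}\subseteq\mathcal{N}_q^n$ of size $k$ minimising $\mathfrak{D}(\mathbf{S},\mathcal{N}_q^n)$. An algorithm has approximation factor $\alpha$ if the set it outputs has value $\mathfrak{D}$ at most $\alpha$ times the minimum.
   Formalization: The formal theorem assumes q ≥ 2 and k·n < q^n, i.e. log_q(kn) < n; at kn = q^n the function f is undefined, and beyond it 1+f is negative and cannot be an approximation factor (e.g. q=2, n=4, k=5). *)

theory Defs
  imports Complex_Main "HOL-Library.Multiset"
begin

section \<open>Necklaces and the overlap distance\<close>

text \<open>The alphabet of size \<open>q\<close> is \<open>{..<q}\<close>.\<close>

definition words :: "nat \<Rightarrow> nat \<Rightarrow> nat list set" where
  "words q n = {w. length w = n \<and> set w \<subseteq> {..<q}}"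

definition shift_rel :: "nat \<Rightarrow> nat \<Rightarrow> (nat list \<times> nat list) set" where
  "shift_rel q n = {(u, v). u \<in> words q n \<and> v \<in> words q n \<and> (\<exists>i. v = rotate i u)}"

definition necklaces :: "nat \<Rightarrow> nat \<Rightarrow> nat list set set" where
  "necklaces q n = words q n // shift_rel q n"

definition word_subwords :: "'a list \<Rightarrow> 'a list multiset" where
  "word_subwords w =
    (\<Sum>m = 1..length w. image_mset (\<lambda>i. take m (rotate i w)) (mset_set {..<length w}))"

text \<open>The value on a necklace is the common value on its representatives, see
  \<open>subwords_necklace\<close> below.\<close>

definition subwords :: "'a list set \<Rightarrow> 'a list multiset" where
  "subwords N = the_elem (word_subwords ` N)"

definition overlap_coeff :: "'a multiset \<Rightarrow> 'a multiset \<Rightarrow> real" where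
  "overlap_coeff A B = real (size (A \<inter># B)) / real (min (size A) (size B))"

definition overlap_dist :: "'a list set \<Rightarrow> 'a list set \<Rightarrow> real" where
  "overlap_dist v w = 1 - overlap_coeff (subwords v) (subwords w)"

lemma size_word_subwords: "size (word_subwords w) = length w ^ 2"
  unfolding word_subwords_def by (simp add: size_multiset_sum power2_eq_square)

lemma word_subwords_rotate: "word_subwords (rotate j w) = word_subwords w"
proof (cases "w = []")
  case False
  define n where "n = length w"
  have n: "n > 0" using False by (simp add: n_def)
  let ?h = "\<lambda>i. (i + j) mod n"
  have inj: "inj_on ?h {..<n}"
  proof (rule inj_onI)
    fix a b assume ab: "a \<in> {..<n}" "b \<in> {..<n}" and eq: "(a + j) mod n = (b + j) mod n"
    from eq have "int (a + j) mod int n = int (b + j) mod int n"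
      by (metis of_nat_mod)
    then have "(int (a + j) - int j) mod int n = (int (b + j) - int j) mod int n"
      by (rule mod_diff_cong) simp
    then show "a = b" using ab by simp
  qed
  moreover have "?h ` {..<n} \<subseteq> {..<n}" using n by auto
  ultimately have im: "?h ` {..<n} = {..<n}" by (simp add: endo_inj_surj)
  have "image_mset (\<lambda>i. take m (rotate i (rotate j w))) (mset_set {..<n})
      = image_mset (\<lambda>i. take m (rotate i w)) (mset_set {..<n})" for m
  proof -
    have "image_mset (\<lambda>i. take m (rotate i (rotate j w))) (mset_set {..<n})
      = image_mset (\<lambda>i. take m (rotate (?h i) w)) (mset_set {..<n})"
      by (rule image_mset_cong) (simp add: rotate_rotate n_def rotate_conv_mod[of "_ + _"])
    also have "\<dots> = image_mset (\<lambda>i. take m (rotate i w)) (image_mset ?h (mset_set {..<n}))"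
      by (simp add: multiset.map_comp comp_def)
    also have "image_mset ?h (mset_set {..<n}) = mset_set {..<n}"
      using image_mset_mset_set[OF inj] im by simp
    finally show ?thesis .
  qed
  then show ?thesis by (simp add: word_subwords_def n_def)
qed simp

lemma subwords_necklace:
  assumes "w \<in> words q n"
  shows "subwords (shift_rel q n `` {w}) = word_subwords w"
proof -
  have "w \<in> shift_rel q n `` {w}"
    using assms by (auto simp: shift_rel_def intro: exI[of _ 0])
  moreover have "word_subwords v = word_subwords w" if "v \<in> shift_rel q n `` {w}" for v
    using that by (auto simp: shift_rel_def word_subwords_rotate)
  ultimately have "word_subwords ` (shift_rel q n `` {w}) = {word_subwords w}" by blast
  then show ?thesis by (simp add: subwords_def)
qed

lemma finite_necklaces: "finite (necklaces q n)"
proof -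
  have "words q n = {w. set w \<subseteq> {..<q} \<and> length w = n}" by (auto simp: words_def)
  then have "finite (words q n)" using finite_lists_length_eq[of "{..<q}" n] by simp
  then show ?thesis
    unfolding necklaces_def quotient_def by simp
qed


section \<open>The k-centre problem\<close>

definition centre_cost :: "nat \<Rightarrow> nat \<Rightarrow> nat list set set \<Rightarrow> real" where
  "centre_cost q n S = Max ((\<lambda>w. Min (overlap_dist w ` S)) ` necklaces q n)"

definition centre_opt :: "nat \<Rightarrow> nat \<Rightarrow> nat \<Rightarrow> real" where
  "centre_opt q n k = Min (centre_cost q n ` {S. S \<subseteq> necklaces q n \<and> card S = k})"

text \<open>The denominators are positive exactly when \<open>k * n < q ^ n\<close> (for \<open>q \<ge> 2\<close> and \<open>n, k \<ge> 1\<close>).\<close>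

definition approx_err :: "nat \<Rightarrow> nat \<Rightarrow> nat \<Rightarrow> real" where
  "approx_err q n k =
     log q (real k * real n) / (real n - log q (real k * real n))
     - (log q (real k * real n))\<^sup>2 / (2 * real n * (real n - log q (real k * real n)))"


section \<open>A word RAM with unit-cost instructions\<close>

text \<open>Programs act on finitely many named registers and on an indirectly addressed memory,
  both holding natural numbers; every instruction and every test costs one time unit.
  All computed values must stay below the word bound \<open>W\<close>: an overflowing instruction has no
  execution.  A bound \<open>W = N ^ d\<close> amounts to machine words of \<open>d * log 2 N\<close> bits.  Subtraction is truncated, and division and remainder by zero follow the
  conventions of HOL.\<close>

datatype binop = Add | Sub | Mul | Div | Mod

fun apply_op :: "binop \<Rightarrow> nat \<Rightarrow> nat \<Rightarrow> nat" where
  "apply_op Add a b = a + b"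
| "apply_op Sub a b = a - b"
| "apply_op Mul a b = a * b"
| "apply_op Div a b = a div b"
| "apply_op Mod a b = a mod b"

datatype prog =
    Skip
  | Const nat nat
  | Op binop nat nat nat
  | Load nat nat
  | Store nat nat
  | Seq prog prog
  | IfLess nat nat prog prog
  | WhileLess nat nat prog

type_synonym state = "(nat \<Rightarrow> nat) \<times> (nat \<Rightarrow> nat)"

text \<open>\<open>exec W P s t s'\<close>: started in \<open>s\<close>, program \<open>P\<close> terminates in \<open>s'\<close> after
  exactly \<open>t\<close> time units, without exceeding the word bound \<open>W\<close>.\<close>

inductive exec :: "nat \<Rightarrow> prog \<Rightarrow> state \<Rightarrow> nat \<Rightarrow> state \<Rightarrow> bool" for W :: nat where
  Skip: "exec W Skip s 1 s"
| Const: "c < W \<Longrightarrow> exec W (Const r c) (R, M) 1 (R(r := c), M)"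
| Op: "apply_op f (R a) (R b) < W \<Longrightarrow>
    exec W (Op f r a b) (R, M) 1 (R(r := apply_op f (R a) (R b)), M)"
| Load: "exec W (Load r a) (R, M) 1 (R(r := M (R a)), M)"
| Store: "exec W (Store a r) (R, M) 1 (R, M(R a := R r))"
| Seq: "exec W P s t s' \<Longrightarrow> exec W Q s' u s'' \<Longrightarrow> exec W (Seq P Q) s (t + u) s''"
| IfTrue: "fst s a < fst s b \<Longrightarrow> exec W P s t s' \<Longrightarrow> exec W (IfLess a b P Q) s (1 + t) s'"
| IfFalse: "\<not> fst s a < fst s b \<Longrightarrow> exec W Q s t s' \<Longrightarrow> exec W (IfLess a b P Q) s (1 + t) s'"
| WhileTrue: "fst s a < fst s b \<Longrightarrow> exec W P s t s' \<Longrightarrow> exec W (WhileLess a b P) s' u s'' \<Longrightarrow>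
    exec W (WhileLess a b P) s (1 + t + u) s''"
| WhileFalse: "\<not> fst s a < fst s b \<Longrightarrow> exec W (WhileLess a b P) s 1 s"

lemma exec_deterministic:
  "exec W P s t s' \<Longrightarrow> exec W P s u s'' \<Longrightarrow> t = u \<and> s' = s''"
proof (induction arbitrary: u s'' rule: exec.induct)
  case (Seq P s t s' Q v s2)
  from Seq.prems show ?case by cases (use Seq.IH in blast)
next
  case (IfTrue s a b P t s' Q)
  from IfTrue.prems show ?case by cases (use IfTrue in blast)+
next
  case (IfFalse s a b Q t s' P)
  from IfFalse.prems show ?case by cases (use IfFalse in blast)+
next
  case (WhileTrue s a b P t s' v s2)
  from WhileTrue.prems show ?case by cases (use WhileTrue in blast)+
next
  case (WhileFalse s a b P)
  from WhileFalse.prems show ?case by cases (use WhileFalse in blast)+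
qed (auto elim: exec.cases)

text \<open>The input \<open>n\<close>, \<open>q\<close>, \<open>k\<close> is passed in the registers 0, 1, 2; all
  other registers and the memory are initially zero.\<close>

definition input_state :: "nat \<Rightarrow> nat \<Rightarrow> nat \<Rightarrow> state" where
  "input_state q n k = ((\<lambda>_. 0)(0 := n, 1 := q, 2 := k), \<lambda>_. 0)"

text \<open>The output consists of \<open>k\<close> words of length \<open>n\<close>, written one letter per cell
  to the memory cells \<open>0, \<dots>, k * n - 1\<close>.  A word with a letter outside the alphabet yields
  the empty set, which is not a necklace.\<close>

definition output_set :: "nat \<Rightarrow> nat \<Rightarrow> nat \<Rightarrow> state \<Rightarrow> nat list set set" where
  "output_set q n k s =
     (\<lambda>i. shift_rel q n `` {map (\<lambda>j. snd s (i * n + j)) [0..<n]}) ` {..<k}"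

end

theory Submission
  imports Defs "HOL-Library.FuncSet" "HOL-Real_Asymp.Real_Asymp"
begin

text \<open>
  Write \<open>L\<close> for \<open>log q (k * n)\<close>.  Distances are at most 1, and \<open>1 + approx_err q n k\<close> is
  \<open>(2 * n\<^sup>2 - L\<^sup>2) / (2 * n * (n - L))\<close>.  The proof shows that the optimum is at least the
  reciprocal of this number.  Then every set of \<open>k\<close> necklaces has the required approximation
  factor, and the algorithm only has to write down \<open>k\<close> different necklaces.

  The lower bound on the optimum says: for any \<open>k\<close> words there is a word \<open>w\<close> whose overlap with
  each of them is at most \<open>tolerance n L\<close>, which is about \<open>n * L - L\<^sup>2 / 2\<close>.  A word that has no
  subword of length above \<open>L\<close> in common with the \<open>k\<close> words would have overlap at most \<open>n * L\<close>,
  but such a word need not exist, and the term \<open>L\<^sup>2 / 2\<close> must be gained as well.  Different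
  sources of words are used, according to the size of \<open>L\<close> compared with \<open>n\<close> and with
  \<open>\<nu> = log q n\<close>.  If \<open>L < 1\<close>, some letter does not occur at all.  If \<open>L < 10 * \<nu>\<close>, a periodic
  word does it: among the \<open>q ^ p\<close> possible periods some period is rare in all \<open>k\<close> words
  together, and this already works when \<open>p - 1\<close> is somewhat below \<open>L\<close>
  (\<open>far_few_centres\<close>).  If \<open>10 * \<nu> \<le> L \<le> n / 100\<close>, a counting
  argument gives a word that never shares two disjoint windows, of length about \<open>L / 2\<close> each,
  with the same word (\<open>far_middle\<close>).  If \<open>L\<close> is a constant fraction of \<open>n\<close>, one takes a word
  without repeated windows of logarithmic length.  For such a word the set of starting positions
  of shared windows is not everything, and therefore loses a position whenever the window
  gets longer, which produces the missing \<open>L\<^sup>2 / 2\<close> (\<open>far_medium\<close>, \<open>far_large\<close>).  At the upper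
  end, \<open>L \<ge> n - 1 / 2\<close>, it is enough that \<open>w\<close> is not a rotation of one of the \<open>k\<close> words.
  Some of these estimates need a large \<open>n\<close>; for bounded \<open>n\<close> and a huge alphabet it suffices to
  bound the number of letters that \<open>w\<close> shares with each of the \<open>k\<close> words
  (\<open>far_huge_alphabet\<close>).  Hence the bound holds for all but finitely many triples \<open>(q, n, k)\<close>
  (\<open>far_word_exists_eventually\<close>).  For each remaining triple the program
  stores an optimal solution as a table; this changes only the constants \<open>c\<close> and \<open>d\<close>
  (\<open>add_hardwired_instance\<close>).

  The algorithm (\<open>centres_prog\<close>) finds the least \<open>p\<close> with \<open>k * p \<le> q ^ p\<close> and reads integers below
  \<open>q ^ p\<close> as words of length \<open>p\<close>.  It runs through \<open>0, 1, 2, \<dots>\<close>, selects each unmarked integer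
  and marks all its rotations.  The rotation classes that meet \<open>{..<k * p}\<close> number at least \<open>k\<close>, as
  each class has at most \<open>p\<close> elements, so the sieve never has to go beyond \<open>k * p\<close>.  The
  selected integers are least in their classes.  This property survives when they are read
  as words of length \<open>n\<close> with leading zeros, so they represent different necklaces.
  Choosing \<open>p\<close> minimal keeps all addresses polynomial in \<open>q * n * k\<close>.
\<close>

section \<open>Windows of a cyclic word and their occurrences in another word\<close>

definition overlap :: "'a list \<Rightarrow> 'a list \<Rightarrow> nat" where
  "overlap w s = size (word_subwords w \<inter># word_subwords s)"

definition level :: "nat \<Rightarrow> 'a list \<Rightarrow> 'a list multiset" where
  "level m w = image_mset (\<lambda>i. take m (rotate i w)) (mset_set {..<length w})"

text \<open>Positions are taken modulo the lengths, so this compares windows of cyclic words.  Windows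
  are compared letter by letter because the counting arguments below speak about the letters
  at given positions.\<close>

definition agree :: "'a list \<Rightarrow> nat \<Rightarrow> 'a list \<Rightarrow> nat \<Rightarrow> nat \<Rightarrow> bool" where
  "agree w i s j m \<longleftrightarrow> (\<forall>t<m. w ! ((i + t) mod length w) = s ! ((j + t) mod length s))"

definition hits :: "'a list \<Rightarrow> 'a list \<Rightarrow> nat \<Rightarrow> nat set" where
  "hits s w m = {i. i < length w \<and> (\<exists>j<length s. agree w i s j m)}"

lemma finite_hits [simp]: "finite (hits s w m)"
  by (simp add: hits_def)

lemma hits_subset: "hits s w m \<subseteq> {..<length w}"
  by (auto simp: hits_def)

lemma card_hits_le: "card (hits s w m) \<le> length w"
  using card_mono[OF finite_lessThan hits_subset[of s w m]] by simp

lemma take_rotate_eq_iff_agree: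
  assumes "m \<le> length w" "m \<le> length s"
  shows "take m (rotate i w) = take m (rotate j s) \<longleftrightarrow> agree w i s j m"
  using assms by (auto simp: agree_def list_eq_iff_nth_eq nth_rotate)

lemma size_level [simp]: "size (level m w) = length w"
  by (simp add: level_def)

lemma word_subwords_levels: "word_subwords w = (\<Sum>m = 1..length w. level m w)"
  by (simp add: word_subwords_def level_def)

lemma filter_length_level:
  assumes "m \<le> length w" "l \<le> length w"
  shows "filter_mset (\<lambda>v. length v = l) (level m w) = (if l = m then level m w else {#})"
  using assms by (auto simp: level_def filter_mset_image_mset lessThan_def)

lemma filter_mset_sum: "filter_mset P (\<Sum>i\<in>I. f i) = (\<Sum>i\<in>I. filter_mset P (f i))"
  by (induction I rule: infinite_finite_induct) auto

lemma filter_length_word_subwords: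
  assumes "l \<in> {1..length w}"
  shows "filter_mset (\<lambda>v. length v = l) (word_subwords w) = level l w"
proof -
  have "filter_mset (\<lambda>v. length v = l) (word_subwords w)
      = (\<Sum>m = 1..length w. if l = m then level m w else {#})"
    unfolding word_subwords_levels filter_mset_sum
    using assms by (intro sum.cong) (auto simp: filter_length_level)
  then show ?thesis using assms by simp
qed

lemma length_in_word_subwords:
  assumes "v \<in># word_subwords w"
  shows "length v \<in> {1..length w}"
  using assms by (auto simp: word_subwords_levels level_def set_mset_sum)

lemma size_partition_length:
  assumes "\<And>v. v \<in># A \<Longrightarrow> length v \<in> I" "finite I"
  shows "size A = (\<Sum>l\<in>I. size (filter_mset (\<lambda>v. length v = l) A))"
  using assms
proof (induction A)
  case (add x A)
  have "(\<Sum>l\<in>I. size (filter_mset (\<lambda>v. length v = l) (add_mset x A)))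
     = (\<Sum>l\<in>I. size (filter_mset (\<lambda>v. length v = l) A) + (if l = length x then 1 else 0))"
    by (intro sum.cong) auto
  also have "\<dots> = size A + 1"
    using add by (simp add: sum.distrib)
  finally show ?case by simp
qed simp

text \<open>Subwords of different lengths never coincide, so the intersection splits by length.\<close>

lemma overlap_levels:
  assumes "length s = length w"
  shows "overlap w s = (\<Sum>m = 1..length w. size (level m w \<inter># level m s))"
proof -
  have "overlap w s = (\<Sum>l = 1..length w.
      size (filter_mset (\<lambda>v. length v = l) (word_subwords w \<inter># word_subwords s)))"
    unfolding overlap_def using length_in_word_subwords[of _ w]
    by (intro size_partition_length) auto
  also have "\<dots> = (\<Sum>m = 1..length w. size (level m w \<inter># level m s))"
    using assms filter_length_word_subwords[of _ w] filter_length_word_subwords[of _ s]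
    by (intro sum.cong) (auto simp: filter_inter_mset)
  finally show ?thesis .
qed

lemma size_inter_image_mset_le:
  assumes "finite I"
  shows "size (image_mset f (mset_set I) \<inter># B) \<le> card {i \<in> I. f i \<in># B}"
proof -
  have "image_mset f (mset_set I) \<inter># B \<subseteq># filter_mset (\<lambda>v. v \<in># B) (image_mset f (mset_set I))"
    by (auto simp: subseteq_mset_def not_in_iff)
  also have "\<dots> = image_mset f (mset_set {i \<in> I. f i \<in># B})"
    using assms by (simp add: filter_mset_image_mset)
  finally show ?thesis using size_mset_mono by fastforce
qed

lemma size_inter_level_le_card_hits:
  assumes "length s = length w" "m \<le> length w"
  shows "size (level m w \<inter># level m s) \<le> card (hits s w m)"
proof -
  have "{i \<in> {..<length w}. take m (rotate i w) \<in># level m s} \<subseteq> hits s w m"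
    using assms by (auto simp: level_def hits_def take_rotate_eq_iff_agree)
  then have "card {i \<in> {..<length w}. take m (rotate i w) \<in># level m s} \<le> card (hits s w m)"
    by (intro card_mono) auto
  then show ?thesis
    using size_inter_image_mset_le[of "{..<length w}" "\<lambda>i. take m (rotate i w)" "level m s"]
    unfolding level_def by simp
qed

text \<open>Forgetting multiplicities on the side of \<open>s\<close> only increases the intersection.  All
  overlap bounds below, except the one for periodic words, start from this estimate.\<close>

lemma overlap_le_sum_hits:
  assumes "length s = length w"
  shows "overlap w s \<le> (\<Sum>m = 1..length w. card (hits s w m))"
  unfolding overlap_levels[OF assms]
  using assms by (intro sum_mono size_inter_level_le_card_hits) auto

lemma hits_antimono: "m \<le> m' \<Longrightarrow> hits s w m' \<subseteq> hits s w m"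
  by (force simp: hits_def agree_def)

lemma agree_shift:
  assumes "agree w i s j m" "a + l \<le> m"
  shows "agree w ((i + a) mod length w) s ((j + a) mod length s) l"
  unfolding agree_def
proof (intro allI impI)
  fix t assume "t < l"
  then have "w ! ((i + (a + t)) mod length w) = s ! ((j + (a + t)) mod length s)"
    using assms unfolding agree_def by auto
  then show "w ! (((i + a) mod length w + t) mod length w)
      = s ! (((j + a) mod length s + t) mod length s)"
    by (simp add: mod_add_left_eq add.assoc)
qed

lemma hits_shift:
  assumes "i \<in> hits s w m" "a + l \<le> m"
  shows "(i + a) mod length w \<in> hits s w l"
proof -
  obtain j where j: "i < length w" "j < length s" "agree w i s j m"
    using assms by (auto simp: hits_def)
  have "(i + a) mod length w < length w" "(j + a) mod length s < length s"
    using j by (auto intro: mod_less_divisor)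
  then show ?thesis
    using agree_shift[OF j(3) assms(2)] unfolding hits_def by blast
qed

text \<open>A nonempty proper subset of a cycle is not closed under the successor.\<close>

lemma card_less_of_shift_closed:
  fixes A B :: "nat set"
  assumes "A \<subseteq> {..<n}" "A \<noteq> {..<n}" "A \<noteq> {}" "B \<subseteq> A"
    and "\<And>i. i \<in> B \<Longrightarrow> (i + 1) mod n \<in> A"
  shows "card B < card A"
proof (rule ccontr)
  have fin: "finite A" using assms(1) finite_subset by blast
  assume "\<not> card B < card A"
  then have BA: "B = A" using fin assms(4) by (metis psubset_card_mono psubsetI)
  obtain a where a: "a \<in> A" using assms by blast
  have st: "(a + t) mod n \<in> A" for t
  proof (induction t)
    case 0
    then show ?case using a assms(1) by auto
  next
    case (Suc t)
    then have "((a + t) mod n + 1) mod n \<in> A" using assms(5) BA by blast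
    then show ?case by (simp add: mod_simps)
  qed
  have "b \<in> A" if "b < n" for b
  proof -
    have "(a + (n - a + b)) mod n = b" using that a assms(1) by auto
    then show ?thesis using st[of "n - a + b"] by simp
  qed
  then show False using assms by blast
qed

text \<open>If a window of length \<open>m + 1\<close> at \<open>i\<close> occurs in \<open>s\<close>, then so do the windows of length \<open>m\<close>
  at \<open>i\<close> and at \<open>i + 1\<close>.  A hit set that is not the whole cycle therefore loses an element
  with every further letter, until it is empty.\<close>

lemma card_hits_decrease:
  assumes "hits s w m \<noteq> {..<length w}"
  shows "card (hits s w (m + j)) \<le> card (hits s w m) - j"
proof (induction j)
  case (Suc j)
  show ?case
  proof (cases "hits s w (m + j) = {}")
    case True
    then show ?thesis using hits_antimono[of "m + j" "m + Suc j" s w] by simp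
  next
    case False
    have "hits s w (m + j) \<noteq> {..<length w}"
      using hits_antimono[of m "m + j" s w] hits_subset[of s w] assms by fastforce
    then have "card (hits s w (m + Suc j)) < card (hits s w (m + j))"
      using False hits_subset hits_antimono[of "m + j" "m + Suc j" s w]
        hits_shift[of _ s w "m + Suc j" 1 "m + j"]
      by (intro card_less_of_shift_closed) simp_all
    then show ?thesis using Suc by linarith
  qed
qed simp

section \<open>Counting words\<close>

lemma finite_words [simp]: "finite (words q n)"
proof -
  have "words q n = {w. set w \<subseteq> {..<q} \<and> length w = n}" by (auto simp: words_def)
  then show ?thesis using finite_lists_length_eq[of "{..<q}" n] by simp
qed

lemma card_words: "card (words q n) = q ^ n"
proof -
  have "words q n = {w. set w \<subseteq> {..<q} \<and> length w = n}" by (auto simp: words_def)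
  then show ?thesis using card_lists_length_eq[of "{..<q}" n] by simp
qed

text \<open>The common form of all counting arguments: if the letters outside \<open>A\<close> determine a word of
  \<open>X\<close>, each position of \<open>A\<close> saves a factor \<open>q\<close>.\<close>

lemma card_words_determined:
  assumes X: "X \<subseteq> words q n" and A: "A \<subseteq> {..<n}"
    and det: "\<And>v w. v \<in> X \<Longrightarrow> w \<in> X \<Longrightarrow> (\<And>i. i < n \<Longrightarrow> i \<notin> A \<Longrightarrow> v ! i = w ! i) \<Longrightarrow> v = w"
  shows "card X \<le> q ^ (n - card A)"
proof -
  let ?r = "\<lambda>w. restrict (\<lambda>i. w ! i) ({..<n} - A)"
  have "inj_on ?r X"
  proof (rule inj_onI)
    fix v w assume "v \<in> X" "w \<in> X" and eq: "?r v = ?r w"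
    then show "v = w"
    proof (intro det)
      fix i assume "i < n" "i \<notin> A"
      then show "v ! i = w ! i" using fun_cong[OF eq, of i] by simp
    qed
  qed
  moreover have "?r ` X \<subseteq> ({..<n} - A) \<rightarrow>\<^sub>E {..<q}"
    using X by (fastforce simp: words_def PiE_def set_conv_nth)
  ultimately have "card X \<le> card (({..<n} - A) \<rightarrow>\<^sub>E {..<q})"
    by (metis card_inj_on_le finite_Diff finite_PiE finite_lessThan)
  also have "\<dots> = q ^ (n - card A)"
    using A finite_subset[OF A] by (simp add: card_PiE card_Diff_subset)
  finally show ?thesis .
qed

lemma card_words_agreeing:
  assumes X: "X \<subseteq> words q n" and A: "A \<subseteq> {..<n}"
    and det: "\<And>v w i. v \<in> X \<Longrightarrow> w \<in> X \<Longrightarrow> i \<in> A \<Longrightarrow> v ! i = w ! i"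
  shows "card X \<le> q ^ (n - card A)"
proof (rule card_words_determined[OF X A])
  fix v w assume vw: "v \<in> X" "w \<in> X" "\<And>i. i < n \<Longrightarrow> i \<notin> A \<Longrightarrow> v ! i = w ! i"
  show "v = w"
  proof (rule nth_equalityI)
    show "length v = length w" using vw X by (auto simp: words_def)
    fix i assume "i < length v"
    then have "i < n" using vw X by (auto simp: words_def)
    then show "v ! i = w ! i" using vw det by blast
  qed
qed

lemma card_UN_le_mult:
  assumes "finite C" "\<And>c. c \<in> C \<Longrightarrow> card (X c) \<le> b"
  shows "card (\<Union>c\<in>C. X c) \<le> card C * b"
proof -
  have "card (\<Union>c\<in>C. X c) \<le> (\<Sum>c\<in>C. card (X c))" by (rule card_UN_le[OF assms(1)])
  also have "\<dots> \<le> card C * b" using sum_bounded_above[of C "\<lambda>c. card (X c)" b] assms(2) by simp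
  finally show ?thesis .
qed

text \<open>The positions covered by the window of length \<open>m\<close> at position \<open>i\<close> of a cyclic word of
  length \<open>n\<close>.\<close>

definition arc :: "nat \<Rightarrow> nat \<Rightarrow> nat \<Rightarrow> nat set" where
  "arc n i m = (\<lambda>t. (i + t) mod n) ` {..<m}"

lemma add_mod_cancel:
  fixes i t t' n :: nat
  assumes "(i + t) mod n = (i + t') mod n" "t < n" "t' < n"
  shows "t = t'"
proof -
  have "int (i + t) mod int n = int (i + t') mod int n"
    using assms(1) by (metis of_nat_mod)
  then have "(int (i + t) - int i) mod int n = (int (i + t') - int i) mod int n"
    by (rule mod_diff_cong) simp
  then show ?thesis using assms by simp
qed

lemma card_arc: "m \<le> n \<Longrightarrow> card (arc n i m) = m"
  unfolding arc_def by (subst card_image) (auto intro!: inj_onI dest: add_mod_cancel)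

lemma finite_arc: "finite (arc n i m)"
  by (simp add: arc_def)

section \<open>Overlap bounds from the positions that are hit\<close>

lemma rotation_of_rotate_eq:
  assumes "rotate i w = rotate j s" "i \<le> length w"
  shows "\<exists>l. w = rotate l s"
proof -
  have "rotate (length w - i) (rotate i w) = w"
    using assms(2) by (simp add: rotate_rotate)
  then show ?thesis using assms(1) by (metis rotate_rotate)
qed

lemma hits_full_length_empty:
  assumes "length s = length w" "\<And>l. w \<noteq> rotate l s"
  shows "hits s w (length w) = {}"
proof -
  { fix i j assume "i < length w" "agree w i s j (length w)"
    then have "rotate i w = rotate j s"
      using assms(1) take_rotate_eq_iff_agree[of "length w" w s i j] by simp
    then have False using rotation_of_rotate_eq[of i w j s] assms(2) \<open>i < length w\<close> by auto }
  then show ?thesis by (auto simp: hits_def)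
qed

lemma hits_eq_empty_mono: "hits s w m = {} \<Longrightarrow> m \<le> m' \<Longrightarrow> hits s w m' = {}"
  using hits_antimono[of m m' s w] by simp

lemma overlap_le_of_bounds:
  assumes len: "length s = length w"
    and b: "\<And>m. 1 \<le> m \<Longrightarrow> m \<le> M \<Longrightarrow> card (hits s w m) \<le> c m"
    and e: "hits s w (Suc M) = {}"
  shows "overlap w s \<le> (\<Sum>m = 1..M. c m)"
proof -
  have z: "card (hits s w m) = 0" if "m > M" for m
    using hits_eq_empty_mono[OF e, of m] that by simp
  have "overlap w s \<le> (\<Sum>m = 1..length w. card (hits s w m))"
    by (rule overlap_le_sum_hits[OF len])
  also have "\<dots> = (\<Sum>m \<in> {1..length w} \<inter> {1..M}. card (hits s w m))"
    using z by (intro sum.mono_neutral_right) (auto simp: not_le)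
  also have "\<dots> \<le> (\<Sum>m = 1..M. card (hits s w m))"
    by (intro sum_mono2) auto
  also have "\<dots> \<le> (\<Sum>m = 1..M. c m)"
    using b by (intro sum_mono) auto
  finally show ?thesis .
qed

lemma overlap_not_rotation:
  assumes "length s = length w" "\<And>l. w \<noteq> rotate l s" "w \<noteq> []"
  shows "overlap w s + length w \<le> length w ^ 2"
proof -
  define n where "n = length w"
  have n: "n > 0" using assms(3) by (simp add: n_def)
  have "overlap w s \<le> (\<Sum>m = 1..n - 1. n)"
    using hits_full_length_empty[OF assms(1,2)] assms(1) n
    by (intro overlap_le_of_bounds) (auto simp: card_hits_le n_def)
  then have "overlap w s + n \<le> (n - 1) * n + n" by simp
  also have "\<dots> = n ^ 2" using n by (cases n) (auto simp: power2_eq_square)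
  finally show ?thesis by (simp add: n_def)
qed

lemma sum_truncated_triangle:
  fixes n M a :: nat
  assumes "M \<le> n"
  shows "2 * (\<Sum>m = 1..M. n - (m - a)) + (M - a) * (M - a + 1) = 2 * n * M"
  using assms
proof (induction M)
  case (Suc M)
  show ?case
  proof (cases "M < a")
    case True
    then show ?thesis using Suc by simp
  next
    case False
    then obtain K where K: "M = a + K" using le_Suc_ex by (metis not_less)
    have "K + 1 \<le> n" using Suc.prems K by simp
    then obtain r where r: "n = K + 1 + r" using le_Suc_ex by blast
    show ?thesis using Suc K by (simp add: r algebra_simps)
  qed
qed simp

text \<open>Up to length \<open>a\<close> nothing is gained; from then on each level loses one more position.  The
  subtracted triangle is the source of the term \<open>L\<^sup>2 / 2\<close> of the tolerance.\<close>

lemma overlap_triangle: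
  assumes len: "length s = length w" and ne: "hits s w (Suc a) \<noteq> {..<length w}"
    and e: "hits s w (Suc M) = {}" and M: "M \<le> length w"
  shows "2 * overlap w s + (M - a) * (M - a + 1) \<le> 2 * length w * M"
proof -
  have c: "card (hits s w (Suc a)) < length w"
    using ne hits_subset[of s w "Suc a"] psubset_card_mono[of "{..<length w}"] by auto
  have "card (hits s w m) \<le> length w - (m - a)" if "1 \<le> m" for m
  proof (cases "m \<le> a")
    case True
    then show ?thesis using card_hits_le[of s w m] by simp
  next
    case False
    then obtain j where "m = Suc a + j" using less_imp_Suc_add[of a m] by auto
    then show ?thesis using card_hits_decrease[OF ne, of j] c by simp
  qed
  then have "overlap w s \<le> (\<Sum>m = 1..M. length w - (m - a))"
    by (intro overlap_le_of_bounds[OF len _ e]) auto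
  then show ?thesis using sum_truncated_triangle[OF M, of a] by linarith
qed

lemma overlap_few_letters:
  assumes len: "length s = length w" and J: "card (hits s w 1) \<le> J" "J < length w"
  shows "2 * overlap w s \<le> J * (J + 1)"
proof -
  have ne: "hits s w 1 \<noteq> {..<length w}"
  proof
    assume "hits s w 1 = {..<length w}"
    then have "card (hits s w 1) = length w" by simp
    then show False using J by simp
  qed
  have b: "card (hits s w (1 + j)) \<le> J - j" for j
    using card_hits_decrease[OF ne, of j] J(1) by linarith
  have b': "card (hits s w m) \<le> J + 1 - m" if "1 \<le> m" for m
    using b[of "m - 1"] that by simp
  have "hits s w (Suc J) = {}" using b[of J] by simp
  then have "overlap w s \<le> (\<Sum>m = 1..J. J + 1 - m)"
    using b' by (intro overlap_le_of_bounds[OF len]) auto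
  also have "\<dots> = (\<Sum>m = 1..J. m)"
    by (rule sum.reindex_bij_witness[of _ "\<lambda>m. J + 1 - m" "\<lambda>m. J + 1 - m"]) auto
  finally show ?thesis using gauss_sum_from_Suc_0[of J, where 'a = nat] by simp
qed

text \<open>A common window of length \<open>2 * \<mu>\<close> would split into two disjoint ones of length \<open>\<mu>\<close>, so only
  the levels below \<open>2 * \<mu>\<close> contribute; and the hits at level \<open>\<mu>\<close> all lie close to any one of
  them.\<close>

lemma overlap_no_disjoint_windows:
  assumes len: "length s = length w" and \<mu>: "0 < \<mu>" "2 * \<mu> \<le> length w"
    and meet: "\<And>i j. i \<in> hits s w \<mu> \<Longrightarrow> j \<in> hits s w \<mu> \<Longrightarrow>
      arc (length w) i \<mu> \<inter> arc (length w) j \<mu> \<noteq> {}"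
  shows "overlap w s \<le> length w * (\<mu> - 1) + 2 * \<mu> ^ 2"
proof -
  define n where "n = length w"
  have e: "hits s w (2 * \<mu>) = {}"
  proof (rule ccontr)
    assume "hits s w (2 * \<mu>) \<noteq> {}"
    then obtain i where i: "i \<in> hits s w (2 * \<mu>)" by blast
    have "arc n i \<mu> \<inter> arc n ((i + \<mu>) mod n) \<mu> = {}"
    proof (rule ccontr)
      assume "arc n i \<mu> \<inter> arc n ((i + \<mu>) mod n) \<mu> \<noteq> {}"
      then obtain t t' where t: "t < \<mu>" "t' < \<mu>" "(i + t) mod n = ((i + \<mu>) mod n + t') mod n"
        by (auto simp: arc_def)
      then have "(i + t) mod n = (i + (\<mu> + t')) mod n" by (simp add: mod_simps add.assoc)
      moreover have "t < n" "\<mu> + t' < n" using t \<mu> by (auto simp: n_def)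
      ultimately have "t = \<mu> + t'" by (rule add_mod_cancel)
      then show False using t by simp
    qed
    moreover have "i \<in> hits s w \<mu>"
      by (rule subsetD[OF hits_antimono i]) simp
    moreover have "(i + \<mu>) mod n \<in> hits s w \<mu>"
      unfolding n_def by (rule hits_shift[OF i]) simp
    ultimately show False using meet[of i "(i + \<mu>) mod n", folded n_def] by blast
  qed
  have c\<mu>: "card (hits s w \<mu>) \<le> 2 * \<mu>"
  proof (cases "hits s w \<mu> = {}")
    case False
    then obtain i where i: "i \<in> hits s w \<mu>" by blast
    have i_n: "i < n" using i by (simp add: hits_def n_def)
    have "hits s w \<mu> \<subseteq> arc n i \<mu> \<union> arc n (i + (n - \<mu>)) \<mu>"
    proof
      fix j assume j: "j \<in> hits s w \<mu>"
      then have jn: "j < n" by (simp add: hits_def n_def)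
      obtain t t' where t: "t < \<mu>" "t' < \<mu>" "(i + t) mod n = (j + t') mod n"
        using meet[OF i j] by (auto simp: arc_def n_def)
      have "j = (j + t' + (n - t')) mod n" using jn t \<mu> by (simp add: n_def)
      also have "\<dots> = (i + t + (n - t')) mod n" using t(3) by (metis mod_add_left_eq)
      finally have j_eq: "j = (i + t + (n - t')) mod n" .
      show "j \<in> arc n i \<mu> \<union> arc n (i + (n - \<mu>)) \<mu>"
      proof (cases "t' \<le> t")
        case True
        then have "i + t + (n - t') = i + (t - t') + n" using t \<mu> by (simp add: n_def)
        then have "j = (i + (t - t')) mod n" unfolding j_eq by (metis mod_add_self2)
        moreover have "t - t' \<in> {..<\<mu>}" using t by simp
        ultimately show ?thesis unfolding arc_def by blast
      next
        case False
        then have "i + t + (n - t') = i + (n - \<mu>) + (\<mu> - (t' - t))"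
          using t \<mu> by (simp add: n_def)
        then have "j = (i + (n - \<mu>) + (\<mu> - (t' - t))) mod n" using j_eq by argo
        moreover have "\<mu> - (t' - t) \<in> {..<\<mu>}" using t False by simp
        ultimately show ?thesis unfolding arc_def by blast
      qed
    qed
    then have "card (hits s w \<mu>) \<le> card (arc n i \<mu> \<union> arc n (i + (n - \<mu>)) \<mu>)"
      by (intro card_mono) (simp_all add: finite_arc)
    also have "\<dots> \<le> \<mu> + \<mu>"
      using card_Un_le[of "arc n i \<mu>" "arc n (i + (n - \<mu>)) \<mu>"] card_arc[of \<mu> n] \<mu>
      by (simp add: n_def)
    finally show ?thesis by simp
  qed simp
  have "overlap w s \<le> (\<Sum>m = 1..2 * \<mu> - 1. if m < \<mu> then n else 2 * \<mu>)"
  proof (rule overlap_le_of_bounds[OF len])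
    fix m :: nat
    assume "1 \<le> m"
    show "card (hits s w m) \<le> (if m < \<mu> then n else 2 * \<mu>)"
      using card_hits_le[of s w m] c\<mu> card_mono[OF _ hits_antimono[of \<mu> m s w]]
      by (auto simp: n_def)
  qed (use e \<mu> in simp)
  also have "{1..2 * \<mu> - 1} = {1..<\<mu>} \<union> {\<mu>..2 * \<mu> - 1}" using \<mu> by auto
  also have "(\<Sum>m\<in>\<dots>. if m < \<mu> then n else 2 * \<mu>) = n * (\<mu> - 1) + 2 * \<mu> ^ 2"
    using \<mu> by (subst sum.union_disjoint) (auto simp: power2_eq_square)
  finally show ?thesis by (simp add: n_def)
qed

lemma overlap_missing_letter:
  assumes "a \<notin> set s"
  shows "overlap (replicate (length s) a) s = 0"
proof -
  have "hits s (replicate (length s) a) 1 = {}"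
    using assms by (auto simp: hits_def agree_def)
  then show ?thesis
    using overlap_le_of_bounds[of s "replicate (length s) a" 0 "\<lambda>_. 0"] by simp
qed

definition nonrepeating :: "nat \<Rightarrow> 'a list \<Rightarrow> bool" where
  "nonrepeating m w \<longleftrightarrow>
    (\<forall>i<length w. \<forall>j<length w. agree w i w j m \<longrightarrow> i = j)"

lemma agree_sym: "agree w i s j m \<Longrightarrow> agree s j w i m"
  by (simp add: agree_def)

lemma agree_trans: "agree w i s j m \<Longrightarrow> agree s j v l m \<Longrightarrow> agree w i v l m"
  by (simp add: agree_def)

lemma agree_mono: "agree w i s j m \<Longrightarrow> l \<le> m \<Longrightarrow> agree w i s j l"
  by (simp add: agree_def)

text \<open>If all windows of \<open>w\<close> of length \<open>m + 1\<close> occurred in \<open>s\<close>, they would occur there in different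
  places, hence fill \<open>s\<close>.  As windows of length \<open>m\<close> do not repeat, the window that follows a
  given one is the same in both words, and \<open>w\<close> would be a rotation of \<open>s\<close>.\<close>

lemma nonrepeating_not_all_hits:
  assumes len: "length s = length w" and nr: "nonrepeating m w"
    and nrot: "\<And>l. w \<noteq> rotate l s"
  shows "hits s w (Suc m) \<noteq> {..<length w}"
proof
  assume all: "hits s w (Suc m) = {..<length w}"
  define n where "n = length w"
  have "\<forall>i<n. \<exists>j<n. agree w i s j (Suc m)"
    using all len by (auto simp: hits_def n_def set_eq_iff)
  then obtain \<phi> where \<phi>: "\<And>i. i < n \<Longrightarrow> \<phi> i < n \<and> agree w i s (\<phi> i) (Suc m)" by metis
  have \<phi>m: "agree w i s (\<phi> i) m" if "i < n" for i
    using \<phi>[OF that] agree_mono[of w i s "\<phi> i" "Suc m" m] by simp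
  have "inj_on \<phi> {..<n}"
  proof (rule inj_onI)
    fix i j assume "i \<in> {..<n}" "j \<in> {..<n}" "\<phi> i = \<phi> j"
    then have "agree w i w j m" using \<phi>m agree_trans agree_sym by (metis lessThan_iff)
    then show "i = j" using nr \<open>i \<in> {..<n}\<close> \<open>j \<in> {..<n}\<close>
      by (simp add: nonrepeating_def n_def)
  qed
  moreover have "\<phi> ` {..<n} \<subseteq> {..<n}" using \<phi> by auto
  ultimately have surj: "\<phi> ` {..<n} = {..<n}" by (simp add: endo_inj_surj)
  have n: "n > 0" using nrot[of 0] len by (auto simp: n_def)
  have step: "\<phi> ((i + 1) mod n) = (\<phi> i + 1) mod n" if i: "i < n" for i
  proof -
    have "(\<phi> i + 1) mod n < n" using n by simp
    then obtain b where b: "b < n" "\<phi> b = (\<phi> i + 1) mod n"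
      using surj by (metis imageE lessThan_iff)
    have "agree w ((i + 1) mod n) s ((\<phi> i + 1) mod n) m"
      using agree_shift[of w i s "\<phi> i" "Suc m" 1 m] \<phi>[OF i] len by (simp add: n_def)
    then have "agree w ((i + 1) mod n) w b m"
      using \<phi>m[OF b(1)] b(2) agree_trans agree_sym by metis
    then have "(i + 1) mod n = b"
      using nr b(1) n by (simp add: nonrepeating_def n_def)
    then show ?thesis using b by simp
  qed
  have \<phi>_eq: "i < n \<Longrightarrow> \<phi> i = (\<phi> 0 + i) mod n" for i
  proof (induction i)
    case 0
    then show ?case using \<phi>[of 0] by simp
  next
    case (Suc i)
    then show ?case using step[of i] by (simp add: mod_simps)
  qed
  have "w = rotate (\<phi> 0) s"
  proof (rule nth_equalityI)
    fix i assume i: "i < length w"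
    have "w ! ((i + 0) mod n) = s ! ((\<phi> i + 0) mod n)"
      using \<phi>[of i] i len unfolding agree_def n_def by (metis zero_less_Suc)
    then show "w ! i = rotate (\<phi> 0) s ! i"
      using i \<phi>_eq[of i] len by (simp add: n_def nth_rotate)
  qed (use len in simp)
  then show False using nrot by blast
qed

section \<open>Few words are badly placed\<close>

lemma length_words: "w \<in> words q n \<Longrightarrow> length w = n"
  by (simp add: words_def)

lemma card_bad_rotations:
  assumes "finite S" "S \<subseteq> words q n" "n > 0"
  shows "card {w \<in> words q n. \<exists>s\<in>S. \<exists>l. w = rotate l s} \<le> card S * n"
proof -
  let ?B = "{w \<in> words q n. \<exists>s\<in>S. \<exists>l. w = rotate l s}"
  have "?B \<subseteq> (\<Union>s\<in>S. (\<lambda>l. rotate l s) ` {..<n})"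
  proof
    fix w assume "w \<in> ?B"
    then obtain s l where s: "s \<in> S" "w = rotate l s" by auto
    have "length s = n" using assms(2) s length_words by blast
    then have "w = rotate (l mod n) s" "l mod n < n"
      using s(2) assms(3) rotate_conv_mod[of l s] by simp_all
    then show "w \<in> (\<Union>s\<in>S. (\<lambda>l. rotate l s) ` {..<n})" using s(1) by blast
  qed
  then have "card ?B \<le> card (\<Union>s\<in>S. (\<lambda>l. rotate l s) ` {..<n})"
    by (rule card_mono[rotated]) (use assms(1) in simp)
  also have "\<dots> \<le> card S * n"
    using assms(1) card_image_le[of "{..<n}"] by (intro card_UN_le_mult) auto
  finally show ?thesis .
qed

text \<open>The windows are counted by the word \<open>s\<close>, the position in \<open>w\<close> and the position in \<open>s\<close>; these
  data fix \<open>m\<close> letters of \<open>w\<close>.\<close>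

lemma card_bad_window:
  assumes "finite S" "S \<subseteq> words q n" "m \<le> n"
  shows "card {w \<in> words q n. \<exists>s\<in>S. hits s w m \<noteq> {}} \<le> card S * n * n * q ^ (n - m)"
proof -
  let ?X = "\<lambda>(s, i, j). {w \<in> words q n. i < n \<and> agree w i s j m}"
  have "{w \<in> words q n. \<exists>s\<in>S. hits s w m \<noteq> {}} \<subseteq> (\<Union>c\<in>S \<times> {..<n} \<times> {..<n}. ?X c)"
    using assms(2) by (fastforce simp: hits_def words_def)
  then have "card {w \<in> words q n. \<exists>s\<in>S. hits s w m \<noteq> {}}
      \<le> card (\<Union>c\<in>S \<times> {..<n} \<times> {..<n}. ?X c)"
    by (intro card_mono) (auto simp: assms(1))
  also have "\<dots> \<le> card (S \<times> {..<n} \<times> {..<n}) * q ^ (n - m)"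
  proof (rule card_UN_le_mult)
    fix c assume "c \<in> S \<times> {..<n} \<times> {..<n}"
    then obtain s i j where c: "c = (s, i, j)" "i < n" by auto
    have "card (?X c) \<le> q ^ (n - card (arc n i m))"
      unfolding c(1) prod.case
    proof (rule card_words_agreeing)
      fix v w a assume "v \<in> {w \<in> words q n. i < n \<and> agree w i s j m}"
        "w \<in> {w \<in> words q n. i < n \<and> agree w i s j m}" "a \<in> arc n i m"
      then show "v ! a = w ! a" by (auto simp: arc_def agree_def words_def)
    qed (use c in \<open>auto simp: arc_def\<close>)
    then show "card (?X c) \<le> q ^ (n - m)" using assms(3) by (simp add: card_arc)
  qed (use assms in auto)
  finally show ?thesis by (simp add: card_cartesian_product algebra_simps)
qed

lemma card_bad_disjoint_windows:
  assumes "finite S" "S \<subseteq> words q n" "m \<le> n"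
  shows "card {w \<in> words q n. \<exists>s\<in>S. \<exists>i\<in>hits s w m. \<exists>j\<in>hits s w m. arc n i m \<inter> arc n j m = {}}
    \<le> card S * n ^ 4 * q ^ (n - 2 * m)" (is "card ?B \<le> _")
proof -
  let ?X = "\<lambda>(s, i, i', j, j'). {w \<in> words q n. i < n \<and> j < n \<and> arc n i m \<inter> arc n j m = {} \<and>
    agree w i s i' m \<and> agree w j s j' m}"
  let ?C = "S \<times> {..<n} \<times> {..<n} \<times> {..<n} \<times> {..<n}"
  have "?B \<subseteq> (\<Union>c\<in>?C. ?X c)"
  proof
    fix w assume "w \<in> ?B"
    then obtain s i j where *: "w \<in> words q n" "s \<in> S" "i \<in> hits s w m" "j \<in> hits s w m"
      "arc n i m \<inter> arc n j m = {}" by blast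
    moreover have "length w = n" "length s = n" using * assms(2) length_words by blast+
    ultimately obtain i' j' where "i < n" "j < n" "i' < n" "j' < n"
      "agree w i s i' m" "agree w j s j' m" by (auto simp: hits_def)
    then have "(s, i, i', j, j') \<in> ?C" "w \<in> ?X (s, i, i', j, j')" using * by auto
    then show "w \<in> (\<Union>c\<in>?C. ?X c)" by blast
  qed
  then have "card ?B \<le> card (\<Union>c\<in>?C. ?X c)"
    by (intro card_mono) (auto simp: assms(1))
  also have "\<dots> \<le> card ?C * q ^ (n - 2 * m)"
  proof (rule card_UN_le_mult)
    fix c assume "c \<in> ?C"
    then obtain s i i' j j' where c: "c = (s, i, i', j, j')" "i < n" by auto
    show "card (?X c) \<le> q ^ (n - 2 * m)"
    proof (cases "arc n i m \<inter> arc n j m = {}")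
      case True
      have "card (?X c) \<le> q ^ (n - card (arc n i m \<union> arc n j m))"
        unfolding c(1) prod.case
      proof (rule card_words_agreeing)
        fix v w a assume "v \<in> {w \<in> words q n. i < n \<and> j < n \<and> arc n i m \<inter> arc n j m = {} \<and>
            agree w i s i' m \<and> agree w j s j' m}"
          "w \<in> {w \<in> words q n. i < n \<and> j < n \<and> arc n i m \<inter> arc n j m = {} \<and>
            agree w i s i' m \<and> agree w j s j' m}" "a \<in> arc n i m \<union> arc n j m"
        then show "v ! a = w ! a" by (auto simp: arc_def agree_def words_def)
      qed (use c in \<open>auto simp: arc_def\<close>)
      also have "card (arc n i m \<union> arc n j m) = 2 * m"
        using card_Un_disjoint[OF finite_arc finite_arc True] assms(3) by (simp add: card_arc)
      finally show ?thesis .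
    qed (simp add: c)
  qed (use assms in auto)
  also have "card ?C = card S * n ^ 4" by (simp add: card_cartesian_product power4_eq_xxxx)
  finally show ?thesis .
qed

lemma card_bad_few_letters:
  assumes "finite S" "S \<subseteq> words q n"
  shows "card {w \<in> words q n. \<exists>s\<in>S. J < card (hits s w 1)}
    \<le> card S * 2 ^ n * n ^ Suc J * q ^ (n - Suc J)" (is "card ?B \<le> _")
proof -
  let ?A = "{A. A \<subseteq> {..<n} \<and> card A = Suc J}"
  let ?C = "S \<times> (SIGMA A:?A. A \<rightarrow>\<^sub>E {..<n})"
  let ?X = "\<lambda>(s, A, g). {w \<in> words q n. \<forall>i\<in>A. w ! i = s ! (g i)}"
  have finA: "finite ?A" by (rule finite_subset[of _ "Pow {..<n}"]) auto
  have finP: "finite (A \<rightarrow>\<^sub>E {..<n})" if "A \<in> ?A" for A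
  proof -
    have "finite A" using that finite_subset[of A "{..<n}"] by simp
    then show ?thesis by (intro finite_PiE) simp_all
  qed
  have finC: "finite ?C" by (intro finite_cartesian_product finite_SigmaI assms(1) finA finP)
  have "?B \<subseteq> (\<Union>c\<in>?C. ?X c)"
  proof
    fix w assume "w \<in> ?B"
    then obtain s where s: "w \<in> words q n" "s \<in> S" "Suc J \<le> card (hits s w 1)"
      unfolding Suc_le_eq by blast
    have "s \<in> words q n" using s(2) assms(2) by (rule subsetD[rotated])
    then have len: "length w = n" "length s = n" using s(1) by (simp_all add: length_words)
    obtain A where A: "A \<subseteq> hits s w 1" "card A = Suc J" using obtain_subset_with_card_n[OF s(3)] by blast
    have "\<exists>j<n. w ! i = s ! j" if "i \<in> A" for i
    proof -
      have "i \<in> hits s w 1" using that A(1) by blast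
      then obtain j where "i < n" "j < n" "agree w i s j 1" using len by (auto simp: hits_def)
      then show ?thesis using len by (auto simp: agree_def)
    qed
    then obtain g where g: "\<And>i. i \<in> A \<Longrightarrow> g i < n \<and> w ! i = s ! (g i)" by metis
    have "A \<subseteq> {..<n}" using A(1) hits_subset[of s w 1] len by blast
    then have "(s, A, restrict g A) \<in> ?C"
      using s(2) A(2) g by auto
    moreover have "w \<in> ?X (s, A, restrict g A)" using g s(1) by simp
    ultimately show "w \<in> (\<Union>c\<in>?C. ?X c)" by blast
  qed
  then have "card ?B \<le> card (\<Union>c\<in>?C. ?X c)"
    by (rule card_mono[rotated]) (rule finite_subset[of _ "words q n"], auto)
  also have "\<dots> \<le> card ?C * q ^ (n - Suc J)"
  proof (rule card_UN_le_mult[OF finC])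
    fix c assume "c \<in> ?C"
    then obtain s A g where c: "c = (s, A, g)" "A \<subseteq> {..<n}" "card A = Suc J" by auto
    have "card (?X c) \<le> q ^ (n - card A)"
      unfolding c(1) prod.case by (rule card_words_agreeing) (use c in auto)
    then show "card (?X c) \<le> q ^ (n - Suc J)" using c by simp
  qed
  also have "card ?C \<le> card S * (2 ^ n * n ^ Suc J)"
  proof -
    have "card (SIGMA A:?A. A \<rightarrow>\<^sub>E {..<n}) = (\<Sum>A\<in>?A. card (A \<rightarrow>\<^sub>E {..<n}))"
      using finA finP by (intro card_SigmaI) auto
    also have "\<dots> = (\<Sum>A\<in>?A. n ^ Suc J)"
    proof (intro sum.cong refl)
      fix A assume "A \<in> ?A"
      then have "finite A" "card A = Suc J" using finite_subset[of A "{..<n}"] by auto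
      then show "card (A \<rightarrow>\<^sub>E {..<n}) = n ^ Suc J" by (simp add: card_PiE)
    qed
    also have "\<dots> = card ?A * n ^ Suc J" by simp
    also have "card ?A \<le> card (Pow {..<n})" by (intro card_mono) auto
    then have "card ?A * n ^ Suc J \<le> 2 ^ n * n ^ Suc J" by (simp add: card_Pow del: power_Suc)
    finally show ?thesis by (simp add: card_cartesian_product del: power_Suc)
  qed
  then have "card ?C * q ^ (n - Suc J) \<le> card S * (2 ^ n * n ^ Suc J) * q ^ (n - Suc J)"
    by (rule mult_le_mono1)
  finally show ?thesis by (simp add: mult.assoc)
qed

text \<open>Going round the cycle in the other direction if necessary, the two occurrences may be taken
  at distance at most half the length.\<close>

lemma repeated_window_close:
  assumes "\<not> nonrepeating m w"
  shows "\<exists>i<length w. \<exists>d\<in>{1..length w div 2}. agree w i w (i + d) m"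
proof -
  define n where "n = length w"
  obtain i j where ij: "i < n" "j < n" "agree w i w j m" "i \<noteq> j"
    using assms by (auto simp: nonrepeating_def n_def)
  have *: "\<exists>i<n. \<exists>d\<in>{1..n div 2}. agree w i w (i + d) m"
    if ij: "i < j" "j < n" "agree w i w j m" for i j
  proof (cases "j - i \<le> n div 2")
    case True
    then show ?thesis using ij by (intro exI[of _ i] conjI bexI[of _ "j - i"]) auto
  next
    case False
    have "agree w j w (j + (n - (j - i))) m"
      unfolding agree_def
    proof (intro allI impI)
      fix t assume "t < m"
      then have "w ! ((i + t) mod n) = w ! ((j + t) mod n)"
        using ij(3) by (simp add: agree_def n_def)
      moreover have "j + (n - (j - i)) + t = i + t + n" using ij by simp
      then have "(j + (n - (j - i)) + t) mod n = (i + t) mod n" by (metis mod_add_self2)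
      ultimately show "w ! ((j + t) mod length w) = w ! ((j + (n - (j - i)) + t) mod length w)"
        by (simp add: n_def)
    qed
    moreover have "n - (j - i) \<in> {1..n div 2}" using False ij by auto
    ultimately show ?thesis using ij(2) by blast
  qed
  show ?thesis
    using *[of i j] *[of j i] ij agree_sym[OF ij(3)] unfolding n_def by (cases "i < j") auto
qed

text \<open>The second window may overlap the first.  Its letters are still determined by the letters
  outside it: they are copied from position to position, from left to right.  This would fail
  if the two windows overlapped at both ends, which is why \<open>m\<close> and the distance are bounded
  by half the length.\<close>

lemma card_bad_repeating:
  assumes m: "m \<le> n div 2"
  shows "card {w \<in> words q n. \<not> nonrepeating m w} \<le> n * n * q ^ (n - m)" (is "card ?B \<le> _")
proof -
  let ?C = "{..<n} \<times> {1..n div 2}"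
  let ?X = "\<lambda>(i, d). {w \<in> words q n. agree w i w (i + d) m}"
  have "?B \<subseteq> (\<Union>c\<in>?C. ?X c)"
  proof
    fix w assume w: "w \<in> ?B"
    then have "length w = n" using length_words by blast
    then obtain i d where "i < n" "d \<in> {1..n div 2}" "agree w i w (i + d) m"
      using repeated_window_close[of m w] w by auto
    then have "(i, d) \<in> ?C" "w \<in> ?X (i, d)" using w by auto
    then show "w \<in> (\<Union>c\<in>?C. ?X c)" by blast
  qed
  then have "card ?B \<le> card (\<Union>c\<in>?C. ?X c)"
    by (rule card_mono[rotated]) (rule finite_subset[of _ "words q n"], auto)
  also have "\<dots> \<le> card ?C * q ^ (n - m)"
  proof (rule card_UN_le_mult)
    fix c assume "c \<in> ?C"
    then obtain i d where c: "c = (i, d)" "i < n" "1 \<le> d" "d \<le> n div 2" by auto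
    have dm: "d + m \<le> n" using c m by linarith
    have "card (?X c) \<le> q ^ (n - card (arc n (i + d) m))"
      unfolding c(1) prod.case
    proof (rule card_words_determined)
      fix v w assume v: "v \<in> {w \<in> words q n. agree w i w (i + d) m}"
        and w: "w \<in> {w \<in> words q n. agree w i w (i + d) m}"
        and out: "\<And>a. a < n \<Longrightarrow> a \<notin> arc n (i + d) m \<Longrightarrow> v ! a = w ! a"
      have len: "length v = n" "length w = n" using v w length_words by blast+
      have copy: "u ! ((i + d + t) mod n) = u ! ((i + t) mod n)"
        if "u = v \<or> u = w" "t < m" for u t
        using that v w len by (auto simp: agree_def)
      have inside: "t < m \<Longrightarrow> v ! ((i + d + t) mod n) = w ! ((i + d + t) mod n)" for t
      proof (induction t rule: less_induct)
        case (less t)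
        have "v ! ((i + t) mod n) = w ! ((i + t) mod n)"
        proof (cases "d \<le> t")
          case True
          then show ?thesis using less.IH[of "t - d"] less.prems c by (simp add: add.assoc)
        next
          case False
          have "(i + t) mod n \<notin> arc n (i + d) m"
          proof
            assume "(i + t) mod n \<in> arc n (i + d) m"
            then obtain t' where t': "t' < m" "(i + t) mod n = (i + (d + t')) mod n"
              by (auto simp: arc_def add.assoc)
            moreover have "t < n" "d + t' < n" using False dm t'(1) c by auto
            ultimately have "t = d + t'" by (intro add_mod_cancel[of i t n "d + t'"])
            then show False using False by simp
          qed
          then show ?thesis using out c by simp
        qed
        then show ?case using copy[of v t] copy[of w t] less.prems by simp
      qed
      show "v = w"
      proof (rule nth_equalityI)
        fix a assume "a < length v"
        then show "v ! a = w ! a"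
          using out[of a] inside len by (cases "a \<in> arc n (i + d) m") (auto simp: arc_def)
      qed (use len in simp)
    qed (use c in \<open>auto simp: arc_def\<close>)
    then show "card (?X c) \<le> q ^ (n - m)" using dm by (simp add: card_arc)
  qed simp
  also have "card ?C = n * (n div 2)" by (simp add: card_cartesian_product)
  then have "card ?C * q ^ (n - m) \<le> n * n * q ^ (n - m)" by (intro mult_le_mono1) simp
  finally show ?thesis .
qed

lemma exists_word_avoiding:
  assumes "card {w \<in> words q n. P w} < q ^ n"
  shows "\<exists>w\<in>words q n. \<not> P w"
proof (rule ccontr)
  assume "\<not> ?thesis"
  then have "{w \<in> words q n. P w} = words q n" by auto
  then show False using assms card_words by simp
qed

section \<open>Words far from a given set of words\<close>

text \<open>The words of \<open>S\<close> play the role of representatives of the centres.\<close>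

definition far_word_exists :: "nat \<Rightarrow> nat \<Rightarrow> nat \<Rightarrow> real \<Rightarrow> bool" where
  "far_word_exists q n k B \<longleftrightarrow>
    (\<forall>S. finite S \<and> S \<subseteq> words q n \<and> card S \<le> k \<longrightarrow>
      (\<exists>w\<in>words q n. \<forall>s\<in>S. real (overlap w s) \<le> B))"

lemma far_word_existsI:
  assumes "\<And>S. finite S \<Longrightarrow> S \<subseteq> words q n \<Longrightarrow> card S \<le> k \<Longrightarrow>
    \<exists>w\<in>words q n. \<forall>s\<in>S. real (overlap w s) \<le> B"
  shows "far_word_exists q n k B"
  unfolding far_word_exists_def by (intro allI impI, elim conjE) (rule assms)

lemma far_word_exists_mono: "far_word_exists q n k B \<Longrightarrow> B \<le> B' \<Longrightarrow> far_word_exists q n k B'"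
  unfolding far_word_exists_def by (meson order_trans)

lemma far_word_missing_letter:
  assumes "k * n < q"
  shows "far_word_exists q n k 0"
proof (rule far_word_existsI)
  fix S assume S: "finite S" "S \<subseteq> words q n" "card S \<le> k"
  have "card (\<Union>s\<in>S. set s) \<le> card S * n"
    using S by (intro card_UN_le_mult) (auto simp: words_def intro: card_length)
  also have "\<dots> \<le> k * n" using S(3) by simp
  finally have "card (\<Union>s\<in>S. set s) < card {..<q}" using assms by simp
  moreover have "finite (\<Union>s\<in>S. set s)" using S by simp
  ultimately have "\<not> {..<q} \<subseteq> (\<Union>s\<in>S. set s)" using card_mono by (metis not_less)
  then obtain a where a: "a < q" "\<And>s. s \<in> S \<Longrightarrow> a \<notin> set s" by auto
  have "replicate n a \<in> words q n" using a by (auto simp: words_def)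
  moreover have "overlap (replicate n a) s = 0" if "s \<in> S" for s
    using overlap_missing_letter[OF a(2)[OF that]] that S(2) by (auto simp: words_def)
  ultimately show "\<exists>w\<in>words q n. \<forall>s\<in>S. real (overlap w s) \<le> 0" by auto
qed

lemma far_word_not_rotation:
  assumes "k * n < q ^ n" "n > 0"
  shows "far_word_exists q n k (real n ^ 2 - real n)"
proof (rule far_word_existsI)
  fix S assume S: "finite S" "S \<subseteq> words q n" "card S \<le> k"
  have "card {w \<in> words q n. \<exists>s\<in>S. \<exists>l. w = rotate l s} \<le> card S * n"
    using S assms by (intro card_bad_rotations)
  also have "\<dots> \<le> k * n" using S(3) by simp
  finally obtain w where w: "w \<in> words q n" "\<And>s l. s \<in> S \<Longrightarrow> w \<noteq> rotate l s"
    using exists_word_avoiding[of q n "\<lambda>w. \<exists>s\<in>S. \<exists>l. w = rotate l s"] assms(1) by auto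
  have "real (overlap w s) \<le> real n ^ 2 - real n" if "s \<in> S" for s
  proof -
    have "length w = n" "length s = n" using w(1) that S(2) length_words by blast+
    then have "overlap w s + n \<le> n ^ 2"
      using overlap_not_rotation[of s w] w(2)[OF that] assms(2) by fastforce
    then have "real (overlap w s + n) \<le> real (n ^ 2)" by (rule of_nat_mono)
    then show ?thesis by simp
  qed
  then show "\<exists>w\<in>words q n. \<forall>s\<in>S. real (overlap w s) \<le> real n ^ 2 - real n" using w(1) by blast
qed

lemma power_diff_mult:
  fixes q :: nat
  assumes "c < q ^ m" "m \<le> n" "0 < q"
  shows "c * q ^ (n - m) < q ^ n"
proof -
  have "c * q ^ (n - m) < q ^ m * q ^ (n - m)" using assms by simp
  also have "\<dots> = q ^ n" using assms(2) by (simp flip: power_add)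
  finally show ?thesis .
qed

lemma far_word_few_letters:
  assumes "k * 2 ^ n * n ^ Suc J < q ^ Suc J" "J < n" "0 < q"
  shows "far_word_exists q n k (real J * (real J + 1) / 2)"
proof (rule far_word_existsI)
  fix S assume S: "finite S" "S \<subseteq> words q n" "card S \<le> k"
  have "card {w \<in> words q n. \<exists>s\<in>S. J < card (hits s w 1)}
      \<le> card S * 2 ^ n * n ^ Suc J * q ^ (n - Suc J)"
    using S by (intro card_bad_few_letters)
  also have "\<dots> \<le> k * 2 ^ n * n ^ Suc J * q ^ (n - Suc J)"
    using S(3) by (intro mult_le_mono1)
  also have "\<dots> < q ^ n" using assms by (intro power_diff_mult) auto
  finally obtain w where w: "w \<in> words q n" "\<And>s. s \<in> S \<Longrightarrow> card (hits s w 1) \<le> J"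
    using exists_word_avoiding[of q n "\<lambda>w. \<exists>s\<in>S. J < card (hits s w 1)"] by (auto simp: not_less)
  have "real (overlap w s) \<le> real J * (real J + 1) / 2" if "s \<in> S" for s
  proof -
    have "length w = n" "length s = n" using w(1) that S(2) length_words by blast+
    then have "2 * overlap w s \<le> J * (J + 1)"
      using overlap_few_letters[of s w J] w(2)[OF that] assms(2) by simp
    then have "real (2 * overlap w s) \<le> real (J * (J + 1))" by (rule of_nat_mono)
    then show ?thesis by (simp add: algebra_simps)
  qed
  then show "\<exists>w\<in>words q n. \<forall>s\<in>S. real (overlap w s) \<le> real J * (real J + 1) / 2"
    using w(1) by blast
qed

lemma far_word_disjoint_windows:
  assumes "k * n ^ 4 < q ^ (2 * \<mu>)" "0 < \<mu>" "2 * \<mu> \<le> n" "0 < q"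
  shows "far_word_exists q n k (real n * (real \<mu> - 1) + 2 * real \<mu> ^ 2)"
proof (rule far_word_existsI)
  fix S assume S: "finite S" "S \<subseteq> words q n" "card S \<le> k"
  let ?P = "\<lambda>w. \<exists>s\<in>S. \<exists>i\<in>hits s w \<mu>. \<exists>j\<in>hits s w \<mu>. arc n i \<mu> \<inter> arc n j \<mu> = {}"
  have "card {w \<in> words q n. ?P w} \<le> card S * n ^ 4 * q ^ (n - 2 * \<mu>)"
    using S assms(3) by (intro card_bad_disjoint_windows) auto
  also have "\<dots> \<le> k * n ^ 4 * q ^ (n - 2 * \<mu>)"
    using S(3) by (intro mult_le_mono1)
  also have "\<dots> < q ^ n" using assms by (intro power_diff_mult) auto
  finally obtain w where w: "w \<in> words q n" "\<not> ?P w"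
    using exists_word_avoiding[of q n ?P] by blast
  have "real (overlap w s) \<le> real n * (real \<mu> - 1) + 2 * real \<mu> ^ 2" if "s \<in> S" for s
  proof -
    have len: "length w = n" "length s = n" using w(1) that S(2) length_words by blast+
    have "overlap w s \<le> length w * (\<mu> - 1) + 2 * \<mu> ^ 2"
      using w(2) that len assms by (intro overlap_no_disjoint_windows) auto
    then have "real (overlap w s) \<le> real (n * (\<mu> - 1) + 2 * \<mu> ^ 2)"
      unfolding len by (rule of_nat_mono)
    then show ?thesis using assms(2) by (simp add: of_nat_diff)
  qed
  then show "\<exists>w\<in>words q n. \<forall>s\<in>S. real (overlap w s) \<le> real n * (real \<mu> - 1) + 2 * real \<mu> ^ 2"
    using w(1) by blast
qed

lemma rotation_hits_full:
  assumes "length s = length w" "w = rotate l s" "w \<noteq> []"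
  shows "hits s w (length w) \<noteq> {}"
proof -
  define n where "n = length s"
  have len: "length w = n" "length s = n" using assms(1) by (simp_all add: n_def)
  have n: "n > 0" using assms(3) len by auto
  have nth: "w ! t = s ! ((l + t) mod n)" if "t < n" for t
    unfolding assms(2) using nth_rotate[of t s l] that len by simp
  have "agree w 0 s (l mod n) n"
    unfolding agree_def len
  proof (intro allI impI)
    fix t assume "t < n"
    then show "w ! ((0 + t) mod n) = s ! ((l mod n + t) mod n)"
      using nth[of t] by (simp add: mod_add_left_eq)
  qed
  moreover have "l mod n < n" using n by simp
  ultimately have "0 \<in> hits s w n" unfolding hits_def len using n by blast
  then show ?thesis unfolding len by blast
qed

lemma real_overlap_triangle:
  assumes "length w = n" "length s = n" "nonrepeating m w" "\<And>l. w \<noteq> rotate l s"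
    "hits s w (Suc M) = {}" "m \<le> M" "M \<le> n"
  shows "real (overlap w s) \<le> real n * real M - (real M - real m) ^ 2 / 2"
proof -
  have "hits s w (Suc m) \<noteq> {..<length w}"
    using assms by (intro nonrepeating_not_all_hits) auto
  then have "2 * overlap w s + (M - m) * (M - m + 1) \<le> 2 * length w * M"
    using assms by (intro overlap_triangle) auto
  then have "2 * overlap w s + (M - m) ^ 2 \<le> 2 * n * M"
    using assms(1) by (simp add: power2_eq_square)
  then have "real (2 * overlap w s + (M - m) ^ 2) \<le> real (2 * n * M)" by (rule of_nat_mono)
  then show ?thesis using assms(6) by (simp add: of_nat_diff algebra_simps)
qed

lemma quarter_of_repeating:
  assumes "4 * n ^ 2 \<le> q ^ m" "m \<le> n div 2"
  shows "4 * card {w \<in> words q n. \<not> nonrepeating m w} \<le> q ^ n"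
proof -
  have "4 * card {w \<in> words q n. \<not> nonrepeating m w} \<le> 4 * (n * n * q ^ (n - m))"
    using card_bad_repeating[OF assms(2)] by simp
  also have "\<dots> = 4 * n ^ 2 * q ^ (n - m)" by (simp add: power2_eq_square)
  also have "\<dots> \<le> q ^ m * q ^ (n - m)" using assms(1) by simp
  also have "\<dots> = q ^ n" using assms(2) by (simp flip: power_add)
  finally show ?thesis .
qed

lemma far_word_short_windows:
  assumes "4 * n ^ 2 \<le> q ^ m" "m \<le> n div 2" "2 * k * n ^ 2 \<le> q ^ Suc M" "m \<le> M" "M < n" "0 < q"
  shows "far_word_exists q n k (real n * real M - (real M - real m) ^ 2 / 2)"
proof (rule far_word_existsI)
  fix S assume S: "finite S" "S \<subseteq> words q n" "card S \<le> k"
  let ?P = "\<lambda>w. \<exists>s\<in>S. hits s w (Suc M) \<noteq> {}"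
  let ?R = "\<lambda>w. \<not> nonrepeating m w"
  have "2 * card {w \<in> words q n. ?P w} \<le> 2 * (card S * n * n * q ^ (n - Suc M))"
    using S assms(5) card_bad_window[of S q n "Suc M"] by simp
  also have "\<dots> \<le> 2 * (k * n * n * q ^ (n - Suc M))"
    using S(3) by (intro mult_le_mono2 mult_le_mono1)
  also have "\<dots> = 2 * k * n ^ 2 * q ^ (n - Suc M)" by (simp add: power2_eq_square)
  also have "\<dots> \<le> q ^ Suc M * q ^ (n - Suc M)" using assms(3) by (rule mult_le_mono1)
  also have "\<dots> = q ^ n" using assms(5) by (simp flip: power_add del: power_Suc)
  finally have P: "2 * card {w \<in> words q n. ?P w} \<le> q ^ n" .
  have "{w \<in> words q n. ?P w \<or> ?R w} = {w \<in> words q n. ?P w} \<union> {w \<in> words q n. ?R w}" by auto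
  then have "card {w \<in> words q n. ?P w \<or> ?R w}
      \<le> card {w \<in> words q n. ?P w} + card {w \<in> words q n. ?R w}"
    by (simp add: card_Un_le)
  moreover have "0 < q ^ n" using assms(6) by simp
  ultimately have "card {w \<in> words q n. ?P w \<or> ?R w} < q ^ n"
    using P quarter_of_repeating[OF assms(1,2)] by linarith
  then obtain w where w: "w \<in> words q n" "\<not> (?P w \<or> ?R w)"
    using exists_word_avoiding[of q n "\<lambda>w. ?P w \<or> ?R w"] by blast
  have "real (overlap w s) \<le> real n * real M - (real M - real m) ^ 2 / 2" if "s \<in> S" for s
  proof -
    have len: "length w = n" "length s = n" using w(1) that S(2) length_words by blast+
    have e: "hits s w (Suc M) = {}" using w(2) that by blast
    have "hits s w n = {}" using hits_eq_empty_mono[OF e] assms(5) by simp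
    then have empty: "hits s w (length w) = {}" using len by simp
    have nrot: "w \<noteq> rotate l s" for l
    proof
      assume "w = rotate l s"
      then have "hits s w (length w) \<noteq> {}"
        using len assms(5) by (intro rotation_hits_full) auto
      then show False using empty by blast
    qed
    have "nonrepeating m w" using w(2) by blast
    then show ?thesis
      using real_overlap_triangle[OF len _ nrot e] assms(4,5) by simp
  qed
  then show "\<exists>w\<in>words q n. \<forall>s\<in>S. real (overlap w s)
      \<le> real n * real M - (real M - real m) ^ 2 / 2" using w(1) by blast
qed

lemma far_word_nonrepeating:
  assumes "4 * n ^ 2 \<le> q ^ m" "m \<le> n div 2" "4 * (k * n) < 3 * q ^ n" "0 < n"
  shows "far_word_exists q n k (real n * (real n - 1) - (real n - 1 - real m) ^ 2 / 2)"
proof (rule far_word_existsI)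
  fix S assume S: "finite S" "S \<subseteq> words q n" "card S \<le> k"
  let ?P = "\<lambda>w. \<exists>s\<in>S. \<exists>l. w = rotate l s"
  let ?R = "\<lambda>w. \<not> nonrepeating m w"
  have mn: "m \<le> n - 1" using assms(2,4) by linarith
  have "card {w \<in> words q n. ?P w} \<le> card S * n"
    using S assms by (intro card_bad_rotations)
  also have "\<dots> \<le> k * n" using S(3) by simp
  finally have P: "card {w \<in> words q n. ?P w} \<le> k * n" .
  have "{w \<in> words q n. ?P w \<or> ?R w} = {w \<in> words q n. ?P w} \<union> {w \<in> words q n. ?R w}" by auto
  then have "card {w \<in> words q n. ?P w \<or> ?R w}
      \<le> card {w \<in> words q n. ?P w} + card {w \<in> words q n. ?R w}"
    by (simp add: card_Un_le)
  then have "card {w \<in> words q n. ?P w \<or> ?R w} < q ^ n"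
    using P quarter_of_repeating[OF assms(1,2)] assms(3) by linarith
  then obtain w where w: "w \<in> words q n" "\<not> (?P w \<or> ?R w)"
    using exists_word_avoiding[of q n "\<lambda>w. ?P w \<or> ?R w"] by blast
  have "real (overlap w s) \<le> real n * real (n - 1) - (real (n - 1) - real m) ^ 2 / 2" if "s \<in> S" for s
  proof -
    have len: "length w = n" "length s = n" using w(1) that S(2) length_words by blast+
    have nr: "w \<noteq> rotate l s" for l using w(2) that by blast
    have "hits s w (length w) = {}" using hits_full_length_empty[of s w] nr len by simp
    then have e: "hits s w (Suc (n - 1)) = {}" using len assms(4) by simp
    have "nonrepeating m w" using w(2) by blast
    then show ?thesis
      using real_overlap_triangle[OF len _ nr e mn] by simp
  qed
  then show "\<exists>w\<in>words q n. \<forall>s\<in>S. real (overlap w s)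
      \<le> real n * (real n - 1) - (real n - 1 - real m) ^ 2 / 2"
    using w(1) assms(4) by (auto simp: of_nat_diff)
qed

section \<open>Periodic words\<close>

text \<open>The last period may be incomplete, so the cyclic word has a seam at position \<open>n\<close>.\<close>

definition periodic_word :: "nat \<Rightarrow> 'a list \<Rightarrow> 'a list" where
  "periodic_word n u = map (\<lambda>i. u ! (i mod length u)) [0..<n]"

lemma length_periodic_word [simp]: "length (periodic_word n u) = n"
  by (simp add: periodic_word_def)

lemma nth_periodic_word: "i < n \<Longrightarrow> periodic_word n u ! i = u ! (i mod length u)"
  by (simp add: periodic_word_def)

lemma card_words_with_rotation_at:
  assumes "0 < p"
  shows "card {u \<in> words q p. i \<in> hits u s p} \<le> p"
proof -
  have "{u \<in> words q p. i \<in> hits u s p} \<subseteq> (\<Union>r\<in>{..<p}. {u \<in> words q p. agree s i u r p})"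
    using length_words by (fastforce simp: hits_def)
  then have "card {u \<in> words q p. i \<in> hits u s p}
      \<le> card (\<Union>r\<in>{..<p}. {u \<in> words q p. agree s i u r p})"
    by (rule card_mono[rotated]) (rule finite_subset[of _ "words q p"], auto)
  also have "\<dots> \<le> card {..<p} * 1"
  proof (rule card_UN_le_mult)
    fix r
    have "card {u \<in> words q p. agree s i u r p} \<le> q ^ (p - card (arc p r p))"
    proof (rule card_words_agreeing)
      fix v w a assume v: "v \<in> {u \<in> words q p. agree s i u r p}"
        and w: "w \<in> {u \<in> words q p. agree s i u r p}" and "a \<in> arc p r p"
      then obtain t where t: "t < p" "a = (r + t) mod p" by (auto simp: arc_def)
      have "length v = p" "length w = p" using v w length_words by blast+
      then have "s ! ((i + t) mod length s) = v ! a" "s ! ((i + t) mod length s) = w ! a"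
        using v w t by (auto simp: agree_def)
      then show "v ! a = w ! a" by simp
    qed (use assms in \<open>auto simp: arc_def\<close>)
    then show "card {u \<in> words q p. agree s i u r p} \<le> 1" by (simp add: card_arc)
  qed simp
  finally show ?thesis by simp
qed

text \<open>Averaging: every position of every word of \<open>S\<close> carries a rotation of at most \<open>p\<close> words of
  length \<open>p\<close>, so the hits of all \<open>q ^ p\<close> periods together number at most \<open>k * n * p\<close>.\<close>

lemma exists_rarely_occurring_period:
  assumes S: "finite S" "S \<subseteq> words q n" "card S \<le> k" and p: "0 < p"
    and avg: "k * n * p < q ^ p * Suc \<rho>"
  shows "\<exists>u\<in>words q p. \<forall>s\<in>S. card (hits u s p) \<le> \<rho>"
proof (rule ccontr)
  assume "\<not> ?thesis"
  then have big: "\<And>u. u \<in> words q p \<Longrightarrow> \<exists>s\<in>S. Suc \<rho> \<le> card (hits u s p)"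
    by (auto simp: not_le Suc_le_eq)
  have "q ^ p * Suc \<rho> = (\<Sum>u\<in>words q p. Suc \<rho>)" by (simp add: card_words)
  also have "\<dots> \<le> (\<Sum>u\<in>words q p. \<Sum>s\<in>S. card (hits u s p))"
  proof (rule sum_mono)
    fix u assume "u \<in> words q p"
    then obtain s where "s \<in> S" "Suc \<rho> \<le> card (hits u s p)" using big by blast
    then show "Suc \<rho> \<le> (\<Sum>s\<in>S. card (hits u s p))"
      using member_le_sum[of s S "\<lambda>s. card (hits u s p)"] S(1) by simp
  qed
  also have "\<dots> = (\<Sum>s\<in>S. \<Sum>u\<in>words q p. card (hits u s p))" by (rule sum.swap)
  also have "\<dots> \<le> (\<Sum>s\<in>S. n * p)"
  proof (rule sum_mono)
    fix s assume "s \<in> S"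
    then have len: "length s = n" using S(2) length_words by blast
    have "(\<Sum>u\<in>words q p. card (hits u s p))
        = (\<Sum>u\<in>words q p. \<Sum>i<n. if i \<in> hits u s p then 1 else 0)"
    proof (rule sum.cong[OF refl])
      fix u
      have "hits u s p = {i \<in> {..<n}. i \<in> hits u s p}"
        using hits_subset[of u s p] len by auto
      then show "card (hits u s p) = (\<Sum>i<n. if i \<in> hits u s p then 1 else 0)"
        by (simp flip: sum.inter_filter)
    qed
    also have "\<dots> = (\<Sum>i<n. \<Sum>u\<in>words q p. if i \<in> hits u s p then 1 else 0)"
      by (rule sum.swap)
    also have "\<dots> = (\<Sum>i<n. card {u \<in> words q p. i \<in> hits u s p})"
      by (simp flip: sum.inter_filter)
    also have "\<dots> \<le> (\<Sum>i<n. p)"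
      using card_words_with_rotation_at[OF p] by (intro sum_mono) auto
    finally show "(\<Sum>u\<in>words q p. card (hits u s p)) \<le> n * p" by simp
  qed
  also have "\<dots> \<le> k * n * p" using S(3) by simp
  finally show False using avg by simp
qed

text \<open>A periodic stretch of \<open>\<rho> + p\<close> letters contains \<open>\<rho> + 1\<close> windows that are rotations of the
  period.\<close>

lemma card_hits_of_periodic_run:
  assumes len: "length s = n" "length u = p" and p: "0 < p" and \<rho>: "\<rho> < n"
    and run: "\<And>t. t < \<rho> + p \<Longrightarrow> s ! ((i + t) mod n) = u ! ((c + t) mod p)"
  shows "\<rho> < card (hits u s p)"
proof -
  have "arc n i (Suc \<rho>) \<subseteq> hits u s p"
  proof
    fix a assume "a \<in> arc n i (Suc \<rho>)"
    then obtain l where l: "l \<le> \<rho>" "a = (i + l) mod n"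
      unfolding arc_def using less_Suc_eq_le by blast
    have "agree s a u ((c + l) mod p) p"
      unfolding agree_def
    proof (intro allI impI)
      fix t assume "t < p"
      then have "s ! ((i + (l + t)) mod n) = u ! ((c + (l + t)) mod p)"
        using l(1) by (intro run) simp
      then show "s ! ((a + t) mod length s) = u ! (((c + l) mod p + t) mod length u)"
        unfolding l(2) len mod_add_left_eq by (simp add: add.assoc)
    qed
    moreover have "a < length s" using l \<rho> len by simp
    moreover have "(c + l) mod p < length u" using p len by simp
    ultimately show "a \<in> hits u s p" unfolding hits_def by blast
  qed
  then have "card (arc n i (Suc \<rho>)) \<le> card (hits u s p)" by (intro card_mono) simp
  then show ?thesis using \<rho> by (simp add: card_arc)
qed

lemma size_inter_union_le:
  "size (A \<inter># (B + C)) \<le> size (A \<inter># B) + size C"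
proof -
  have "A \<inter># (B + C) \<subseteq># (A \<inter># B) + C"
    by (auto simp: subseteq_mset_def)
  then show ?thesis using size_mset_mono by fastforce
qed

text \<open>Windows of the periodic word that avoid the seam begin with a rotation of \<open>u\<close>, and these are
  rare in \<open>s\<close>.  Counting occurrences in \<open>s\<close>, not positions of the periodic word, is essential
  here, because each of its windows is repeated many times.  Fewer than \<open>m\<close> windows cross the
  seam.\<close>

lemma size_inter_level_periodic:
  assumes len: "length s = n" "length u = p" and p: "0 < p" "p \<le> m" "m \<le> n"
  shows "size (level m (periodic_word n u) \<inter># level m s) \<le> card (hits u s p) + m"
proof -
  let ?w = "periodic_word n u"
  let ?f = "\<lambda>i. take m (rotate i ?w)"
  let ?B = "image_mset ?f (mset_set {..n - m})" and ?C = "image_mset ?f (mset_set {n - m<..<n})"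
  have "{..n - m} \<union> {n - m<..<n} = {..<n}" using p by auto
  moreover have "mset_set ({..n - m} \<union> {n - m<..<n}) = mset_set {..n - m} + mset_set {n - m<..<n}"
    by (rule mset_set_Union) auto
  ultimately have "mset_set {..<n} = mset_set {..n - m} + mset_set {n - m<..<n}" by argo
  then have split: "level m ?w = ?B + ?C" by (simp add: level_def)
  have "size (level m s \<inter># ?B) \<le> card {i \<in> {..<n}. take m (rotate i s) \<in># ?B}"
    using size_inter_image_mset_le[of "{..<n}" "\<lambda>i. take m (rotate i s)" ?B] len
    by (simp add: level_def)
  also have "\<dots> \<le> card (hits u s p)"
  proof (intro card_mono subsetI)
    fix i assume "i \<in> {i \<in> {..<n}. take m (rotate i s) \<in># ?B}"
    then obtain a where i: "i < n" and a: "a \<le> n - m" "take m (rotate i s) = take m (rotate a ?w)"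
      by auto
    then have ag: "agree s i ?w a m"
      using take_rotate_eq_iff_agree[of m s ?w i a] len p by simp
    have "agree s i u (a mod p) p"
      unfolding agree_def
    proof (intro allI impI)
      fix t assume t: "t < p"
      then have "s ! ((i + t) mod n) = ?w ! ((a + t) mod n)"
        using ag p len by (auto simp: agree_def)
      also have "\<dots> = u ! ((a + t) mod p)"
        using a(1) t p len by (simp add: nth_periodic_word)
      finally show "s ! ((i + t) mod length s) = u ! ((a mod p + t) mod length u)"
        by (simp add: len mod_add_left_eq)
    qed
    moreover have "a mod p < length u" using p len by simp
    ultimately show "i \<in> hits u s p" using i len unfolding hits_def by blast
  qed simp
  finally have "size (level m s \<inter># ?B) \<le> card (hits u s p)" .
  moreover have "size (level m s \<inter># level m ?w) \<le> size (level m s \<inter># ?B) + size ?C"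
    unfolding split by (rule size_inter_union_le)
  moreover have "size ?C \<le> m" using p by simp
  moreover have "level m ?w \<inter># level m s = level m s \<inter># level m ?w"
    by (rule subset_mset.inf_commute)
  ultimately show ?thesis by simp
qed

text \<open>Of a window of length \<open>2 * (\<rho> + p)\<close>, at least half lies on one side of the seam, and
  this half is a longer periodic stretch than \<open>s\<close> can contain.\<close>

lemma level_periodic_disjoint:
  assumes len: "length s = n" "length u = p" and p: "0 < p" "\<rho> + p \<le> n" "2 * (\<rho> + p) \<le> m" "m \<le> n"
    and few: "card (hits u s p) \<le> \<rho>"
  shows "level m (periodic_word n u) \<inter># level m s = {#}"
proof (rule ccontr)
  let ?w = "periodic_word n u"
  assume "level m ?w \<inter># level m s \<noteq> {#}"
  then obtain v where "v \<in># level m ?w \<inter># level m s" by blast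
  then obtain a i where a: "a < n" "i < n" "take m (rotate i s) = take m (rotate a ?w)"
    using len by (auto simp: level_def)
  then have ag: "agree s i ?w a m"
    using take_rotate_eq_iff_agree[of m s ?w i a] len p by simp
  have eq: "s ! ((i + t) mod n) = ?w ! ((a + t) mod n)" if "t < m" for t
    using ag that len by (simp add: agree_def)
  have "\<rho> < card (hits u s p)"
  proof (cases "a + (\<rho> + p) \<le> n")
    case True
    show ?thesis
    proof (rule card_hits_of_periodic_run[OF len p(1)])
      fix t assume "t < \<rho> + p"
      then show "s ! ((i + t) mod n) = u ! ((a + t) mod p)"
        using eq[of t] True p len by (simp add: nth_periodic_word)
    qed (use p in simp)
  next
    case False
    show ?thesis
    proof (rule card_hits_of_periodic_run[OF len p(1)])
      fix t assume t: "t < \<rho> + p"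
      have "a + (n - a + t) = n + t" using a by simp
      then have "(a + (n - a + t)) mod n = t" using t p by simp
      then show "s ! ((i + (n - a) + t) mod n) = u ! ((0 + t) mod p)"
        using eq[of "n - a + t"] False t p len by (simp add: nth_periodic_word add.assoc)
    qed (use p in simp)
  qed
  then show False using few by simp
qed

lemma overlap_periodic:
  assumes len: "length s = n" "length u = p" and p: "0 < p" "\<rho> + p \<le> n"
    and few: "card (hits u s p) \<le> \<rho>"
  shows "overlap (periodic_word n u) s \<le> n * (p - 1) + 6 * (\<rho> + p) ^ 2"
proof -
  let ?w = "periodic_word n u"
  let ?c = "\<lambda>m. size (level m ?w \<inter># level m s)"
  let ?T = "2 * (\<rho> + p)"
  have "overlap ?w s = (\<Sum>m = 1..n. ?c m)" using overlap_levels[of s ?w] len by simp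
  also have "\<dots> = (\<Sum>m \<in> {1..n} \<inter> {1..<?T}. ?c m)"
  proof (rule sum.mono_neutral_right)
    have "?c m = 0" if "?T \<le> m" "m \<le> n" for m
      using level_periodic_disjoint[OF len p that few] by simp
    moreover have "?T \<le> m" "m \<le> n" if "m \<in> {1..n} - {1..n} \<inter> {1..<?T}" for m
      using that by auto
    ultimately show "\<forall>m\<in>{1..n} - {1..n} \<inter> {1..<?T}. ?c m = 0" by blast
  qed auto
  also have "\<dots> \<le> (\<Sum>m \<in> {1..n} \<inter> {1..<?T}. if m < p then n else 3 * (\<rho> + p))"
  proof (rule sum_mono)
    fix m assume m: "m \<in> {1..n} \<inter> {1..<?T}"
    have "?c m \<le> n"
      using size_inter_level_le_card_hits[of s ?w m] card_hits_le[of s ?w m] m len by simp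
    moreover have "?c m \<le> 3 * (\<rho> + p)" if "p \<le> m"
      using size_inter_level_periodic[OF len p(1) that] m few by simp
    ultimately show "?c m \<le> (if m < p then n else 3 * (\<rho> + p))" by simp
  qed
  also have "\<dots> \<le> (\<Sum>m \<in> {1..<?T}. if m < p then n else 3 * (\<rho> + p))"
    by (intro sum_mono2) auto
  also have "{1..<?T} = {1..<p} \<union> {p..<?T}" using p by auto
  also have "(\<Sum>m\<in>\<dots>. if m < p then n else 3 * (\<rho> + p))
      = (p - 1) * n + (?T - p) * (3 * (\<rho> + p))"
    by (subst sum.union_disjoint) auto
  also have "\<dots> \<le> (p - 1) * n + ?T * (3 * (\<rho> + p))" by (intro add_mono mult_mono) auto
  also have "\<dots> = n * (p - 1) + 6 * (\<rho> + p) ^ 2" by (simp add: power2_eq_square algebra_simps)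
  finally show ?thesis .
qed

lemma periodic_word_in_words:
  assumes "u \<in> words q p" "0 < p"
  shows "periodic_word n u \<in> words q n"
proof -
  have "u ! (i mod p) < q" for i
  proof -
    have "i mod p < length u" using assms length_words by fastforce
    then show ?thesis using assms(1) nth_mem by (fastforce simp: words_def)
  qed
  then show ?thesis using length_words[OF assms(1)] by (auto simp: words_def periodic_word_def)
qed

text \<open>The levels below the period contribute \<open>n\<close> each, all others together only the square of a
  small number.\<close>

lemma far_word_periodic:
  assumes "0 < p" "\<rho> + p \<le> n" "k * n * p < q ^ p * Suc \<rho>"
  shows "far_word_exists q n k (real n * (real p - 1) + 6 * (real \<rho> + real p) ^ 2)"
proof (rule far_word_existsI)
  fix S assume S: "finite S" "S \<subseteq> words q n" "card S \<le> k"
  obtain u where u: "u \<in> words q p" "\<And>s. s \<in> S \<Longrightarrow> card (hits u s p) \<le> \<rho>"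
    using exists_rarely_occurring_period[OF S assms(1,3)] by blast
  have "real (overlap (periodic_word n u) s) \<le> real n * (real p - 1) + 6 * (real \<rho> + real p) ^ 2"
    if "s \<in> S" for s
  proof -
    have "length s = n" using that S(2) length_words by blast
    then have "overlap (periodic_word n u) s \<le> n * (p - 1) + 6 * (\<rho> + p) ^ 2"
      using u(2)[OF that] length_words[OF u(1)] assms by (intro overlap_periodic) auto
    then have "real (overlap (periodic_word n u) s) \<le> real (n * (p - 1) + 6 * (\<rho> + p) ^ 2)"
      by (rule of_nat_mono)
    then show ?thesis using assms(1) by (simp add: of_nat_diff)
  qed
  then show "\<exists>w\<in>words q n. \<forall>s\<in>S. real (overlap w s)
      \<le> real n * (real p - 1) + 6 * (real \<rho> + real p) ^ 2"
    using periodic_word_in_words[OF u(1) assms(1)] by blast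
qed

section \<open>An admissible overlap in all but finitely many instances\<close>

text \<open>This is \<open>n\<^sup>2 * (1 - 1 / (1 + approx_err q n k))\<close> for \<open>L = log q (k * n)\<close>, see
  \<open>approx_err_tolerance\<close> below.\<close>

definition tolerance :: "real \<Rightarrow> real \<Rightarrow> real" where
  "tolerance n L = n ^ 2 * (L * (2 * n - L)) / (2 * n ^ 2 - L ^ 2)"

context
  fixes n L :: real
  assumes L: "0 \<le> L" "L < n"
begin

lemma tolerance_denominator: "n ^ 2 \<le> 2 * n ^ 2 - L ^ 2" "0 < 2 * n ^ 2 - L ^ 2"
proof -
  have "L ^ 2 \<le> n ^ 2" using L by (intro power_mono) auto
  then show "n ^ 2 \<le> 2 * n ^ 2 - L ^ 2" by simp
  moreover have "0 < n ^ 2" using L by simp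
  ultimately show "0 < 2 * n ^ 2 - L ^ 2" by linarith
qed

lemma tolerance_nonneg: "0 \<le> tolerance n L"
  using L tolerance_denominator by (simp add: tolerance_def)

lemma tolerance_ge_iff: "B \<le> tolerance n L \<longleftrightarrow> B * (2 * n ^ 2 - L ^ 2) \<le> n ^ 2 * (L * (2 * n - L))"
  using tolerance_denominator(2) by (simp add: tolerance_def pos_le_divide_eq)

lemma tolerance_ge_three_quarters: "3 / 4 * n * L \<le> tolerance n L"
proof -
  have "n ^ 2 * (L * (2 * n - L)) - 3 / 4 * n * L * (2 * n ^ 2 - L ^ 2)
      = n * L * ((3 * L - 2 * n) ^ 2 / 12 + n ^ 2 / 6)"
    by (simp add: power2_eq_square field_simps)
  also have "\<dots> \<ge> 0" using L by simp
  finally show ?thesis by (simp add: tolerance_ge_iff)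
qed

text \<open>The cubic term is the slack that absorbs the logarithmic errors when \<open>L\<close> is a fixed
  fraction of \<open>n\<close>.\<close>

lemma tolerance_ge_cubic: "n * L - L ^ 2 / 2 + L ^ 3 / (4 * n) \<le> tolerance n L"
proof -
  have n: "n > 0" using L by simp
  have "n ^ 2 * (L * (2 * n - L)) - (n * L - L ^ 2 / 2 + L ^ 3 / (4 * n)) * (2 * n ^ 2 - L ^ 2)
      = L ^ 3 * (n - L) / 2 + L ^ 5 / (4 * n)"
    using n by (simp add: power2_eq_square power3_eq_cube power_numeral_reduce field_simps)
  also have "\<dots> \<ge> 0" using L n by simp
  finally show ?thesis by (simp add: tolerance_ge_iff)
qed

lemma tolerance_ge_near_top: "n ^ 2 - 2 * n * (n - L) \<le> tolerance n L"
proof -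
  have "n ^ 2 * (L * (2 * n - L)) - (n ^ 2 - 2 * n * (n - L)) * (2 * n ^ 2 - L ^ 2)
     = 2 * n * (n - L) * (n ^ 2 - L ^ 2)"
    by (simp add: power2_eq_square algebra_simps)
  also have "\<dots> \<ge> 0" using L by (auto intro!: mult_nonneg_nonneg power_mono)
  finally show ?thesis by (simp add: tolerance_ge_iff)
qed

lemma tolerance_ge_half:
  assumes "3 / 5 * n \<le> L"
  shows "51 / 100 * n ^ 2 \<le> tolerance n L"
proof -
  have n: "n > 0" using L by simp
  have "51 * (2 * n ^ 2 - L ^ 2) \<le> 100 * (L * (2 * n - L))"
  proof -
    have "100 * (L * (2 * n - L)) - 51 * (2 * n ^ 2 - L ^ 2)
        = 49 * ((L - 3 / 5 * n) * (n - L)) + 608 / 5 * (n * (L - 3 / 5 * n)) + 9 / 25 * n ^ 2"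
      by (simp add: power2_eq_square field_simps)
    also have "\<dots> \<ge> 0" using assms L n by simp
    finally show ?thesis by simp
  qed
  then have "n ^ 2 * (51 * (2 * n ^ 2 - L ^ 2)) \<le> n ^ 2 * (100 * (L * (2 * n - L)))"
    by (intro mult_left_mono) auto
  then show ?thesis unfolding tolerance_ge_iff by (simp add: field_simps)
qed

end

lemma real_nat_floor_bounds:
  fixes y :: real
  assumes "0 \<le> y"
  shows "real (nat \<lfloor>y\<rfloor>) \<le> y" "y < real (nat \<lfloor>y\<rfloor>) + 1"
proof -
  have "real (nat \<lfloor>y\<rfloor>) = of_int \<lfloor>y\<rfloor>" using assms by simp
  then show "real (nat \<lfloor>y\<rfloor>) \<le> y" "y < real (nat \<lfloor>y\<rfloor>) + 1" by linarith+
qed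

lemma real_nat_ceiling_bounds:
  fixes y :: real
  assumes "0 \<le> y"
  shows "y \<le> real (nat \<lceil>y\<rceil>)" "real (nat \<lceil>y\<rceil>) < y + 1"
proof -
  have "real (nat \<lceil>y\<rceil>) = of_int \<lceil>y\<rceil>" using assms by simp
  then show "y \<le> real (nat \<lceil>y\<rceil>)" "real (nat \<lceil>y\<rceil>) < y + 1" by linarith+
qed

lemma log_less_nat_iff:
  assumes "2 \<le> q" "0 < c"
  shows "log (real q) (real c) < real m \<longleftrightarrow> c < q ^ m"
proof -
  have "log (real q) (real c) < real m \<longleftrightarrow> real c < real q powr real m"
    using assms by (intro log_less_iff) auto
  also have "real q powr real m = real (q ^ m)" using assms by (simp add: powr_realpow)
  finally show ?thesis by simp
qed

context
  fixes q n k :: nat and L \<nu> :: real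
  assumes q: "2 \<le> q" and n: "1 \<le> n" and k: "1 \<le> k" and few: "k * n < q ^ n"
  defines "L \<equiv> log (real q) (real k * real n)" and "\<nu> \<equiv> log (real q) (real n)"
begin

lemma L_bounds: "0 \<le> L" "L < n"
proof -
  have "1 * 1 \<le> k * n" using n k by (intro mult_le_mono)
  then have "real (1 * 1) \<le> real (k * n)" by (rule of_nat_mono)
  then show "0 \<le> L" using q by (simp add: L_def)
  show "L < n" using log_less_nat_iff[of q "k * n" n] q few n k by (simp add: L_def)
qed

lemma nu_nonneg: "0 \<le> \<nu>"
  using q n by (simp add: \<nu>_def)

lemma nu_le: "\<nu> \<le> log 2 n"
  using q n by (auto simp: \<nu>_def log_def intro!: divide_left_mono mult_pos_pos)

lemma log_k_n_power: "log (real q) (real (k * n ^ Suc j)) = L + real j * \<nu>"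
proof -
  have "log (real q) (real (k * n ^ Suc j)) = log (real q) ((real k * real n) * real n ^ j)"
    by (simp add: mult.assoc)
  also have "\<dots> = L + real j * \<nu>"
    using n k by (simp add: log_mult_pos log_nat_power L_def \<nu>_def)
  finally show ?thesis .
qed

lemma far_small_log:
  assumes "L < 1"
  shows "far_word_exists q n k (tolerance n L)"
proof -
  have "k * n < q ^ 1"
    using log_less_nat_iff[of q "k * n" 1] assms q n k by (simp add: L_def)
  then have "far_word_exists q n k 0" by (intro far_word_missing_letter) simp
  then show ?thesis using tolerance_nonneg[OF L_bounds] far_word_exists_mono by blast
qed

text \<open>Different necklaces share no subword of the full length \<open>n\<close>, which gives a distance of
  at least \<open>1 / n\<close>.\<close>

lemma far_near_top:
  assumes "real n - 1 / 2 \<le> L"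
  shows "far_word_exists q n k (tolerance n L)"
proof -
  have "real n * (2 * (real n - L)) \<le> real n * 1" using assms by (intro mult_left_mono) auto
  moreover have "real n * (2 * (real n - L)) = 2 * real n * (real n - L)" by simp
  ultimately have "real n ^ 2 - real n \<le> tolerance n L"
    using tolerance_ge_near_top[OF L_bounds] by linarith
  then show ?thesis using far_word_not_rotation[of k n q] few n far_word_exists_mono by simp
qed

text \<open>For a huge alphabet the \<open>n ^ (2 * n)\<close> ways to place the common letters do not
  matter: about \<open>L\<close> letters of \<open>w\<close>, and no more, occur in a given centre.\<close>

lemma far_huge_alphabet:
  assumes "1 \<le> L" "L < real n - 1 / 2" "n ^ (4 * n) \<le> q"
  shows "far_word_exists q n k (tolerance n L)"
proof -
  have n2: "2 \<le> n" using assms(1,2) by linarith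
  define c where "c = k * n ^ (2 * n)"
  \<comment> \<open>\<open>J\<close> is the least number of common letters whose excess can be excluded by counting.\<close>
  define J where "J = nat \<lfloor>log q c\<rfloor>"
  have c: "0 < c" using k n by (simp add: c_def)
  have "log q c = L + real (2 * n - 1) * \<nu>"
    using log_k_n_power[of "2 * n - 1"] n by (simp add: c_def)
  also have "\<dots> \<le> L + 1 / 2"
  proof -
    have "log q (real (n ^ (4 * n))) \<le> log q q"
      using assms(3) q n by (subst log_le_cancel_iff) auto
    then have "real (4 * n) * \<nu> \<le> 1" using n q by (simp add: log_nat_power \<nu>_def)
    moreover have "real (2 * n - 1) * \<nu> \<le> real (2 * n) * \<nu>"
      using nu_nonneg by (intro mult_right_mono) auto
    ultimately show ?thesis by simp
  qed
  finally have c_le: "log q c \<le> L + 1 / 2" .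
  have "0 \<le> log q c" using c q by simp
  then have "real J \<le> log q c" "log q c < real J + 1"
    unfolding J_def by (rule real_nat_floor_bounds)+
  then have J: "real J \<le> L + 1 / 2" "log q c < real (Suc J)"
    using c_le by auto
  have Jn: "J < n" using J(1) assms(2) by linarith
  have "2 ^ n * n ^ Suc J \<le> n ^ n * n ^ n"
    using n2 Jn by (intro mult_le_mono power_mono power_increasing) auto
  then have "k * 2 ^ n * n ^ Suc J \<le> c"
    unfolding c_def by (simp add: mult_2 power_add mult.assoc del: power_Suc)
  moreover have "c < q ^ Suc J" using log_less_nat_iff[OF q c, of "Suc J"] J(2) by blast
  ultimately have "far_word_exists q n k (real J * (real J + 1) / 2)"
    using Jn q by (intro far_word_few_letters) auto
  moreover have "real J * (real J + 1) / 2 \<le> tolerance n L"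
  proof -
    have "real J * (real J + 1) \<le> (L + 1 / 2) * n"
      using J(1) Jn L_bounds by (intro mult_mono) auto
    also have "\<dots> \<le> (3 / 2 * L) * n" using assms(1) by (intro mult_right_mono) auto
    finally show ?thesis using tolerance_ge_three_quarters[OF L_bounds] by (simp add: algebra_simps)
  qed
  ultimately show ?thesis using far_word_exists_mono by blast
qed

text \<open>The four positions of two disjoint windows of length \<open>\<mu>\<close>, in \<open>w\<close> and in a centre, cost a
  factor \<open>n ^ 4\<close>; so \<open>2 * \<mu>\<close> has to exceed \<open>L + 3 * \<nu>\<close>, and \<open>\<mu>\<close> is about \<open>0.65 * L\<close> at most.\<close>

lemma far_middle:
  assumes "1 \<le> L" "10 * \<nu> \<le> L" "100 * L \<le> n"
  shows "far_word_exists q n k (tolerance n L)"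
proof -
  define \<mu> where "\<mu> = Suc (nat \<lfloor>(L + 3 * \<nu>) / 2\<rfloor>)"
  have "0 \<le> (L + 3 * \<nu>) / 2" using L_bounds nu_nonneg by simp
  then have "real \<mu> - 1 \<le> (L + 3 * \<nu>) / 2" "(L + 3 * \<nu>) / 2 < real \<mu> - 1 + 1"
    unfolding \<mu>_def of_nat_Suc add_diff_cancel_left' by (rule real_nat_floor_bounds)+
  note \<mu>_bounds = this
  have \<mu>: "2 * real \<mu> \<le> L + 3 * \<nu> + 2" using \<mu>_bounds(1) by (simp add: field_simps)
  have \<mu>': "L + 3 * \<nu> < 2 * real \<mu>" using \<mu>_bounds(2) by (simp add: field_simps)
  have "k * n ^ 4 < q ^ (2 * \<mu>)"
    using log_less_nat_iff[of q "k * n ^ Suc 3" "2 * \<mu>"] log_k_n_power[of 3] \<mu>' q k n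
    by (simp del: power_Suc)
  moreover have "0 < \<mu>" by (simp add: \<mu>_def)
  moreover have "real (2 * \<mu>) \<le> real n" using \<mu> assms by simp
  ultimately have far: "far_word_exists q n k (real n * (real \<mu> - 1) + 2 * real \<mu> ^ 2)"
    using q by (intro far_word_disjoint_windows) auto
  have "real n * (real \<mu> - 1) \<le> real n * (13 / 20 * L)"
    using \<mu> assms by (intro mult_left_mono) auto
  moreover have "real \<mu> ^ 2 \<le> (5 / 3 * L) ^ 2"
    using \<mu> assms by (intro power_mono) auto
  moreover have "L ^ 2 \<le> real n * L / 100"
    using assms L_bounds by (auto simp: power2_eq_square intro!: mult_right_mono)
  moreover have "(5 / 3 * L) ^ 2 = 25 / 9 * L ^ 2" by (simp add: power2_eq_square)
  moreover have "real n * (13 / 20 * L) = 13 / 20 * (real n * L)" by simp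
  moreover have "0 \<le> real n * L" using L_bounds by simp
  ultimately have "real n * (real \<mu> - 1) + 2 * real \<mu> ^ 2 \<le> 3 / 4 * (real n * L)"
    by linarith
  then have "real n * (real \<mu> - 1) + 2 * real \<mu> ^ 2 \<le> 3 / 4 * real n * L" by simp
  then show ?thesis
    using far tolerance_ge_three_quarters[OF L_bounds] far_word_exists_mono by (meson order_trans)
qed

text \<open>Chosen such that at most a quarter of all words have a repeated window of this length; it
  does not depend on \<open>q\<close>.\<close>

definition repeat_length :: nat where
  "repeat_length = nat \<lceil>2 * log 2 n\<rceil> + 2"

lemma repeat_length: "4 * n ^ 2 \<le> q ^ repeat_length" "real repeat_length \<le> 2 * log 2 n + 3"
proof -
  have pos: "0 \<le> log 2 n" using n by simp
  show "real repeat_length \<le> 2 * log 2 n + 3"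
    using pos real_nat_ceiling_bounds[of "2 * log 2 n"] by (simp add: repeat_length_def)
  have "real n ^ 2 = 2 powr (log 2 (real n ^ 2))" using n by simp
  also have "\<dots> \<le> 2 powr real (nat \<lceil>2 * log 2 n\<rceil>)"
    using n pos by (intro powr_mono) (auto simp: log_nat_power)
  also have "\<dots> = 2 ^ nat \<lceil>2 * log 2 n\<rceil>" by (simp add: powr_realpow)
  finally have "real (4 * n ^ 2) \<le> real (2 ^ repeat_length)"
    by (simp add: repeat_length_def power_add)
  then have "4 * n ^ 2 \<le> 2 ^ repeat_length" by (simp only: of_nat_le_iff)
  also have "\<dots> \<le> q ^ repeat_length" using q by (intro power_mono) auto
  finally show "4 * n ^ 2 \<le> q ^ repeat_length" .
qed

text \<open>As \<open>k * n\<close> is below \<open>q ^ n / sqrt q\<close>, the rotations of the centres leave more than a quarter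
  of all words, so one of them has no repeated window.  Its overlaps are at most about \<open>n\<^sup>2 / 2\<close>,
  whereas the tolerance is at least \<open>0.51 * n\<^sup>2\<close>.\<close>

lemma far_large:
  assumes "3 / 5 * n \<le> L" "L < n - 1 / 2" "2 * (2 * log 2 n + 3) + 2 \<le> n"
    and ev: "real n * (real n - 1) - (real n - 1 - (2 * log 2 n + 3)) ^ 2 / 2 \<le> 51 / 100 * real n ^ 2"
  shows "far_word_exists q n k (tolerance n L)"
proof -
  let ?m = repeat_length
  have "real (2 * ?m) \<le> real n" using repeat_length(2) assms(3) by simp
  then have m: "?m \<le> n div 2" unfolding of_nat_le_iff by simp
  have "real (k * n) = q powr L" using q n k by (simp add: L_def)
  also have "\<dots> < q powr (real n - 1 / 2)" using q assms(2) by simp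
  also have "\<dots> = real q ^ n / sqrt q"
    using q by (simp add: powr_diff powr_realpow powr_half_sqrt)
  finally have "sqrt q * real (k * n) < real q ^ n" using q by (simp add: pos_less_divide_eq mult.commute)
  moreover have "4 / 3 * real (k * n) \<le> sqrt q * real (k * n)"
  proof (intro mult_right_mono)
    show "4 / 3 \<le> sqrt q" using q by (intro real_le_rsqrt) (simp add: power2_eq_square)
  qed simp
  ultimately have "real (4 * (k * n)) < real (3 * q ^ n)" by simp
  then have "4 * (k * n) < 3 * q ^ n" by (simp only: of_nat_less_iff)
  then have "far_word_exists q n k (real n * (real n - 1) - (real n - 1 - real ?m) ^ 2 / 2)"
    using repeat_length(1) m n by (intro far_word_nonrepeating) auto
  moreover have "(real n - 1 - (2 * log 2 n + 3)) ^ 2 \<le> (real n - 1 - real ?m) ^ 2"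
    using repeat_length(2) assms(3) n by (intro power_mono) auto
  ultimately show ?thesis
    using ev tolerance_ge_half[OF L_bounds assms(1)] by (elim far_word_exists_mono) linarith
qed

text \<open>A union bound excludes common windows longer than \<open>M\<close>, about \<open>L + \<nu>\<close>, for at least half of
  all words, and at most a quarter of all words have repeated windows.  The triangle between the lengths
  \<open>repeat_length\<close> and \<open>M\<close> gives \<open>n * L - L\<^sup>2 / 2\<close> up to an error of order \<open>n * log n\<close>.\<close>

lemma far_medium:
  assumes L': "n / 100 \<le> L" "L \<le> 3 / 5 * n"
    and ev: "2 * (2 * log 2 n + 3) + 2 \<le> n" "2 * log 2 n + 4 \<le> n / 100" "log 2 n + 1 < 2 / 5 * n"
      "3 * log 2 n + 5 \<le> n / 4000000"
  shows "far_word_exists q n k (tolerance n L)"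
proof -
  let ?m = repeat_length
  define e where "e = log q (2 * real k * real n ^ 2)"
  have e: "e = L + \<nu> + log q 2"
    using q n k unfolding e_def L_def \<nu>_def
    by (simp add: log_mult_pos log_nat_power power2_eq_square)
  have "log q 2 \<le> log q q" using q by (subst log_le_cancel_iff) auto
  then have log2: "0 \<le> log q 2" "log q 2 \<le> 1" using q by auto
  \<comment> \<open>The least length with \<open>2 * k * n\<^sup>2 \<le> q ^ Suc M\<close>.\<close>
  define M where "M = nat \<lceil>e\<rceil> - 1"
  have e_pos: "0 < e" using e log2 nu_nonneg L'(1) n by linarith
  have M: "e \<le> real (Suc M)" "real M \<le> e"
    using e_pos real_nat_ceiling_bounds[of e] by (simp_all add: M_def of_nat_diff)
  have M_le: "real M \<le> L + (log 2 n + 1)" using M(2) e log2 nu_le by linarith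
  have M_ge: "L - 1 \<le> real M" using M(1) e log2 nu_nonneg by simp
  have mM: "?m \<le> M" using repeat_length(2) M_ge L'(1) ev(2) by linarith
  have Mn: "M < n" using M_le L'(2) ev(3) by linarith
  have "real (2 * ?m) \<le> real n" using repeat_length(2) ev(1) by simp
  then have m: "?m \<le> n div 2" unfolding of_nat_le_iff by simp
  have "real (2 * k * n ^ 2) = q powr e" using q n k by (simp add: e_def)
  also have "\<dots> \<le> q powr real (Suc M)" using q M(1) by (intro powr_mono) auto
  also have "\<dots> = real (q ^ Suc M)" using q by (subst powr_realpow) auto
  finally have "2 * k * n ^ 2 \<le> q ^ Suc M" by (simp only: of_nat_le_iff)
  then have far: "far_word_exists q n k (real n * real M - (real M - real ?m) ^ 2 / 2)"
    using repeat_length(1) m mM Mn q by (intro far_word_short_windows) auto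
  have "real n * real M \<le> real n * (L + (log 2 n + 1))"
    using M_le by (intro mult_left_mono) auto
  moreover have "L ^ 2 - 2 * n * (real ?m + 1) \<le> (real M - real ?m) ^ 2"
  proof -
    have nonneg: "0 \<le> L - 1 - real ?m" using repeat_length(2) L'(1) ev(2) by linarith
    have "L * (real ?m + 1) \<le> n * (real ?m + 1)" using L_bounds by (intro mult_right_mono) auto
    moreover have "L ^ 2 - 2 * (L * (real ?m + 1)) \<le> (L - 1 - real ?m) ^ 2"
      by (simp add: power2_eq_square algebra_simps)
    moreover have "(L - 1 - real ?m) ^ 2 \<le> (real M - real ?m) ^ 2"
      using M_ge nonneg by (intro power_mono) auto
    ultimately show ?thesis by linarith
  qed
  moreover have "n * (real ?m + (log 2 n + 2)) \<le> L ^ 3 / (4 * real n)"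
  proof -
    have "n * (real ?m + (log 2 n + 2)) \<le> n * (n / 4000000)"
      using repeat_length(2) ev(4) by (intro mult_left_mono) auto
    also have "\<dots> = (n / 100) ^ 3 / (4 * real n)" using n by (simp add: power3_eq_cube)
    also have "\<dots> \<le> L ^ 3 / (4 * real n)" using L'(1) n by (intro divide_right_mono power_mono) auto
    finally show ?thesis .
  qed
  ultimately have "real n * real M - (real M - real ?m) ^ 2 / 2 \<le> n * L - L ^ 2 / 2 + L ^ 3 / (4 * real n)"
    by (simp add: algebra_simps)
  then show ?thesis
    using far tolerance_ge_cubic[OF L_bounds] far_word_exists_mono by (meson order_trans)
qed

text \<open>With at most \<open>n powr (2 / 5)\<close> occurrences of the period in all centres, the levels from
  \<open>p\<close> on contribute \<open>o(n)\<close>.  Allowing that many occurrences lowers the required \<open>p - 1\<close> to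
  \<open>L - 0.3 * \<nu>\<close>, and this gain of \<open>0.3 * n * \<nu>\<close> pays for \<open>L\<^sup>2 / 2\<close> and the error term, since
  \<open>\<nu> \<ge> 1 / 10\<close>.\<close>

lemma far_few_centres:
  assumes L': "1 \<le> L" "L < 10 * \<nu>"
    and ev: "10 * log 2 n + 1 \<le> n powr (1 / 10)" "n powr (2 / 5) + 10 * log 2 n + 1 \<le> n"
      "6 * (n powr (2 / 5) + 1) ^ 2 \<le> 3 / 4 * n"
      "60 * (n powr (2 / 5) + 10 * log 2 n + 1) ^ 2 + 50 * log 2 n \<le> 3 / 10 * n"
  shows "far_word_exists q n k (tolerance n L)"
proof -
  define P where "P p \<longleftrightarrow> 0 < p \<and> real (k * n * p) \<le> n powr (2 / 5) * real (q ^ p)" for p :: nat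
  define p0 where "p0 = nat \<lceil>L\<rceil>"
  have pos: "0 \<le> log 2 n" "1 \<le> n powr (1 / 10)" using n by (auto simp: ge_one_powr_ge_zero)
  have p0: "L \<le> real p0" "real p0 \<le> L + 1" "0 < p0"
    using L'(1) real_nat_ceiling_bounds[of L] by (simp_all add: p0_def)
  have L10: "L \<le> 10 * log 2 n" using L'(2) nu_le by linarith
  have small: "n powr (1 / 10) \<le> n powr (2 / 5)" using n by (intro powr_mono) auto
  \<comment> \<open>Since \<open>p0\<close> is admissible, the least admissible period is at most logarithmic in \<open>n\<close>.\<close>
  have "P p0"
  proof -
    have "real (k * n) = q powr L" using q n k by (simp add: L_def)
    also have "\<dots> \<le> q powr real p0" using q p0(1) by (intro powr_mono) auto
    also have "\<dots> = real (q ^ p0)" using q by (simp add: powr_realpow)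
    finally have "real (k * n) * real p0 \<le> real (q ^ p0) * n powr (2 / 5)"
      using p0(2) L10 ev(1) small by (intro mult_mono) auto
    then show ?thesis using p0(3) by (simp add: P_def mult.commute)
  qed
  define p where "p = (LEAST p. P p)"
  have Pp: "P p" unfolding p_def using \<open>P p0\<close> by (rule LeastI)
  have p_le: "real p \<le> 10 * log 2 n + 1"
    using Least_le[of P, OF \<open>P p0\<close>] p0(2) L10 by (simp add: p_def)
  define \<rho> where "\<rho> = nat \<lfloor>n powr (2 / 5)\<rfloor>"
  have \<rho>: "real \<rho> \<le> n powr (2 / 5)" "n powr (2 / 5) < real (Suc \<rho>)"
  proof -
    have "0 \<le> n powr (2 / 5)" by simp
    then have "real \<rho> \<le> n powr (2 / 5)" "n powr (2 / 5) < real \<rho> + 1"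
      unfolding \<rho>_def by (rule real_nat_floor_bounds)+
    then show "real \<rho> \<le> n powr (2 / 5)" "n powr (2 / 5) < real (Suc \<rho>)" by simp_all
  qed
  have "real (k * n * p) \<le> n powr (2 / 5) * real (q ^ p)" using Pp by (simp add: P_def)
  also have "\<dots> < real (Suc \<rho>) * real (q ^ p)" using \<rho>(2) q by (intro mult_strict_right_mono) auto
  also have "\<dots> = real (q ^ p * Suc \<rho>)" by (simp only: of_nat_mult mult.commute)
  finally have "k * n * p < q ^ p * Suc \<rho>" by (simp only: of_nat_less_iff)
  moreover have "real (\<rho> + p) \<le> real n" using \<rho>(1) p_le ev(2) by simp
  moreover have p_pos: "0 < p" using Pp by (simp add: P_def)
  ultimately have far: "far_word_exists q n k (real n * (real p - 1) + 6 * (real \<rho> + real p) ^ 2)"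
    by (intro far_word_periodic) auto
  have "real n * (real p - 1) + 6 * (real \<rho> + real p) ^ 2 \<le> tolerance n L"
  proof (cases "p = 1")
    case True
    have "(real \<rho> + 1) ^ 2 \<le> (n powr (2 / 5) + 1) ^ 2" using \<rho>(1) by (intro power_mono) auto
    then have "6 * (real \<rho> + 1) ^ 2 \<le> 3 / 4 * n" using ev(3) by linarith
    then have "real n * (real p - 1) + 6 * (real \<rho> + real p) ^ 2 \<le> 3 / 4 * n * 1"
      using True by simp
    also have "\<dots> \<le> 3 / 4 * n * L" using L'(1) by (intro mult_left_mono) auto
    finally show ?thesis using tolerance_ge_three_quarters[OF L_bounds] by linarith
  next
    case False
    define r where "r = p - 1"
    have r: "0 < r" "real r = real p - 1" using False p_pos by (auto simp: r_def of_nat_diff)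
    \<comment> \<open>Minimality of \<open>p\<close> bounds \<open>q ^ (p - 1)\<close> from above.\<close>
    have "\<not> P r" using not_less_Least[of r P] p_pos by (simp add: p_def[symmetric] r_def)
    then have "n powr (2 / 5) * real (q ^ r) < real (k * n) * real r" using r by (simp add: P_def)
    also have "\<dots> \<le> real (k * n) * n powr (1 / 10)"
      using r p_le ev(1) by (intro mult_left_mono) auto
    finally have "log q (n powr (2 / 5) * real (q ^ r)) \<le> log q (real (k * n) * n powr (1 / 10))"
      using q n k by (subst log_le_cancel_iff) auto
    then have "2 / 5 * \<nu> + real r \<le> L + 1 / 10 * \<nu>"
      using q n k by (simp add: log_mult_pos log_powr log_nat_power L_def \<nu>_def)
    then have "real p - 1 \<le> L - 3 / 10 * \<nu>" using r by simp
    then have "real n * (real p - 1) \<le> real n * (L - 3 / 10 * \<nu>)" by (intro mult_left_mono) auto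
    moreover have \<nu>: "1 / 10 \<le> \<nu>" using L' by simp
    have "(real \<rho> + real p) ^ 2 \<le> (n powr (2 / 5) + 10 * log 2 n + 1) ^ 2"
      using \<rho>(1) p_le by (intro power_mono) auto
    moreover have "(1 / 10) * (60 * (n powr (2 / 5) + 10 * log 2 n + 1) ^ 2)
        \<le> \<nu> * (60 * (n powr (2 / 5) + 10 * log 2 n + 1) ^ 2)"
      using \<nu> by (intro mult_right_mono) auto
    moreover have "L ^ 2 / 2 \<le> \<nu> * (50 * log 2 n)"
    proof -
      have "L * L \<le> (10 * \<nu>) * (10 * log 2 n)" using L' L10 pos by (intro mult_mono) auto
      then show ?thesis by (simp add: power2_eq_square)
    qed
    moreover have "\<nu> * (60 * (n powr (2 / 5) + 10 * log 2 n + 1) ^ 2 + 50 * log 2 n) \<le> \<nu> * (3 / 10 * n)"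
      using ev(4) \<nu> by (intro mult_left_mono) auto
    moreover have "0 \<le> L ^ 3 / (4 * real n)" using L_bounds by simp
    ultimately show ?thesis
      using tolerance_ge_cubic[OF L_bounds] by (simp add: algebra_simps)
  qed
  then show ?thesis using far far_word_exists_mono by blast
qed

end

lemma eventually_far_conditions:
  "eventually (\<lambda>n::nat. 2 * (2 * log 2 n + 3) + 2 \<le> n) at_top"
  "eventually (\<lambda>n::nat. real n * (real n - 1) - (real n - 1 - (2 * log 2 n + 3)) ^ 2 / 2 \<le> 51 / 100 * real n ^ 2) at_top"
  "eventually (\<lambda>n::nat. 2 * log 2 n + 4 \<le> n / 100) at_top"
  "eventually (\<lambda>n::nat. log 2 n + 1 < 2 / 5 * n) at_top"
  "eventually (\<lambda>n::nat. 3 * log 2 n + 5 \<le> n / 4000000) at_top"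
  "eventually (\<lambda>n::nat. 10 * log 2 n + 1 \<le> n powr (1 / 10)) at_top"
  "eventually (\<lambda>n::nat. n powr (2 / 5) + 10 * log 2 n + 1 \<le> n) at_top"
  "eventually (\<lambda>n::nat. 6 * (n powr (2 / 5) + 1) ^ 2 \<le> 3 / 4 * n) at_top"
  "eventually (\<lambda>n::nat. 60 * (n powr (2 / 5) + 10 * log 2 n + 1) ^ 2 + 50 * log 2 n \<le> 3 / 10 * n) at_top"
  unfolding log_def by real_asymp+

text \<open>The estimates for large \<open>n\<close> are uniform in \<open>q\<close> and \<open>k\<close>.  For the finitely many smaller \<open>n\<close>
  a bound on \<open>q\<close> is found from the case of a huge alphabet.\<close>

theorem far_word_exists_eventually:
  "\<exists>N. \<forall>q n k. 2 \<le> q \<longrightarrow> 1 \<le> n \<longrightarrow> 1 \<le> k \<longrightarrow> k * n < q ^ n \<longrightarrow> N \<le> n \<or> N \<le> q \<longrightarrow>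
    far_word_exists q n k (tolerance n (log q (real k * real n)))"
proof -
  have "eventually (\<lambda>n::nat. \<forall>q k. 2 \<le> q \<longrightarrow> 1 \<le> n \<longrightarrow> 1 \<le> k \<longrightarrow> k * n < q ^ n \<longrightarrow>
    far_word_exists q n k (tolerance n (log q (real k * real n)))) at_top"
    using eventually_far_conditions
  proof eventually_elim
    case (elim n)
    show ?case
    proof (intro allI impI)
      fix q k assume *: "2 \<le> q" "1 \<le> n" "1 \<le> k" "k * n < q ^ n"
      let ?L = "log q (real k * real n)" and ?\<nu> = "log q n"
      \<comment> \<open>The cases overlap; together they cover every value of \<open>?L\<close>.\<close>
      consider "?L < 1" | "real n - 1 / 2 \<le> ?L" | "1 \<le> ?L" "?L < 10 * ?\<nu>"
        | "1 \<le> ?L" "10 * ?\<nu> \<le> ?L" "100 * ?L \<le> n" | "n / 100 \<le> ?L" "?L \<le> 3 / 5 * n"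
        | "3 / 5 * n \<le> ?L" "?L < real n - 1 / 2"
        by linarith
      then show "far_word_exists q n k (tolerance n ?L)"
      proof cases
        case 1 then show ?thesis by (rule far_small_log[OF *])
      next
        case 2 then show ?thesis by (rule far_near_top[OF *])
      next
        case 3 then show ?thesis by (rule far_few_centres[OF *]) (fact elim)+
      next
        case 4 then show ?thesis by (rule far_middle[OF *])
      next
        case 5 then show ?thesis by (rule far_medium[OF *]) (fact elim)+
      next
        case 6 then show ?thesis by (rule far_large[OF *]) (fact elim)+
      qed
    qed
  qed
  then obtain N where N: "\<And>q n k. N \<le> n \<Longrightarrow> 2 \<le> q \<Longrightarrow> 1 \<le> n \<Longrightarrow> 1 \<le> k \<Longrightarrow> k * n < q ^ n \<Longrightarrow>
    far_word_exists q n k (tolerance n (log q (real k * real n)))"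
    unfolding eventually_at_top_linorder by blast
  show ?thesis
  proof (intro exI[of _ "max N (Suc N ^ (4 * N))"] allI impI)
    fix q n k :: nat
    assume *: "2 \<le> q" "1 \<le> n" "1 \<le> k" "k * n < q ^ n"
      and big: "max N (Suc N ^ (4 * N)) \<le> n \<or> max N (Suc N ^ (4 * N)) \<le> q"
    let ?L = "log q (real k * real n)"
    show "far_word_exists q n k (tolerance n ?L)"
    proof (cases "N \<le> n")
      case True
      then show ?thesis using * by (rule N)
    next
      case False
      then have "n ^ (4 * n) \<le> Suc N ^ (4 * N)"
        using *(2) by (intro order_trans[OF power_mono power_increasing]) auto
      also have "\<dots> \<le> q" using big False by simp
      finally have huge: "n ^ (4 * n) \<le> q" .
      consider "?L < 1" | "real n - 1 / 2 \<le> ?L" | "1 \<le> ?L" "?L < real n - 1 / 2" by linarith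
      then show ?thesis
      proof cases
        case 1 then show ?thesis by (rule far_small_log[OF *])
      next
        case 2 then show ?thesis by (rule far_near_top[OF *])
      next
        case 3 then show ?thesis using huge by (rule far_huge_alphabet[OF *])
      qed
    qed
  qed
qed

section \<open>Least rotations of integers\<close>

text \<open>Rotation by one letter of the word of length \<open>p\<close> whose base-\<open>q\<close> value is \<open>y\<close>: the leading
  digit moves to the end.\<close>

definition rot :: "nat \<Rightarrow> nat \<Rightarrow> nat \<Rightarrow> nat" where
  "rot q p y = y * q mod q ^ p + y div q ^ (p - 1)"

definition least_rotation :: "nat \<Rightarrow> nat \<Rightarrow> nat \<Rightarrow> bool" where
  "least_rotation q p x \<longleftrightarrow> (\<forall>j. x \<le> (rot q p ^^ j) x)"

definition digits :: "nat \<Rightarrow> nat \<Rightarrow> nat \<Rightarrow> nat list" where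
  "digits q n x = map (\<lambda>j. x div q ^ (n - 1 - j) mod q) [0..<n]"

lemma rot_alt: "p \<ge> 1 \<Longrightarrow> rot q p y = (y mod q ^ (p - 1)) * q + y div q ^ (p - 1)"
proof (cases p)
  case (Suc r)
  then show ?thesis using mod_mult_mult2[of y q "q ^ r"] by (simp add: rot_def mult.commute[of q])
qed simp

lemma funpow_rot:
  assumes "q \<ge> 2" "p \<ge> 1" "y < q ^ p" "j \<le> p"
  shows "(rot q p ^^ j) y = (y mod q ^ (p - j)) * q ^ j + y div q ^ (p - j)"
  using assms(4)
proof (induction j)
  case 0
  then show ?case using assms by simp
next
  case (Suc j)
  define e where "e = p - Suc j"
  note power_Suc [simp del]
  have pe: "p - j = Suc e" "p - 1 = e + j" "p = e + Suc j" using Suc.prems by (simp_all add: e_def)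
  let ?r = "y mod q ^ Suc e" and ?u = "y div q ^ Suc e"
  have qpos: "q > 0" using assms by simp
  have u: "?u < q ^ j"
  proof -
    have "q ^ j * q ^ Suc e = q ^ p" by (simp add: pe(3) power_add power_Suc mult_ac)
    then have "y < q ^ j * q ^ Suc e" using assms(3) by simp
    then show ?thesis by (rule less_mult_imp_div_less)
  qed
  have IH: "(rot q p ^^ j) y = ?r * q ^ j + ?u" using Suc pe by simp
  have r: "?r = q ^ e * (y div q ^ e mod q) + y mod q ^ e"
    using mod_mult2_eq[of y "q ^ e" q] by (simp add: power_Suc mult.commute)
  have r_div: "?r div q ^ e = y div q ^ e mod q"
    unfolding r using qpos by simp
  have split: "?r = (?r div q ^ e) * q ^ e + y mod q ^ e"
    unfolding r_div using r by (metis mult.commute)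
  have rd: "(?r * q ^ j + ?u) div q ^ (e + j) = ?r div q ^ e"
  proof -
    have "(?r * q ^ j + ?u) div q ^ (e + j) = (?r * q ^ j + ?u) div q ^ j div q ^ e"
      by (simp only: power_add mult.commute[of "q ^ e"] div_mult2_eq)
    also have "(?r * q ^ j + ?u) div q ^ j = ?r" using u qpos by simp
    finally show ?thesis .
  qed
  have rm: "(?r * q ^ j + ?u) mod q ^ (e + j) = (y mod q ^ e) * q ^ j + ?u"
  proof -
    have "?r * q ^ j + ?u = (?r div q ^ e) * q ^ (e + j) + ((y mod q ^ e) * q ^ j + ?u)"
      using arg_cong[OF split, of "\<lambda>z. z * q ^ j + ?u"]
      by (simp only: power_add add_mult_distrib mult.assoc add.assoc)
    moreover have "(y mod q ^ e) * q ^ j + ?u < q ^ (e + j)"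
    proof -
      have "y mod q ^ e + 1 \<le> q ^ e" using qpos by (simp add: Suc_le_eq)
      then have "(y mod q ^ e + 1) * q ^ j \<le> q ^ e * q ^ j" by (rule mult_le_mono1)
      then show ?thesis using u by (simp add: power_add)
    qed
    ultimately show ?thesis by (metis mod_mult_self3 mod_less)
  qed
  have yu: "y div q ^ e = ?u * q + ?r div q ^ e"
  proof -
    have "?u = y div q ^ e div q"
      using div_mult2_eq[of y "q ^ e" q] by (simp add: power_Suc mult.commute)
    then show ?thesis unfolding r_div by (metis div_mult_mod_eq)
  qed
  have "(rot q p ^^ Suc j) y = rot q p (?r * q ^ j + ?u)" using IH by simp
  also have "\<dots> = ((y mod q ^ e) * q ^ j + ?u) * q + ?r div q ^ e"
    using assms(2) rd rm pe by (simp add: rot_alt)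
  also have "\<dots> = (y mod q ^ e) * q ^ Suc j + y div q ^ e"
    by (simp add: yu power_Suc algebra_simps)
  finally show ?case by (simp add: e_def)
qed

context
  fixes q p :: nat
  assumes q: "q \<ge> 2" and p: "p \<ge> 1"
begin

lemma rot_less:
  assumes "y < q ^ p"
  shows "rot q p y < q ^ p"
proof -
  have "y div q ^ (p - 1) < q"
    using assms p by (intro less_mult_imp_div_less) (simp flip: power_Suc)
  moreover have "(y mod q ^ (p - 1) + 1) * q \<le> q ^ (p - 1) * q"
    using q by (intro mult_le_mono1) (simp add: Suc_le_eq)
  moreover have "q ^ (p - 1) * q = q ^ p" using p by (cases p) auto
  ultimately show ?thesis using p by (simp add: rot_alt)
qed

lemma funpow_rot_less: "y < q ^ p \<Longrightarrow> (rot q p ^^ j) y < q ^ p"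
  by (induction j) (auto intro: rot_less)

lemma funpow_rot_period: "y < q ^ p \<Longrightarrow> (rot q p ^^ p) y = y"
  using funpow_rot[OF q p, of y p] by simp

lemma funpow_rot_mod: "y < q ^ p \<Longrightarrow> (rot q p ^^ (j mod p)) y = (rot q p ^^ j) y"
  by (intro funpow_mod_eq funpow_rot_period)

lemma funpow_rot_inverse:
  assumes "y < q ^ p"
  shows "\<exists>i<p. (rot q p ^^ i) ((rot q p ^^ j) y) = y"
proof -
  have "(rot q p ^^ (p - j mod p)) ((rot q p ^^ j) y)
      = (rot q p ^^ (p - j mod p)) ((rot q p ^^ (j mod p)) y)"
    using funpow_rot_mod[OF assms] by simp
  also have "\<dots> = (rot q p ^^ (p - j mod p + j mod p)) y" by (simp add: funpow_add)
  also have "\<dots> = y" using funpow_rot_period[OF assms] p by simp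
  finally have "(rot q p ^^ ((p - j mod p) mod p)) ((rot q p ^^ j) y) = y"
    using funpow_rot_mod[OF funpow_rot_less[OF assms]] by simp
  then show ?thesis using p by (intro exI[of _ "(p - j mod p) mod p"]) simp
qed

lemma exists_least_rotation:
  assumes "y < q ^ p"
  shows "\<exists>x\<le>y. least_rotation q p x \<and> (\<exists>j<p. (rot q p ^^ j) x = y)"
proof -
  define orbit where "orbit = {(rot q p ^^ j) y | j. True}"
  define x where "x = (LEAST x. x \<in> orbit)"
  have "y \<in> orbit" unfolding orbit_def by (rule CollectI, rule exI[of _ 0]) simp
  then have x: "x \<in> orbit" "x \<le> y" unfolding x_def by (auto intro: LeastI Least_le)
  then obtain i where i: "x = (rot q p ^^ i) y" by (auto simp: orbit_def)
  have "x \<le> (rot q p ^^ j) x" for j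
  proof -
    have "(rot q p ^^ j) x = (rot q p ^^ (j + i)) y" by (simp add: i funpow_add)
    then have "(rot q p ^^ j) x \<in> orbit" unfolding orbit_def by blast
    then show ?thesis unfolding x_def by (rule Least_le)
  qed
  moreover have "\<exists>j<p. (rot q p ^^ j) x = y" using funpow_rot_inverse[OF assms] i by simp
  ultimately show ?thesis using x by (auto simp: least_rotation_def)
qed

text \<open>A class that meets \<open>{..<k * p}\<close> has its least element there, and it covers at most \<open>p\<close> of
  these numbers.\<close>

lemma many_least_rotations:
  assumes "k * p \<le> q ^ p"
  shows "k \<le> card {x. x < k * p \<and> least_rotation q p x}"
proof -
  let ?A = "{x. x < k * p \<and> least_rotation q p x}"
  have fin: "finite ?A" by simp
  have "{..<k * p} \<subseteq> (\<Union>x\<in>?A. (\<lambda>j. (rot q p ^^ j) x) ` {..<p})"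
  proof
    fix y assume "y \<in> {..<k * p}"
    then have "y < k * p" "y < q ^ p" using assms by auto
    then obtain x j where "x \<le> y" "least_rotation q p x" "j < p" "y = (rot q p ^^ j) x"
      using exists_least_rotation by metis
    then show "y \<in> (\<Union>x\<in>?A. (\<lambda>j. (rot q p ^^ j) x) ` {..<p})"
      using \<open>y < k * p\<close> by (intro UN_I[of x]) auto
  qed
  then have "card {..<k * p} \<le> card (\<Union>x\<in>?A. (\<lambda>j. (rot q p ^^ j) x) ` {..<p})"
    using fin by (intro card_mono) auto
  also have "\<dots> \<le> card ?A * p"
    using fin card_image_le[of "{..<p}"] by (intro card_UN_le_mult) auto
  finally have "k * p \<le> card ?A * p" by simp
  then show ?thesis using p by simp
qed

text \<open>The correctness of the sieve: \<open>x\<close> is least in its class if and only if no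
  least element found before has \<open>x\<close> among its rotations.\<close>

lemma least_rotation_iff_unmarked:
  assumes "x < q ^ p"
  shows "least_rotation q p x \<longleftrightarrow>
    \<not> (\<exists>x'. x' < x \<and> least_rotation q p x' \<and> (\<exists>j<p. x = (rot q p ^^ j) x'))"
proof
  assume min: "least_rotation q p x"
  show "\<not> (\<exists>x'. x' < x \<and> least_rotation q p x' \<and> (\<exists>j<p. x = (rot q p ^^ j) x'))"
  proof
    assume "\<exists>x'. x' < x \<and> least_rotation q p x' \<and> (\<exists>j<p. x = (rot q p ^^ j) x')"
    then obtain x' j where x': "x' < x" "x = (rot q p ^^ j) x'" by blast
    then have "x' < q ^ p" using assms by simp
    then obtain i where "(rot q p ^^ i) x = x'" using funpow_rot_inverse x'(2) by blast
    moreover have "x \<le> (rot q p ^^ i) x" using min by (simp add: least_rotation_def)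
    ultimately show False using x'(1) by simp
  qed
next
  assume none: "\<not> (\<exists>x'. x' < x \<and> least_rotation q p x' \<and> (\<exists>j<p. x = (rot q p ^^ j) x'))"
  obtain x' j where "x' \<le> x" "least_rotation q p x'" "j < p" "(rot q p ^^ j) x' = x"
    using exists_least_rotation[OF assms] by blast
  then have "x' = x" using none by (metis le_neq_implies_less)
  then show "least_rotation q p x" using \<open>least_rotation q p x'\<close> by simp
qed

text \<open>A rotation of the padded word either moves leading zeros to the end, which
  multiplies the value by a power of \<open>q\<close>, or cuts the original word in two; inserting zeros
  between the two parts only increases the value of the corresponding short rotation.\<close>

lemma least_rotation_padded:
  assumes x: "x < q ^ p" "least_rotation q p x" and n: "p \<le> n"
  shows "least_rotation q n x"
proof -
  have n1: "n \<ge> 1" using p n by simp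
  have "q ^ p \<le> q ^ n" using n q by (intro power_increasing) auto
  then have xn: "x < q ^ n" using x(1) by simp
  have le: "x \<le> (rot q n ^^ i) x" if i: "i \<le> n" for i
  proof (cases "p \<le> n - i")
    case True
    then have "q ^ p \<le> q ^ (n - i)" using q by (intro power_increasing) auto
    then have "x < q ^ (n - i)" using x(1) by simp
    moreover have "1 \<le> q ^ i" using q by simp
    ultimately show ?thesis using funpow_rot[OF q n1 xn i] by simp
  next
    case False
    define j where "j = p - (n - i)"
    have j: "p - j = n - i" "j \<le> p" "j \<le> i" using False n i by (auto simp: j_def)
    have "x \<le> (rot q p ^^ j) x" using x(2) by (simp add: least_rotation_def)
    also have "\<dots> = (x mod q ^ (n - i)) * q ^ j + x div q ^ (n - i)"
      using funpow_rot[OF q p x(1) j(2)] j(1) by simp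
    also have "\<dots> \<le> (x mod q ^ (n - i)) * q ^ i + x div q ^ (n - i)"
      using j(3) q by (intro add_mono mult_mono power_increasing) auto
    also have "\<dots> = (rot q n ^^ i) x" using funpow_rot[OF q n1 xn i] by simp
    finally show ?thesis .
  qed
  have "x \<le> (rot q n ^^ i) x" for i
  proof -
    have "(rot q n ^^ n) x = x" using funpow_rot[OF q n1 xn, of n] by simp
    then have "(rot q n ^^ (i mod n)) x = (rot q n ^^ i) x" by (rule funpow_mod_eq)
    moreover have "i mod n \<le> n" using n1 by simp
    ultimately show ?thesis using le[of "i mod n"] by simp
  qed
  then show ?thesis by (simp add: least_rotation_def)
qed

end

lemma digits_Suc: "digits q (Suc n) x = digits q n (x div q) @ [x mod q]"
proof -
  have "x div q ^ (n - j) = x div q div q ^ (n - 1 - j)" if "j < n" for j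
  proof -
    have "n - j = Suc (n - 1 - j)" using that by simp
    then show ?thesis by (simp add: div_mult2_eq)
  qed
  then show ?thesis by (simp add: digits_def)
qed

lemma length_digits [simp]: "length (digits q n x) = n"
  by (simp add: digits_def)

lemma digits_in_words: "q \<ge> 2 \<Longrightarrow> digits q n x \<in> words q n"
  by (auto simp: words_def digits_def)

lemma digits_inject:
  assumes "digits q n x = digits q n y" "x < q ^ n" "y < q ^ n"
  shows "x = y"
  using assms
proof (induction n arbitrary: x y)
  case (Suc n)
  then have "digits q n (x div q) = digits q n (y div q)" "x mod q = y mod q"
    by (simp_all add: digits_Suc)
  moreover have "x div q < q ^ n" "y div q < q ^ n"
    using Suc.prems by (auto intro!: less_mult_imp_div_less simp: mult.commute)
  ultimately show ?case using Suc.IH by (metis div_mult_mod_eq)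
qed simp

lemma rotate1_digits:
  assumes "q \<ge> 2" "n \<ge> 1" "x < q ^ n"
  shows "rotate1 (digits q n x) = digits q n (rot q n x)"
proof (rule nth_equalityI)
  fix i assume "i < length (rotate1 (digits q n x))"
  then have i: "i < n" by simp
  let ?r = "x mod q ^ (n - 1)" and ?t = "x div q ^ (n - 1)"
  have t: "?t < q"
    using assms by (intro less_mult_imp_div_less) (simp flip: power_Suc)
  have rot: "rot q n x = ?r * q + ?t" using assms by (simp add: rot_alt)
  have "rotate1 (digits q n x) ! i = digits q n x ! (Suc i mod n)"
    using i nth_rotate1[of i "digits q n x"] by simp
  also have "\<dots> = digits q n (rot q n x) ! i"
  proof (cases "Suc i = n")
    case True
    then show ?thesis using t by (simp add: digits_def rot)
  next
    case False
    define e where "e = n - 2 - i"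
    have e: "n - 1 - i = Suc e" "n - 1 - Suc i = e" "n - 1 = e + Suc i"
      using False i by (auto simp: e_def)
    have "(?r * q + ?t) div q ^ Suc e = (?r * q + ?t) div q div q ^ e"
      by (simp add: div_mult2_eq)
    also have "(?r * q + ?t) div q = ?r" using t by simp
    finally have "rot q n x div q ^ (n - 1 - i) mod q = ?r div q ^ e mod q" by (simp only: rot e(1))
    moreover have "x div q ^ e mod q = ?r div q ^ e mod q"
    proof -
      have "q ^ (n - 1) = q ^ i * q * q ^ e"
        unfolding e(3) by (simp add: power_add mult_ac)
      moreover have "x = ?t * q ^ (n - 1) + ?r" by (rule div_mult_mod_eq[symmetric])
      ultimately have "x = (?t * q ^ i * q) * q ^ e + ?r" by (metis mult.assoc)
      then have "x div q ^ e = ((?t * q ^ i * q) * q ^ e + ?r) div q ^ e" by simp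
      also have "\<dots> = ?t * q ^ i * q + ?r div q ^ e" using assms(1) by simp
      finally show ?thesis by simp
    qed
    ultimately show ?thesis using False i e(2) by (simp add: digits_def)
  qed
  finally show "rotate1 (digits q n x) ! i = digits q n (rot q n x) ! i" .
qed simp

lemma rotate_digits:
  assumes "q \<ge> 2" "n \<ge> 1" "x < q ^ n"
  shows "rotate i (digits q n x) = digits q n ((rot q n ^^ i) x)"
proof (induction i)
  case (Suc i)
  have "rotate (Suc i) (digits q n x) = rotate1 (rotate i (digits q n x))" by (simp add: rotate_def)
  then show ?case using Suc rotate1_digits[OF assms(1,2) funpow_rot_less[OF assms]] by simp
qed simp

lemma least_rotation_eq_if_rotated:
  assumes q: "q \<ge> 2" "n \<ge> 1" and x: "x < q ^ n" "least_rotation q n x"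
    and y: "y < q ^ n" "least_rotation q n y"
    and eq: "digits q n y = rotate i (digits q n x)"
  shows "x = y"
proof -
  have "digits q n y = digits q n ((rot q n ^^ i) x)" using eq rotate_digits[OF q x(1)] by simp
  then have y_eq: "y = (rot q n ^^ i) x"
    using digits_inject y(1) funpow_rot_less[OF q x(1)] by blast
  then have "x \<le> y" using x(2) by (simp add: least_rotation_def)
  moreover obtain l where "(rot q n ^^ l) y = x"
    using funpow_rot_inverse[OF q x(1)] y_eq by blast
  then have "y \<le> x" using y(2) unfolding least_rotation_def by metis
  ultimately show ?thesis by simp
qed

section \<open>Total correctness with time bounds\<close>

lemma exec_word_bound_mono: "exec W P s t s' \<Longrightarrow> W \<le> W' \<Longrightarrow> exec W' P s t s'"
  by (induction rule: exec.induct) (blast intro: exec.intros less_le_trans)+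

definition runs :: "nat \<Rightarrow> prog \<Rightarrow> state \<Rightarrow> nat \<Rightarrow> (state \<Rightarrow> bool) \<Rightarrow> bool" where
  "runs W P s b Q \<longleftrightarrow> (\<exists>t s'. exec W P s t s' \<and> t \<le> b \<and> Q s')"

lemma runs_weaken:
  "runs W P s b Q \<Longrightarrow> b \<le> b' \<Longrightarrow> (\<And>s'. Q s' \<Longrightarrow> Q' s') \<Longrightarrow> runs W P s b' Q'"
  unfolding runs_def by (meson order_trans)

lemma runs_Skip: "Q s \<Longrightarrow> 1 \<le> b \<Longrightarrow> runs W Skip s b Q"
  unfolding runs_def by (blast intro: exec.Skip)

lemma runs_Const: "c < W \<Longrightarrow> Q (R(r := c), M) \<Longrightarrow> 1 \<le> b \<Longrightarrow> runs W (Const r c) (R, M) b Q"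
  unfolding runs_def by (blast intro: exec.Const)

lemma runs_Op: "apply_op f (R a) (R c) < W \<Longrightarrow> Q (R(r := apply_op f (R a) (R c)), M) \<Longrightarrow> 1 \<le> b \<Longrightarrow>
    runs W (Op f r a c) (R, M) b Q"
  unfolding runs_def by (blast intro: exec.Op)

lemma runs_Load: "Q (R(r := M (R a)), M) \<Longrightarrow> 1 \<le> b \<Longrightarrow> runs W (Load r a) (R, M) b Q"
  unfolding runs_def by (blast intro: exec.Load)

lemma runs_Store: "Q (R, M(R a := R r)) \<Longrightarrow> 1 \<le> b \<Longrightarrow> runs W (Store a r) (R, M) b Q"
  unfolding runs_def by (blast intro: exec.Store)

lemma runs_Seq:
  assumes "runs W P s b (\<lambda>s'. runs W P' s' b' Q)" "b + b' \<le> c"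
  shows "runs W (Seq P P') s c Q"
proof -
  obtain t s' u s'' where "exec W P s t s'" "exec W P' s' u s''" "t \<le> b" "u \<le> b'" "Q s''"
    using assms(1) by (auto simp: runs_def)
  then have "exec W (Seq P P') s (t + u) s''" "t + u \<le> c" "Q s''"
    using assms(2) by (auto intro: exec.Seq)
  then show ?thesis unfolding runs_def by blast
qed

lemma runs_IfLess:
  assumes "R a < R c \<Longrightarrow> runs W P (R, M) b Q" "\<not> R a < R c \<Longrightarrow> runs W P' (R, M) b Q" "1 + b \<le> b'"
  shows "runs W (IfLess a c P P') (R, M) b' Q"
proof (cases "R a < R c")
  case True
  then obtain t s' where "exec W P (R, M) t s'" "t \<le> b" "Q s'" using assms(1) by (auto simp: runs_def)
  moreover from this have "exec W (IfLess a c P P') (R, M) (1 + t) s'"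
    using True by (intro exec.IfTrue) auto
  moreover have "1 + t \<le> b'" using \<open>t \<le> b\<close> assms(3) by simp
  ultimately show ?thesis unfolding runs_def by blast
next
  case False
  then obtain t s' where "exec W P' (R, M) t s'" "t \<le> b" "Q s'" using assms(2) by (auto simp: runs_def)
  moreover from this have "exec W (IfLess a c P P') (R, M) (1 + t) s'"
    using False by (intro exec.IfFalse) auto
  moreover have "1 + t \<le> b'" using \<open>t \<le> b\<close> assms(3) by simp
  ultimately show ?thesis unfolding runs_def by blast
qed

text \<open>The potential \<open>\<Phi>\<close> bounds the remaining time, so that cheap and expensive iterations can be
  mixed in an amortised analysis.\<close>

lemma runs_WhileLess:
  fixes I :: "state \<Rightarrow> bool" and \<Phi> :: "state \<Rightarrow> nat"
  assumes body: "\<And>R M. I (R, M) \<Longrightarrow> R a < R c \<Longrightarrow>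
      \<exists>b. runs W P (R, M) b (\<lambda>s'. I s' \<and> b + 1 + \<Phi> s' \<le> \<Phi> (R, M))"
    and exit: "\<And>s. I s \<Longrightarrow> 1 \<le> \<Phi> s"
    and init: "I s"
  shows "runs W (WhileLess a c P) s (\<Phi> s) (\<lambda>s'. I s' \<and> \<not> fst s' a < fst s' c)"
  using init
proof (induction "\<Phi> s" arbitrary: s rule: less_induct)
  case less
  obtain R M where s: "s = (R, M)" by (cases s)
  show ?case
  proof (cases "R a < R c")
    case True
    obtain b t s' where b: "exec W P s t s'" "t \<le> b" "I s'" "b + 1 + \<Phi> s' \<le> \<Phi> s"
      using body[of R M] less.prems True by (auto simp: s runs_def)
    have "runs W (WhileLess a c P) s' (\<Phi> s') (\<lambda>s'. I s' \<and> \<not> fst s' a < fst s' c)"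
      using b by (intro less.hyps) auto
    then obtain u s'' where u: "exec W (WhileLess a c P) s' u s''" "u \<le> \<Phi> s'"
      "I s''" "\<not> fst s'' a < fst s'' c" by (auto simp: runs_def)
    have "exec W (WhileLess a c P) s (1 + t + u) s''"
      using True b(1) u(1) by (intro exec.WhileTrue) (auto simp: s)
    moreover have "1 + t + u \<le> \<Phi> s" using b u by simp
    ultimately show ?thesis unfolding runs_def using u by blast
  next
    case False
    then have "exec W (WhileLess a c P) s 1 s" by (intro exec.WhileFalse) (simp add: s)
    then show ?thesis unfolding runs_def using less.prems exit[of s] False by (auto simp: s)
  qed
qed

fun block :: "prog list \<Rightarrow> prog" where
  "block [] = Skip"
| "block (P # Ps) = Seq P (block Ps)"

lemma runs_block_Nil: "Q s \<Longrightarrow> 1 \<le> b \<Longrightarrow> runs W (block []) s b Q"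
  by (simp add: runs_Skip)

lemma runs_block_Cons:
  "runs W P s b (\<lambda>s'. runs W (block Ps) s' b' Q) \<Longrightarrow> b + b' \<le> c \<Longrightarrow> runs W (block (P # Ps)) s c Q"
  by (simp add: runs_Seq)

lemma runs_block_Const:
  "c < W \<Longrightarrow> runs W (block Ps) (R(r := c), M) (b - 1) Q \<Longrightarrow> 1 \<le> b \<Longrightarrow>
    runs W (block (Const r c # Ps)) (R, M) b Q"
  by (rule runs_block_Cons[where b = 1 and b' = "b - 1"], rule runs_Const) auto

lemma runs_block_Op:
  "apply_op f (R a) (R c) < W \<Longrightarrow>
    runs W (block Ps) (R(r := apply_op f (R a) (R c)), M) (b - 1) Q \<Longrightarrow> 1 \<le> b \<Longrightarrow>
    runs W (block (Op f r a c # Ps)) (R, M) b Q"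
  by (rule runs_block_Cons[where b = 1 and b' = "b - 1"], rule runs_Op) auto

lemma runs_block_Load:
  "runs W (block Ps) (R(r := M (R a)), M) (b - 1) Q \<Longrightarrow> 1 \<le> b \<Longrightarrow>
    runs W (block (Load r a # Ps)) (R, M) b Q"
  by (rule runs_block_Cons[where b = 1 and b' = "b - 1"], rule runs_Load) auto

lemma runs_block_Store:
  "runs W (block Ps) (R, M(R a := R r)) (b - 1) Q \<Longrightarrow> 1 \<le> b \<Longrightarrow>
    runs W (block (Store a r # Ps)) (R, M) b Q"
  by (rule runs_block_Cons[where b = 1 and b' = "b - 1"], rule runs_Store) auto

lemmas runs_block = runs_block_Const runs_block_Op runs_block_Load runs_block_Store runs_block_Nil

section \<open>A sieve for necklaces\<close>

text \<open>Throughout, the registers 0 to 8 hold \<open>n\<close>, \<open>q\<close>, \<open>k\<close>, the constants 1 and 0, the width \<open>p\<close>,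
  \<open>q ^ p\<close>, \<open>q ^ (p - 1)\<close> and the address \<open>k * n\<close> where the marks begin, just behind the output.
  Register 9 is the current candidate and register 10 the number of words found; the higher
  registers are scratch.\<close>

definition mark_orbit :: prog where
  "mark_orbit = WhileLess 12 5 (block
    [Op Add 13 8 11, Store 13 3,
     Op Mul 15 11 1, Op Mod 15 15 6, Op Div 16 11 7, Op Add 11 15 16,
     Op Add 12 12 3])"

lemma runs_mark_orbit:
  assumes R: "R 1 = q" "R 3 = 1" "R 5 = p" "R 6 = q ^ p" "R 7 = q ^ (p - 1)" "R 8 = B" "R 11 = x" "R 12 = 0"
    and q: "2 \<le> q" and p: "1 \<le> p" and x: "x < q ^ p"
    and W: "q ^ p * q \<le> W" "B + q ^ p \<le> W" "p < W"
  shows "runs W mark_orbit (R, M) (9 * p + 1) (\<lambda>(R', M'). (\<forall>r\<le>10. R' r = R r) \<and>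
    M' = (\<lambda>a. if \<exists>j<p. a = B + (rot q p ^^ j) x then 1 else M a))"
proof -
  define I where "I = (\<lambda>(R', M'). (\<forall>r\<le>10. R' r = R r) \<and> R' 12 \<le> p \<and>
    R' 11 = (rot q p ^^ R' 12) x \<and>
    M' = (\<lambda>a. if \<exists>j<R' 12. a = B + (rot q p ^^ j) x then 1 else M a))"
  have "runs W mark_orbit (R, M) (9 * (p - fst (R, M) 12) + 1) (\<lambda>s'. I s' \<and> \<not> fst s' 12 < fst s' 5)"
    unfolding mark_orbit_def
  proof (rule runs_WhileLess[where \<Phi> = "\<lambda>s. 9 * (p - fst s 12) + 1"])
    fix R' M' assume I: "I (R', M')" and lt: "R' 12 < R' 5"
    define y where "y = (rot q p ^^ R' 12) x"
    have y: "y < q ^ p" unfolding y_def by (rule funpow_rot_less[OF q p x])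
    have R': "R' 1 = q" "R' (Suc 0) = q" "R' 3 = 1" "R' 5 = p" "R' 6 = q ^ p" "R' 7 = q ^ (p - 1)" "R' 8 = B" "R' 11 = y"
      using I R by (auto simp: I_def y_def)
    have j: "R' 12 < p" using lt R' by simp
    have yq: "y * q < W"
    proof -
      have "y * q < q ^ p * q" using y q by simp
      from this W(1) show ?thesis by (rule less_le_trans)
    qed
    have rot: "y * q mod q ^ p + y div q ^ (p - 1) = rot q p y" by (simp add: rot_def)
    have rotW: "rot q p y < W" using rot_less[OF q p y] W(2) by simp
    have "y * q mod q ^ p < W" "y div q ^ (p - 1) < W"
      using rotW rot by simp_all
    moreover have "\<exists>j<R' 12. a = B + (rot q p ^^ j) x \<Longrightarrow> \<exists>j<Suc (R' 12). a = B + (rot q p ^^ j) x" for a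
      using less_SucI by blast
    ultimately show "\<exists>b. runs W (block
        [Op Add 13 8 11, Store 13 3, Op Mul 15 11 1, Op Mod 15 15 6, Op Div 16 11 7, Op Add 11 15 16,
         Op Add 12 12 3]) (R', M') b
        (\<lambda>s'. I s' \<and> b + 1 + (9 * (p - fst s' 12) + 1) \<le> 9 * (p - fst (R', M') 12) + 1)"
      using I j y yq rotW W
      by (intro exI[of _ 8] runs_block)
        (auto simp: R' rot rot[unfolded One_nat_def] I_def y_def[symmetric] less_Suc_eq fun_eq_iff)
  qed (use R in \<open>auto simp: I_def\<close>)
  then show ?thesis
    by (rule runs_weaken) (use R in \<open>auto simp: I_def\<close>)
qed

text \<open>The letters are produced by repeated division, from the last to the first.\<close>

definition write_word :: prog where
  "write_word = WhileLess 12 13 (block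
    [Op Sub 13 13 3, Op Mod 15 11 1, Store 13 15, Op Div 11 11 1])"

lemma runs_write_word:
  assumes R: "R 1 = q" "R 3 = 1" "R 11 = x" "R 12 = B" "R 13 = B + n"
    and q: "2 \<le> q" and W: "q \<le> W" "B + n < W" "x < W"
  shows "runs W write_word (R, M) (6 * n + 1) (\<lambda>(R', M'). (\<forall>r\<le>10. R' r = R r) \<and>
    M' = (\<lambda>a. if B \<le> a \<and> a < B + n then x div q ^ (B + n - 1 - a) mod q else M a))"
proof -
  define I where "I = (\<lambda>(R', M'). (\<forall>r\<le>10. R' r = R r) \<and> R' 12 = B \<and> B \<le> R' 13 \<and> R' 13 \<le> B + n \<and>
    R' 11 = x div q ^ (B + n - R' 13) \<and>
    M' = (\<lambda>a. if R' 13 \<le> a \<and> a < B + n then x div q ^ (B + n - 1 - a) mod q else M a))"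
  have "runs W write_word (R, M) (6 * (fst (R, M) 13 - B) + 1) (\<lambda>s'. I s' \<and> \<not> fst s' 12 < fst s' 13)"
    unfolding write_word_def
  proof (rule runs_WhileLess[where \<Phi> = "\<lambda>s. 6 * (fst s 13 - B) + 1"])
    fix R' M' assume I: "I (R', M')" and lt: "R' 12 < R' 13"
    define e where "e = B + n - R' 13"
    have R': "R' 1 = q" "R' (Suc 0) = q" "R' 3 = 1" "R' 12 = B" "R' 11 = x div q ^ e"
      using I R by (auto simp: I_def e_def)
    have b: "B < R' 13" "R' 13 \<le> B + n" using I lt by (auto simp: I_def)
    have e1: "B + n - (R' 13 - 1) = Suc e" "B + n - 1 - (R' 13 - 1) = e"
      using b by (auto simp: e_def)
    have "x div q ^ e \<le> x" by (rule div_le_dividend)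
    then have small: "x div q ^ e < W" using W(3) by (rule le_less_trans)
    then have small': "x div q ^ e div q < W" by (rule le_less_trans[OF div_le_dividend])
    have mod: "x div q ^ e mod q < W" using q W by (meson less_le_trans mod_less_divisor zero_less_numeral)
    have div: "x div q ^ e div q = x div q ^ Suc e" by (simp only: power_Suc2 div_mult2_eq)
    have upd: "M'(R' 13 - 1 := x div q ^ e mod q)
        = (\<lambda>a. if R' 13 - 1 \<le> a \<and> a < B + n then x div q ^ (B + n - 1 - a) mod q else M a)"
    proof
      fix a
      show "(M'(R' 13 - 1 := x div q ^ e mod q)) a
          = (if R' 13 - 1 \<le> a \<and> a < B + n then x div q ^ (B + n - 1 - a) mod q else M a)"
      proof (cases "a = R' 13 - 1")
        case True
        have "R' 13 - 1 < B + n" using b by linarith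
        then show ?thesis unfolding True using e1(2) by simp
      next
        case False
        then have "R' 13 - 1 \<le> a \<longleftrightarrow> R' 13 \<le> a" by linarith
        then show ?thesis using False I by (simp add: I_def)
      qed
    qed
    let ?R = "R'(13 := R' 13 - 1, 15 := x div q ^ e mod q, 11 := x div q ^ e div q)"
    let ?M = "M'(R' 13 - 1 := x div q ^ e mod q)"
    have new: "I (?R, ?M)"
    proof -
      have "\<forall>r\<le>10. R' r = R r" using I by (simp add: I_def)
      moreover have "B \<le> R' 13 - 1" "R' 13 - 1 \<le> B + n" using b by linarith+
      moreover have "x div q ^ e div q = x div q ^ (B + n - (R' 13 - 1))" unfolding e1(1) by (rule div)
      ultimately show ?thesis unfolding I_def upd prod.case using R'(4) by simp
    qed
    have "runs W (block [Op Sub 13 13 3, Op Mod 15 11 1, Store 13 15, Op Div 11 11 1]) (R', M') 5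
        (\<lambda>s'. s' = (?R, ?M))"
      using b small small' mod W by (intro runs_block) (simp_all add: R')
    moreover have "5 + 1 + (6 * (?R 13 - B) + 1) \<le> 6 * (R' 13 - B) + 1"
      using b by simp
    ultimately show "\<exists>b. runs W (block [Op Sub 13 13 3, Op Mod 15 11 1, Store 13 15, Op Div 11 11 1]) (R', M') b
        (\<lambda>s'. I s' \<and> b + 1 + (6 * (fst s' 13 - B) + 1) \<le> 6 * (fst (R', M') 13 - B) + 1)"
      using new by (intro exI[of _ 5], elim runs_weaken) auto
  qed (use R in \<open>auto simp: I_def\<close>)
  then show ?thesis
    using R by (elim runs_weaken) (auto simp: I_def)
qed


definition find_width :: prog where
  "find_width = block
    [Const 3 1, Op Add 5 3 4, Op Add 6 1 4, Op Add 7 3 4, Op Mul 13 2 5,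
     WhileLess 6 13 (block [Op Add 7 6 4, Op Mul 6 6 1, Op Add 5 5 3, Op Mul 13 2 5])]"

definition found_word :: prog where
  "found_word = block
    [Op Add 11 9 4, Op Add 12 4 4, mark_orbit,
     Op Add 11 9 4, Op Mul 12 10 0, Op Add 13 12 0, write_word,
     Op Add 10 10 3]"

definition enumerate_words :: prog where
  "enumerate_words = WhileLess 10 2 (block
    [Op Add 13 8 9, Load 14 13, IfLess 14 3 found_word Skip, Op Add 9 9 3])"

definition centres_prog :: prog where
  "centres_prog = block [find_width, Op Mul 8 2 0, enumerate_words]"

context
  fixes q n k W :: nat
  assumes q: "2 \<le> q" and n: "1 \<le> n" and k: "1 \<le> k" and few: "k * n < q ^ n"
    and W: "q * q * (k * n) < W"
begin

lemma word_bounds: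
  assumes "1 \<le> p" "p \<le> n" "q ^ p \<le> q * (k * n)"
  shows "p < W" "n < W" "q < W" "1 < W" "k * p < W" "k * n < W" "q ^ p < W" "q ^ p * q < W"
    "k * n + q ^ p < W"
proof -
  let ?c = "k * n"
  have c: "1 \<le> ?c" "n \<le> ?c" "k * p \<le> ?c" using n k assms by auto
  then have "p \<le> ?c" using assms(2) by (meson order_trans)
  have "2 * (q * ?c) \<le> q * (q * ?c)" using q by (rule mult_le_mono1)
  moreover have "2 * ?c \<le> q * ?c" using q by (rule mult_le_mono1)
  moreover have "q * 1 \<le> q * ?c" using c(1) by (rule mult_le_mono2)
  moreover have "q * (q * ?c) < W" using W by (simp only: mult.assoc)
  moreover have "q ^ p * q \<le> q * (q * ?c)" using assms(3) by (simp add: mult.commute)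
  ultimately show "p < W" "n < W" "q < W" "1 < W" "k * p < W" "k * n < W" "q ^ p < W" "q ^ p * q < W"
    "k * n + q ^ p < W"
    using c \<open>p \<le> ?c\<close> assms q by linarith+
qed

definition width_found :: "state \<Rightarrow> bool" where
  "width_found = (\<lambda>(R, M). M = (\<lambda>_. 0) \<and> R 0 = n \<and> R 1 = q \<and> R 2 = k \<and> R 3 = 1 \<and> R 4 = 0 \<and>
    1 \<le> R 5 \<and> R 5 \<le> n \<and> R 6 = q ^ R 5 \<and> R 7 = q ^ (R 5 - 1) \<and> q ^ R 5 \<le> q * (k * n) \<and>
    R 9 = 0 \<and> R 10 = 0)"

lemma runs_find_width:
  "runs W find_width (input_state q n k) (6 * n + 7) (\<lambda>s. width_found s \<and> k * fst s 5 \<le> q ^ fst s 5)"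
proof -
  define I where "I = (\<lambda>s. width_found s \<and> fst s 13 = k * fst s 5)"
  have "q * 1 \<le> q * (k * n)" using n k by (intro mult_le_mono2) simp
  then have base: "q \<le> q * (k * n)" by simp
  have loop: "runs W (WhileLess 6 13 (block [Op Add 7 6 4, Op Mul 6 6 1, Op Add 5 5 3, Op Mul 13 2 5]))
    s (6 * (n - fst s 5) + 1) (\<lambda>s'. I s' \<and> \<not> fst s' 6 < fst s' 13)" if "I s" for s
  proof (rule runs_WhileLess[where \<Phi> = "\<lambda>s. 6 * (n - fst s 5) + 1"])
    fix R M assume I: "I (R, M)" and lt: "R 6 < R 13"
    define p where "p = R 5"
    have R: "M = (\<lambda>_. 0)" "R 0 = n" "R 1 = q" "R (Suc 0) = q" "R 2 = k" "R 3 = 1" "R 4 = 0" "R 5 = p" "R 6 = q ^ p"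
      "R 7 = q ^ (p - 1)" "R 13 = k * p" "R 9 = 0" "R 10 = 0"
      and p: "1 \<le> p" "p \<le> n" "q ^ p \<le> q * (k * n)"
      using I by (auto simp: I_def width_found_def p_def)
    have lt': "q ^ p < k * p" using lt R by simp
    \<comment> \<open>The width never grows beyond \<open>n\<close>, since \<open>k * n < q ^ n\<close>.\<close>
    then have "p \<noteq> n" using few by auto
    then have pn: "Suc p \<le> n" using p by simp
    have "q ^ p < k * n" using lt' p(2) by (meson less_le_trans mult_le_mono2)
    then have "q * q ^ p \<le> q * (k * n)" by (intro mult_le_mono2) simp
    then have next_p: "q ^ Suc p \<le> q * (k * n)" by simp
    note b = word_bounds[OF p] word_bounds[OF _ pn next_p]
    show "\<exists>b. runs W (block [Op Add 7 6 4, Op Mul 6 6 1, Op Add 5 5 3, Op Mul 13 2 5]) (R, M) b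
        (\<lambda>s'. I s' \<and> b + 1 + (6 * (n - fst s' 5) + 1) \<le> 6 * (n - fst (R, M) 5) + 1)"
    proof (intro exI[of _ 5] runs_block)
    qed (use b p pn next_p in \<open>auto simp: R I_def width_found_def mult.commute[of _ q]\<close>)
  qed (use that in auto)
  let ?R = "(\<lambda>_. 0)(0 := n, 1 := q, 2 := k, 3 := 1, 5 := 1, 6 := q, 7 := 1, 13 := k)"
  have "I (?R, \<lambda>_. 0)" using base n by (simp add: I_def width_found_def)
  then have "runs W (WhileLess 6 13 (block [Op Add 7 6 4, Op Mul 6 6 1, Op Add 5 5 3, Op Mul 13 2 5]))
      (?R, \<lambda>_. 0) (6 * n + 1) (\<lambda>s'. I s' \<and> \<not> fst s' 6 < fst s' 13)"
    by (rule runs_weaken[OF loop]) auto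
  then have fin: "runs W (block [WhileLess 6 13 (block [Op Add 7 6 4, Op Mul 6 6 1, Op Add 5 5 3, Op Mul 13 2 5])])
      (?R, \<lambda>_. 0) (6 * n + 2) (\<lambda>s. width_found s \<and> k * fst s 5 \<le> q ^ fst s 5)"
    by (intro runs_block_Cons[where b' = 1], elim runs_weaken)
      (auto intro!: runs_Skip simp: I_def width_found_def)
  have b: "1 < W" "q < W" "k < W" using word_bounds[of 1] n base by auto
  show ?thesis
    unfolding find_width_def input_state_def
    apply (rule runs_block_Const, use b in simp)
     apply (rule runs_block_Op, use b in simp)
      apply (rule runs_block_Op, use b in simp)
       apply (rule runs_block_Op, use b in simp)
        apply (rule runs_block_Op, use b in simp)
         apply (rule runs_weaken[OF fin[THEN back_subst[where P = "\<lambda>R. runs W _ (R, _) _ _"]]])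
           apply (simp add: fun_eq_iff)
          apply simp_all
    done
qed

end

context
  fixes q n k W p :: nat
  assumes q: "2 \<le> q" and n: "1 \<le> n" and k: "1 \<le> k" and few: "k * n < q ^ n"
    and W: "q * q * (k * n) < W"
    and p: "1 \<le> p" "p \<le> n" "q ^ p \<le> q * (k * n)" "k * p \<le> q ^ p"
begin

lemmas W_bounds = word_bounds[OF q n k few W p(1-3)]

definition ready :: "(nat \<Rightarrow> nat) \<Rightarrow> bool" where
  "ready R \<longleftrightarrow> R 0 = n \<and> R 1 = q \<and> R 2 = k \<and> R 3 = 1 \<and> R 4 = 0 \<and> R 5 = p \<and> R 6 = q ^ p \<and>
    R 7 = q ^ (p - 1) \<and> R 8 = k * n"

definition with_marks :: "nat \<Rightarrow> (nat \<Rightarrow> nat) \<Rightarrow> nat \<Rightarrow> nat" where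
  "with_marks x M = (\<lambda>a. if \<exists>j<p. a = k * n + (rot q p ^^ j) x then 1 else M a)"

definition with_word :: "nat \<Rightarrow> nat \<Rightarrow> (nat \<Rightarrow> nat) \<Rightarrow> nat \<Rightarrow> nat" where
  "with_word i x M = (\<lambda>a. if i * n \<le> a \<and> a < i * n + n then x div q ^ (i * n + n - 1 - a) mod q else M a)"

lemma ready_cong: "(\<forall>r\<le>10. R' r = R r) \<Longrightarrow> ready R' = ready R"
  by (simp add: ready_def)

lemma slot_fits: "i < k \<Longrightarrow> i * n + n \<le> k * n"
  using mult_le_mono1[of "Suc i" k n] by simp

lemma runs_output_found:
  assumes R: "ready R" "R 9 = x" "R 10 = i" and i: "i < k" and x: "x < q ^ p"
  shows "runs W (block [Op Add 11 9 4, Op Mul 12 10 0, Op Add 13 12 0, write_word, Op Add 10 10 3])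
    (R, M) (6 * n + 6)
    (\<lambda>(R', M'). ready R' \<and> R' 9 = x \<and> R' 10 = Suc i \<and> M' = with_word i x M)"
proof -
  have Rq: "R 0 = n" "R 1 = q" "R (Suc 0) = q" "R 2 = k" "R 3 = 1" "R 4 = 0"
    using R by (simp_all add: ready_def)
  have "k * 1 \<le> k * n" using n by (rule mult_le_mono2)
  then have "k < W" using W_bounds(6) by linarith
  then have b: "i * n + n < W" "x < W" "i * n < W" "Suc i < W"
    using slot_fits[OF i] W_bounds x i by auto
  let ?R = "R(11 := x, 12 := i * n, 13 := i * n + n)"
  have "runs W write_word (?R, M) (6 * n + 1) (\<lambda>(R', M'). (\<forall>r\<le>10. R' r = ?R r) \<and>
      M' = (\<lambda>a. if i * n \<le> a \<and> a < i * n + n then x div q ^ (i * n + n - 1 - a) mod q else M a))"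
    using Rq b W_bounds q by (intro runs_write_word) auto
  then have "runs W (block [write_word, Op Add 10 10 3]) (?R, M) (3 + 6 * n)
      (\<lambda>(R', M'). ready R' \<and> R' 9 = x \<and> R' 10 = Suc i \<and> M' = with_word i x M)"
    by (intro runs_block_Cons[where b' = 2], elim runs_weaken)
      (use R b Rq in \<open>auto intro!: runs_block_Op runs_block_Nil simp: ready_def with_word_def simp del: block.simps\<close>)
  then show ?thesis
    using Rq R b by (intro runs_block_Op) (simp_all del: block.simps)
qed

lemma runs_found_word:
  assumes R: "ready R" "R 9 = x" "R 10 = i" and i: "i < k" and x: "x < q ^ p"
  shows "runs W found_word (R, M) (24 * n)
    (\<lambda>(R', M'). ready R' \<and> R' 9 = x \<and> R' 10 = Suc i \<and> M' = with_word i x (with_marks x M))"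
proof -
  have Rq: "R 0 = n" "R 1 = q" "R (Suc 0) = q" "R 2 = k" "R 3 = 1" "R 4 = 0"
    using R by (simp_all add: ready_def)
  let ?R = "R(11 := x, 12 := 0)"
  have "runs W mark_orbit (?R, M) (9 * p + 1) (\<lambda>(R', M'). (\<forall>r\<le>10. R' r = ?R r) \<and>
      M' = (\<lambda>a. if \<exists>j<p. a = k * n + (rot q p ^^ j) x then 1 else M a))"
    using R(1) W_bounds q x p by (intro runs_mark_orbit) (auto simp: ready_def)
  then have "runs W mark_orbit (?R, M) (9 * p + 1)
      (\<lambda>s'. runs W (block [Op Add 11 9 4, Op Mul 12 10 0, Op Add 13 12 0, write_word, Op Add 10 10 3])
        s' (6 * n + 6)
        (\<lambda>(R', M'). ready R' \<and> R' 9 = x \<and> R' 10 = Suc i \<and> M' = with_word i x (with_marks x M)))"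
  proof (rule runs_weaken[OF _ order_refl])
    fix s' assume s': "case s' of (R', M') \<Rightarrow> (\<forall>r\<le>10. R' r = ?R r) \<and>
      M' = (\<lambda>a. if \<exists>j<p. a = k * n + (rot q p ^^ j) x then 1 else M a)"
    obtain R' M' where eq: "s' = (R', M')" by (cases s')
    have "\<forall>r\<le>10. R' r = R r" and M': "M' = with_marks x M"
      using s' by (simp_all add: eq with_marks_def)
    then have "ready R'" "R' 9 = x" "R' 10 = i" using R ready_cong by auto
    then show "runs W (block [Op Add 11 9 4, Op Mul 12 10 0, Op Add 13 12 0, write_word, Op Add 10 10 3])
        s' (6 * n + 6)
        (\<lambda>(R', M'). ready R' \<and> R' 9 = x \<and> R' 10 = Suc i \<and> M' = with_word i x (with_marks x M))"
      using runs_output_found[OF _ _ _ i x] by (simp only: eq M')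
  qed
  then have "runs W (block [mark_orbit, Op Add 11 9 4, Op Mul 12 10 0, Op Add 13 12 0, write_word, Op Add 10 10 3])
      (?R, M) (9 * p + 6 * n + 7)
      (\<lambda>(R', M'). ready R' \<and> R' 9 = x \<and> R' 10 = Suc i \<and> M' = with_word i x (with_marks x M))"
    by (rule runs_block_Cons) simp
  then have "runs W (block [mark_orbit, Op Add 11 9 4, Op Mul 12 10 0, Op Add 13 12 0, write_word, Op Add 10 10 3])
      (?R, M) (24 * n - 1 - 1)
      (\<lambda>(R', M'). ready R' \<and> R' 9 = x \<and> R' 10 = Suc i \<and> M' = with_word i x (with_marks x M))"
    using p(2) n by (elim runs_weaken) auto
  then show ?thesis
    unfolding found_word_def using Rq R x W_bounds n
    by (intro runs_block_Op) (simp_all del: block.simps)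
qed

definition least_below :: "nat \<Rightarrow> nat list" where
  "least_below x = filter (least_rotation q p) [0..<x]"

lemma least_below_Suc:
  "least_below (Suc x) = least_below x @ (if least_rotation q p x then [x] else [])"
  by (simp add: least_below_def)

lemma set_least_below: "set (least_below x) = {x'. x' < x \<and> least_rotation q p x'}"
  by (auto simp: least_below_def)

lemma length_least_below: "length (least_below x) = card {x'. x' < x \<and> least_rotation q p x'}"
  using distinct_card[of "least_below x"] set_least_below by (simp add: least_below_def)

text \<open>The marks describe exactly the classes of the least elements below the candidate, and the
  output area holds their words of length \<open>n\<close>.\<close>

definition sieve_inv :: "state \<Rightarrow> bool" where
  "sieve_inv = (\<lambda>(R, M). ready R \<and> R 9 \<le> k * p \<and> R 10 = length (least_below (R 9)) \<and> R 10 \<le> k \<and>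
    (\<forall>z<q ^ p. M (k * n + z) = (if \<exists>x'\<in>set (least_below (R 9)). \<exists>j<p. z = (rot q p ^^ j) x' then 1 else 0)) \<and>
    (\<forall>i<R 10. \<forall>j<n. M (i * n + j) = least_below (R 9) ! i div q ^ (n - 1 - j) mod q))"

lemma sieve_inv_skip:
  assumes I: "sieve_inv (R, M)" and not: "\<not> least_rotation q p (R 9)" and lt: "R 9 < k * p"
    and R': "ready R'" "R' 9 = Suc (R 9)" "R' 10 = R 10"
  shows "sieve_inv (R', M)"
  using I not lt R' by (simp add: sieve_inv_def least_below_Suc)

lemma sieve_inv_found:
  assumes I: "sieve_inv (R, M)" and least: "least_rotation q p (R 9)" and lt: "R 9 < k * p" "R 10 < k"
    and R': "ready R'" "R' 9 = Suc (R 9)" "R' 10 = Suc (R 10)"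
    and M': "M' = with_word (R 10) (R 9) (with_marks (R 9) M)"
  shows "sieve_inv (R', M')"
proof -
  define x where "x = R 9"
  define xs where "xs = least_below x"
  define i where "i = R 10"
  have i: "i = length xs" "i < k" using I lt by (simp_all add: sieve_inv_def i_def xs_def x_def)
  have xs': "least_below (Suc x) = xs @ [x]" using least by (simp add: least_below_Suc xs_def x_def)
  note fit = slot_fits[OF i(2)]
  have marks: "M' (k * n + z) = (if \<exists>x'\<in>set (xs @ [x]). \<exists>j<p. z = (rot q p ^^ j) x' then 1 else 0)"
    if "z < q ^ p" for z
  proof -
    have "M' (k * n + z) = with_marks x M (k * n + z)"
      using fit by (simp add: M' with_word_def i_def[symmetric] x_def)
    also have "\<dots> = (if \<exists>j<p. z = (rot q p ^^ j) x then 1 else M (k * n + z))"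
      by (simp add: with_marks_def)
    also have "M (k * n + z) = (if \<exists>x'\<in>set xs. \<exists>j<p. z = (rot q p ^^ j) x' then 1 else 0)"
      using I that by (simp add: sieve_inv_def xs_def x_def)
    finally show ?thesis by auto
  qed
  have out: "M' (l * n + j) = (xs @ [x]) ! l div q ^ (n - 1 - j) mod q" if "l < Suc i" "j < n" for l j
  proof (cases "l = i")
    case True
    then show ?thesis using that i by (simp add: M' with_word_def i_def[symmetric] x_def[symmetric])
  next
    case False
    then have l: "l < i" using that by simp
    have "l * n + n \<le> i * n" using mult_le_mono1[of "Suc l" i n] l by simp
    then have addr: "l * n + j < i * n" using that(2) by simp
    have "M' (l * n + j) = M (l * n + j)"
      using addr fit by (auto simp: M' with_word_def with_marks_def i_def[symmetric])
    also have "\<dots> = xs ! l div q ^ (n - 1 - j) mod q"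
      using I l that(2) by (simp add: sieve_inv_def xs_def x_def i_def)
    finally show ?thesis using l i by (simp add: nth_append)
  qed
  show ?thesis
    using R' lt i marks out by (simp add: sieve_inv_def xs' x_def[symmetric] i_def[symmetric])
qed

text \<open>A candidate costs at most 7 units, and a selected one another \<open>24 * n\<close>.  The candidates stay
  below \<open>k * p\<close>, because there are at least \<open>k\<close> least elements below this number.\<close>

lemma runs_sieve_step:
  assumes I: "sieve_inv (R, M)" and lt: "R 10 < R 2"
  shows "\<exists>b. runs W (block [Op Add 13 8 9, Load 14 13, IfLess 14 3 found_word Skip, Op Add 9 9 3]) (R, M) b
    (\<lambda>s'. sieve_inv s' \<and> b + 1 + (7 * (k * p - fst s' 9) + 24 * n * (k - fst s' 10) + 1)
      \<le> 7 * (k * p - R 9) + 24 * n * (k - R 10) + 1)"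
proof -
  define x where "x = R 9"
  define i where "i = R 10"
  have ready: "ready R" and i: "i = length (least_below x)" "i < k" and x_le: "x \<le> k * p"
    using I lt by (simp_all add: sieve_inv_def i_def x_def ready_def)
  have R: "R 0 = n" "R 1 = q" "R (Suc 0) = q" "R 2 = k" "R 3 = 1" "R 4 = 0" "R 8 = k * n"
    using ready by (simp_all add: ready_def)
  \<comment> \<open>At the candidate \<open>k * p\<close> all \<open>k\<close> words would have been found.\<close>
  have "x \<noteq> k * p"
    using many_least_rotations[OF q p(1,4)] i length_least_below[of x] by auto
  then have x: "x < k * p" using x_le by simp
  then have xq: "x < q ^ p" using p(4) by simp
  have mark: "M (k * n + x) = (if least_rotation q p x then 0 else 1)"
    using I xq least_rotation_iff_unmarked[OF q p(1) xq] set_least_below[of x]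
    by (auto simp: sieve_inv_def x_def)
  have b: "k * n + x < W" "Suc x < W" using W_bounds xq by auto
  have "k * p - x = Suc (k * p - Suc x)" "k - i = Suc (k - Suc i)" using x i(2) by simp_all
  then have \<Phi>: "7 * (k * p - x) = 7 * (k * p - Suc x) + 7"
    "24 * n * (k - i) = 24 * n * (k - Suc i) + 24 * n" by simp_all
  let ?R = "R(13 := k * n + x, 14 := M (k * n + x))"
  have r: "ready ?R" "?R 9 = x" "?R 10 = i" using ready by (simp_all add: ready_def x_def i_def)
  show ?thesis
  proof (cases "least_rotation q p x")
    case True
    let ?Q = "\<lambda>s'. sieve_inv s' \<and> fst s' 9 = Suc x \<and> fst s' 10 = Suc i"
    have "runs W found_word (?R, M) (24 * n) (\<lambda>s'. runs W (block [Op Add 9 9 3]) s' 2 ?Q)"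
    proof (rule runs_weaken[OF runs_found_word[OF r i(2) xq] order_refl])
      fix s' assume s': "case s' of (R', M') \<Rightarrow>
        ready R' \<and> R' 9 = x \<and> R' 10 = Suc i \<and> M' = with_word i x (with_marks x M)"
      obtain R' M' where eq: "s' = (R', M')" by (cases s')
      have R': "ready R'" "R' 9 = x" "R' 10 = Suc i" and M': "M' = with_word i x (with_marks x M)"
        using s' by (simp_all add: eq)
      have "ready (R'(9 := Suc x))" using R'(1) by (simp add: ready_def)
      then have inv: "sieve_inv (R'(9 := Suc x), M')"
        using sieve_inv_found[OF I] True x i(2) R' M' by (simp add: x_def i_def)
      have "R' 3 = 1" using R'(1) by (simp add: ready_def)
      then show "runs W (block [Op Add 9 9 3]) s' 2 ?Q"
        unfolding eq using inv R' b by (intro runs_block) simp_all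
    qed
    then have "runs W (IfLess 14 3 found_word Skip) (?R, M) (24 * n + 1)
        (\<lambda>s'. runs W (block [Op Add 9 9 3]) s' 2 ?Q)"
      using mark True R by (intro runs_IfLess[where b = "24 * n"]) auto
    then have "runs W (block [IfLess 14 3 found_word Skip, Op Add 9 9 3]) (?R, M) (3 + 24 * n) ?Q"
      by (rule runs_block_Cons) simp
    then have "runs W (block [Op Add 13 8 9, Load 14 13, IfLess 14 3 found_word Skip, Op Add 9 9 3])
        (R, M) (24 * n + 5) ?Q"
      using R b by (intro runs_block_Op runs_block_Load) (simp_all add: x_def del: block.simps)
    then show ?thesis
      by (intro exI[of _ "24 * n + 5"], elim runs_weaken) (use \<Phi> in \<open>simp_all add: x_def i_def\<close>)
  next
    case False
    let ?Q = "\<lambda>s'. sieve_inv s' \<and> fst s' 9 = Suc x \<and> fst s' 10 = i"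
    have "ready (?R(9 := Suc x))" using ready by (simp add: ready_def)
    then have inv: "sieve_inv (?R(9 := Suc x), M)"
      using sieve_inv_skip[OF I] False x by (simp add: x_def i_def)
    have "runs W (block [Op Add 9 9 3]) (?R, M) 2 ?Q"
      using inv R b i_def by (intro runs_block) (simp_all add: x_def)
    then have "runs W (IfLess 14 3 found_word Skip) (?R, M) 2
        (\<lambda>s'. runs W (block [Op Add 9 9 3]) s' 2 ?Q)"
      using mark False R by (intro runs_IfLess[where b = 1] runs_Skip) auto
    then have "runs W (block [IfLess 14 3 found_word Skip, Op Add 9 9 3]) (?R, M) 4 ?Q"
      by (rule runs_block_Cons) simp
    then have "runs W (block [Op Add 13 8 9, Load 14 13, IfLess 14 3 found_word Skip, Op Add 9 9 3])
        (R, M) 6 ?Q"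
      using R b by (intro runs_block_Op runs_block_Load) (simp_all add: x_def del: block.simps)
    then show ?thesis
      by (intro exI[of _ 6], elim runs_weaken) (use \<Phi> in \<open>simp_all add: x_def i_def\<close>)
  qed
qed

lemma runs_enumerate_words:
  assumes "sieve_inv (R, M)"
  shows "runs W enumerate_words (R, M) (7 * (k * p - R 9) + 24 * n * (k - R 10) + 1)
    (\<lambda>s. sieve_inv s \<and> fst s 10 = k)"
proof -
  have "runs W enumerate_words (R, M) (7 * (k * p - fst (R, M) 9) + 24 * n * (k - fst (R, M) 10) + 1)
    (\<lambda>s. sieve_inv s \<and> \<not> fst s 10 < fst s 2)"
    unfolding enumerate_words_def
    by (rule runs_WhileLess[where \<Phi> = "\<lambda>s. 7 * (k * p - fst s 9) + 24 * n * (k - fst s 10) + 1"])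
      (use runs_sieve_step assms in auto)
  then show ?thesis
    by (elim runs_weaken) (auto simp: sieve_inv_def ready_def)
qed

end

lemma runs_centres_prog:
  assumes q: "2 \<le> q" and n: "1 \<le> n" and k: "1 \<le> k" and few: "k * n < q ^ n"
    and W: "q * q * (k * n) < W"
  shows "runs W centres_prog (input_state q n k) (50 * (n * k))
    (\<lambda>s. \<exists>xs. length xs = k \<and> distinct xs \<and> (\<forall>x\<in>set xs. x < q ^ n \<and> least_rotation q n x) \<and>
      (\<forall>i<k. map (\<lambda>j. snd s (i * n + j)) [0..<n] = digits q n (xs ! i)))"
    (is "runs W _ _ _ ?Q")
proof -
  have "runs W find_width (input_state q n k) (6 * n + 7)
      (\<lambda>s'. runs W (block [Op Mul 8 2 0, enumerate_words]) s' (31 * (n * k) + 3) ?Q)"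
  proof (rule runs_weaken[OF runs_find_width[OF assms] order_refl])
    fix s' assume s': "width_found q n k s' \<and> k * fst s' 5 \<le> q ^ fst s' 5"
    obtain R M where eq: "s' = (R, M)" by (cases s')
    define p where "p = R 5"
    have R: "M = (\<lambda>_. 0)" "R 0 = n" "R 1 = q" "R (Suc 0) = q" "R 2 = k" "R 3 = 1" "R 4 = 0" "R 5 = p" "R 6 = q ^ p"
      "R 7 = q ^ (p - 1)" "R 9 = 0" "R 10 = 0"
      and p: "1 \<le> p" "p \<le> n" "q ^ p \<le> q * (k * n)" "k * p \<le> q ^ p"
      using s' by (auto simp: eq width_found_def[OF assms] p_def)
    note ctx = q n k few W p
    have b: "k * n < W" using word_bounds[OF q n k few W p(1-3)] by simp
    let ?R = "R(8 := k * n)"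
    have "ready q n k p ?R" using R by (simp add: ready_def[OF ctx])
    then have I: "sieve_inv q n k p (?R, M)"
      using R by (simp add: sieve_inv_def[OF ctx] least_below_def[OF ctx])
    have "7 * (k * p - ?R 9) + 24 * n * (k - ?R 10) + 1 \<le> 31 * (n * k) + 1"
    proof -
      have "k * p \<le> n * k" using p(2) by simp
      then show ?thesis using R by (simp add: mult.assoc)
    qed
    then have "runs W enumerate_words (?R, M) (31 * (n * k) + 1) (\<lambda>s. runs W (block []) s 1 ?Q)"
    proof (rule runs_weaken[OF runs_enumerate_words[OF ctx I]])
      fix s assume s: "sieve_inv q n k p s \<and> fst s 10 = k"
      obtain R' M' where s_eq: "s = (R', M')" by (cases s)
      define xs where "xs = least_below q p (R' 9)"
      have xs: "length xs = k" "R' 9 \<le> k * p"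
        and out: "\<forall>i<k. \<forall>j<n. M' (i * n + j) = xs ! i div q ^ (n - 1 - j) mod q"
        using s by (auto simp: s_eq sieve_inv_def[OF ctx] xs_def)
      have "distinct xs" by (simp add: xs_def least_below_def[OF ctx])
      moreover have "x < q ^ n \<and> least_rotation q n x" if "x \<in> set xs" for x
      proof -
        have "x < R' 9" "least_rotation q p x" using that by (auto simp: xs_def set_least_below[OF ctx])
        moreover have "q ^ p \<le> q ^ n" using p(2) q by (intro power_increasing) auto
        ultimately show ?thesis
          using xs(2) p(4) least_rotation_padded[OF q p(1) _ _ p(2), of x] by simp
      qed
      moreover have "map (\<lambda>j. M' (i * n + j)) [0..<n] = digits q n (xs ! i)" if "i < k" for i
        using out that by (simp add: digits_def)
      ultimately have "?Q s" using xs(1) by (auto simp: s_eq)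
      then show "runs W (block []) s 1 ?Q" by (rule runs_block_Nil) simp
    qed
    then have "runs W (block [enumerate_words]) (?R, M) (31 * (n * k) + 2) ?Q"
      by (rule runs_block_Cons) simp
    then show "runs W (block [Op Mul 8 2 0, enumerate_words]) s' (31 * (n * k) + 3) ?Q"
      unfolding eq using R b by (intro runs_block_Op) (simp_all del: block.simps)
  qed
  moreover have "6 * n + 7 + (31 * (n * k) + 3) \<le> 50 * (n * k)"
  proof -
    have "n * 1 \<le> n * k" using k by (rule mult_le_mono2)
    then show ?thesis using n by linarith
  qed
  ultimately show ?thesis unfolding centres_prog_def by (rule runs_block_Cons)
qed

lemma shift_rel_class_eqD:
  assumes "v \<in> words q n" "shift_rel q n `` {u} = shift_rel q n `` {v}"
  shows "\<exists>i. v = rotate i u"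
proof -
  have "v \<in> shift_rel q n `` {v}"
    using assms(1) by (auto simp: shift_rel_def intro: exI[of _ 0])
  then have "v \<in> shift_rel q n `` {u}" using assms(2) by simp
  then show ?thesis by (auto simp: shift_rel_def)
qed

theorem centres_prog_correct:
  assumes q: "2 \<le> q" and n: "1 \<le> n" and k: "1 \<le> k" and few: "k * n < q ^ n"
  shows "\<exists>t s. exec ((q * n * k) ^ 3) centres_prog (input_state q n k) t s \<and> t \<le> 50 * (n * k) \<and>
    output_set q n k s \<subseteq> necklaces q n \<and> card (output_set q n k s) = k"
proof -
  define c where "c = n * k"
  have c: "1 \<le> c" using n k by (simp add: c_def)
  have "q * q * c * 1 < q * q * c * (q * (c * c))"
  proof -
    have "1 * 1 \<le> c * c" using c by (intro mult_le_mono)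
    then have "2 * 1 \<le> q * (c * c)" using q by (intro mult_le_mono) auto
    then show ?thesis using q c by simp
  qed
  then have W: "q * q * (k * n) < (q * n * k) ^ 3"
    by (simp add: c_def power3_eq_cube mult_ac)
  obtain t s xs where run: "exec ((q * n * k) ^ 3) centres_prog (input_state q n k) t s" "t \<le> 50 * (n * k)"
    and xs: "length xs = k" "distinct xs" "\<And>x. x \<in> set xs \<Longrightarrow> x < q ^ n \<and> least_rotation q n x"
    and out: "\<And>i. i < k \<Longrightarrow> map (\<lambda>j. snd s (i * n + j)) [0..<n] = digits q n (xs ! i)"
    using runs_centres_prog[OF q n k few W] unfolding runs_def by blast
  let ?N = "\<lambda>i. shift_rel q n `` {digits q n (xs ! i)}"
  have set: "output_set q n k s = ?N ` {..<k}"
    unfolding output_set_def using out by (intro image_cong) auto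
  have "?N i \<in> necklaces q n" for i
    unfolding necklaces_def by (intro quotientI digits_in_words q)
  moreover have "inj_on ?N {..<k}"
  proof (rule inj_onI)
    fix i j assume ij: "i \<in> {..<k}" "j \<in> {..<k}" and eq: "?N i = ?N j"
    obtain l where l: "digits q n (xs ! j) = rotate l (digits q n (xs ! i))"
      using shift_rel_class_eqD[OF digits_in_words[OF q] eq] by blast
    have "xs ! i \<in> set xs" "xs ! j \<in> set xs" using ij xs(1) by auto
    then have "xs ! i = xs ! j" using least_rotation_eq_if_rotated[OF q n _ _ _ _ l] xs(3) by blast
    then show "i = j" using ij xs(1,2) nth_eq_iff_index_eq by fastforce
  qed
  then have "card (?N ` {..<k}) = k" by (simp add: card_image)
  ultimately show ?thesis using run set by (intro exI[of _ t] exI[of _ s]) auto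
qed

section \<open>The cost of a set of centres\<close>

lemma necklace_of_word: "w \<in> words q n \<Longrightarrow> shift_rel q n `` {w} \<in> necklaces q n"
  unfolding necklaces_def by (rule quotientI)

lemma overlap_dist_words:
  assumes "w \<in> words q n" "s \<in> words q n"
  shows "overlap_dist (shift_rel q n `` {w}) (shift_rel q n `` {s}) = 1 - real (overlap w s) / real n ^ 2"
  using assms length_words[OF assms(1)] length_words[OF assms(2)]
  by (simp add: overlap_dist_def overlap_coeff_def subwords_necklace size_word_subwords overlap_def)

lemma overlap_dist_bounds:
  assumes "v \<in> necklaces q n" "w \<in> necklaces q n"
  shows "0 \<le> overlap_dist v w" "overlap_dist v w \<le> 1"
proof -
  obtain x y where xy: "x \<in> words q n" "y \<in> words q n" "v = shift_rel q n `` {x}" "w = shift_rel q n `` {y}"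
    using assms unfolding necklaces_def by (elim quotientE) blast
  have "overlap x y \<le> size (word_subwords x)"
    unfolding overlap_def by (intro size_mset_mono) simp
  then have "real (overlap x y) \<le> real n ^ 2"
    using length_words[OF xy(1)] by (simp add: size_word_subwords flip: of_nat_power)
  then have "real (overlap x y) / real n ^ 2 \<le> 1"
    by (cases "n = 0") (auto simp: divide_le_eq_1)
  then show "0 \<le> overlap_dist v w" "overlap_dist v w \<le> 1"
    using overlap_dist_words[OF xy(1,2)] xy(3,4) by simp_all
qed

lemma representatives:
  assumes "S \<subseteq> necklaces q n"
  shows "\<exists>r. \<forall>s\<in>S. r s \<in> words q n \<and> shift_rel q n `` {r s} = s"
proof (rule bchoice, rule ballI)
  fix s assume "s \<in> S"
  then have "s \<in> words q n // shift_rel q n" using assms by (auto simp: necklaces_def)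
  then show "\<exists>x. x \<in> words q n \<and> shift_rel q n `` {x} = s" by (elim quotientE) blast
qed

lemma finite_centres: "S \<subseteq> necklaces q n \<Longrightarrow> finite S"
  using finite_necklaces finite_subset by blast

lemma necklaces_nonempty: "1 \<le> q \<Longrightarrow> necklaces q n \<noteq> {}"
proof -
  assume "1 \<le> q"
  then have "replicate n 0 \<in> words q n" by (auto simp: words_def)
  then show ?thesis using necklace_of_word by blast
qed

lemma centre_cost_bounds:
  assumes q: "1 \<le> q" and S: "S \<subseteq> necklaces q n" "S \<noteq> {}"
  shows "0 \<le> centre_cost q n S" "centre_cost q n S \<le> 1"
proof -
  let ?m = "\<lambda>w. Min (overlap_dist w ` S)"
  have m: "0 \<le> ?m w \<and> ?m w \<le> 1" if "w \<in> necklaces q n" for w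
  proof -
    have "?m w \<in> overlap_dist w ` S" using S finite_centres[OF S(1)] by (intro Min_in) auto
    then obtain s where "s \<in> S" "?m w = overlap_dist w s" by blast
    moreover from this have "s \<in> necklaces q n" using S(1) by blast
    ultimately show ?thesis using overlap_dist_bounds[OF that] by simp
  qed
  have "centre_cost q n S \<in> ?m ` necklaces q n"
    unfolding centre_cost_def using finite_necklaces necklaces_nonempty[OF q] by (intro Max_in) auto
  then show "0 \<le> centre_cost q n S" "centre_cost q n S \<le> 1" using m by auto
qed

lemma centre_cost_ge:
  assumes far: "far_word_exists q n k B" and S: "S \<subseteq> necklaces q n" "card S = k" "S \<noteq> {}"
  shows "1 - B / real n ^ 2 \<le> centre_cost q n S"
proof -
  have fin: "finite S" using S(1) by (rule finite_centres)
  obtain r where r: "\<And>s. s \<in> S \<Longrightarrow> r s \<in> words q n \<and> shift_rel q n `` {r s} = s"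
    using representatives[OF S(1)] by blast
  have "finite (r ` S)" "card (r ` S) \<le> k"
    using fin S(2) card_image_le[OF fin, of r] by simp_all
  moreover have "r ` S \<subseteq> words q n" using r by blast
  ultimately have "\<exists>w\<in>words q n. \<forall>s\<in>r ` S. real (overlap w s) \<le> B"
    using far unfolding far_word_exists_def by (elim allE[of _ "r ` S"]) simp
  then obtain w where w: "w \<in> words q n" "\<And>s. s \<in> S \<Longrightarrow> real (overlap w (r s)) \<le> B"
    by auto
  let ?w = "shift_rel q n `` {w}"
  have "1 - B / real n ^ 2 \<le> overlap_dist ?w s" if "s \<in> S" for s
  proof -
    have "real (overlap w (r s)) / real n ^ 2 \<le> B / real n ^ 2"
      using w(2)[OF that] by (intro divide_right_mono) auto
    moreover have "overlap_dist ?w s = 1 - real (overlap w (r s)) / real n ^ 2"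
      using overlap_dist_words[OF w(1), of "r s"] r[OF that] by (simp only:)
    ultimately show ?thesis by linarith
  qed
  then have "1 - B / real n ^ 2 \<le> Min (overlap_dist ?w ` S)"
    using fin S(3) by (intro Min.boundedI) auto
  also have "\<dots> \<le> centre_cost q n S"
    unfolding centre_cost_def using finite_necklaces necklace_of_word[OF w(1)] by (intro Max_ge) auto
  finally show ?thesis .
qed

text \<open>The tolerance is chosen such that the resulting lower bound on the optimum is the
  reciprocal of the approximation factor.\<close>

lemma approx_err_tolerance:
  assumes L: "L = log q (real k * real n)" "0 \<le> L" "L < real n"
  shows "(1 + approx_err q n k) * (1 - tolerance (real n) L / real n ^ 2) = 1"
    and "0 \<le> approx_err q n k"
proof -
  have n: "real n > 0" "real n - L > 0" using L by auto
  have D: "0 < 2 * real n ^ 2 - L ^ 2" using tolerance_denominator[OF L(2,3)] by simp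
  have "L / d - L ^ 2 / (2 * m * d) = L * (2 * m - L) / (2 * m * d)" if "d \<noteq> 0" "m \<noteq> 0" for d m :: real
    using that by (simp add: power2_eq_square field_simps)
  from this[of "real n - L" "real n"]
  have f: "approx_err q n k = L * (2 * real n - L) / (2 * real n * (real n - L))"
    using n by (simp add: approx_err_def L(1)[symmetric])
  then show "0 \<le> approx_err q n k" using n L(2) by simp
  have "1 + approx_err q n k = (2 * real n ^ 2 - L ^ 2) / (2 * real n * (real n - L))"
    using n unfolding f by (simp add: power2_eq_square field_simps)
  moreover have "1 - tolerance (real n) L / real n ^ 2 = 2 * real n * (real n - L) / (2 * real n ^ 2 - L ^ 2)"
    using n D unfolding tolerance_def by (simp add: field_simps power2_eq_square)
  ultimately show "(1 + approx_err q n k) * (1 - tolerance (real n) L / real n ^ 2) = 1"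
    using n D by simp
qed

definition solves :: "nat \<Rightarrow> prog \<Rightarrow> nat \<Rightarrow> nat \<Rightarrow> nat \<Rightarrow> nat \<Rightarrow> bool" where
  "solves c P d q n k \<longleftrightarrow>
    (\<exists>t s. exec ((q * n * k) ^ d) P (input_state q n k) t s
         \<and> t \<le> c * (n * k)
         \<and> output_set q n k s \<subseteq> necklaces q n
         \<and> card (output_set q n k s) = k
         \<and> centre_cost q n (output_set q n k s) \<le> (1 + approx_err q n k) * centre_opt q n k)"

lemma centre_opt_attained:
  assumes "S \<subseteq> necklaces q n" "card S = k"
  shows "\<exists>S'\<subseteq>necklaces q n. card S' = k \<and> centre_cost q n S' = centre_opt q n k"
proof -
  let ?F = "{S. S \<subseteq> necklaces q n \<and> card S = k}"
  have "finite ?F" using finite_necklaces by simp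
  then have "centre_opt q n k \<in> centre_cost q n ` ?F"
    unfolding centre_opt_def using assms by (intro Min_in) auto
  then show ?thesis by auto
qed

text \<open>The factor times the lower bound on the optimum is 1, the largest possible cost.\<close>

lemma any_centres_good:
  assumes q: "2 \<le> q" "1 \<le> n" "1 \<le> k" "k * n < q ^ n"
    and far: "far_word_exists q n k (tolerance n (log q (real k * real n)))"
    and S: "S \<subseteq> necklaces q n" "card S = k"
  shows "centre_cost q n S \<le> (1 + approx_err q n k) * centre_opt q n k"
proof -
  define L where "L = log q (real k * real n)"
  have L: "0 \<le> L" "L < real n" using L_bounds[OF q] by (simp_all add: L_def)
  have ne: "S' \<noteq> {}" if "card S' = k" for S' :: "nat list set set" using that q(3) by auto
  obtain S' where S': "S' \<subseteq> necklaces q n" "card S' = k" "centre_cost q n S' = centre_opt q n k"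
    using centre_opt_attained[OF S] by blast
  have "centre_cost q n S \<le> 1" using centre_cost_bounds[OF _ S(1) ne[OF S(2)]] q(1) by simp
  also have "1 = (1 + approx_err q n k) * (1 - tolerance (real n) L / real n ^ 2)"
    using approx_err_tolerance(1)[OF L_def L] by simp
  also have "\<dots> \<le> (1 + approx_err q n k) * centre_opt q n k"
    using centre_cost_ge[OF far S'(1,2) ne[OF S'(2)]] S'(3) approx_err_tolerance(2)[OF L_def L]
    by (intro mult_left_mono) (simp_all add: L_def)
  finally show ?thesis .
qed

lemma solves_mono:
  assumes "solves c P d q n k" "c \<le> c'" "d \<le> d'" "1 \<le> q * n * k"
  shows "solves c' P d' q n k"
proof -
  obtain t s where ts: "exec ((q * n * k) ^ d) P (input_state q n k) t s" "t \<le> c * (n * k)"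
    "output_set q n k s \<subseteq> necklaces q n" "card (output_set q n k s) = k"
    "centre_cost q n (output_set q n k s) \<le> (1 + approx_err q n k) * centre_opt q n k"
    using assms(1) by (auto simp: solves_def)
  have "(q * n * k) ^ d \<le> (q * n * k) ^ d'" using assms by (intro power_increasing) auto
  then have "exec ((q * n * k) ^ d') P (input_state q n k) t s"
    using ts(1) exec_word_bound_mono by blast
  moreover have "c * (n * k) \<le> c' * (n * k)" using assms(2) by (rule mult_le_mono1)
  ultimately show ?thesis unfolding solves_def using ts by (meson order_trans)
qed

section \<open>Adding finitely many stored solutions\<close>

lemma solves_iff_runs:
  "solves c P d q n k \<longleftrightarrow> runs ((q * n * k) ^ d) P (input_state q n k) (c * (n * k))
    (\<lambda>s. output_set q n k s \<subseteq> necklaces q n \<and> card (output_set q n k s) = k \<and>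
      centre_cost q n (output_set q n k s) \<le> (1 + approx_err q n k) * centre_opt q n k)"
  by (simp add: solves_def runs_def)

fun write_list :: "nat \<Rightarrow> nat list \<Rightarrow> prog list" where
  "write_list a [] = []"
| "write_list a (v # vs) = Const 3 a # Const 4 v # Store 3 4 # write_list (Suc a) vs"

lemma runs_write_list:
  assumes "\<And>v. v \<in> set vs \<Longrightarrow> v < W" "a + length vs \<le> W"
  shows "runs W (block (write_list a vs)) (R, M) (3 * length vs + 1)
    (\<lambda>s. snd s = (\<lambda>b. if a \<le> b \<and> b < a + length vs then vs ! (b - a) else M b))"
  using assms
proof (induction vs arbitrary: a R M)
  case Nil
  then show ?case by (simp add: runs_Skip fun_eq_iff)
next
  case (Cons v vs)
  let ?R = "R(3 := a, 4 := v)" and ?M = "M(a := v)"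
  have "runs W (block (write_list (Suc a) vs)) (?R, ?M) (3 * length vs + 1)
    (\<lambda>s. snd s = (\<lambda>b. if Suc a \<le> b \<and> b < Suc a + length vs then vs ! (b - Suc a) else ?M b))"
    using Cons.prems by (intro Cons.IH) auto
  then have rest: "runs W (block (write_list (Suc a) vs)) (?R, ?M) (3 * length (v # vs) + 1 - 1 - 1 - 1)
    (\<lambda>s. snd s = (\<lambda>b. if a \<le> b \<and> b < a + length (v # vs) then (v # vs) ! (b - a) else M b))"
  proof (rule runs_weaken)
    fix s :: state
    assume s: "snd s = (\<lambda>b. if Suc a \<le> b \<and> b < Suc a + length vs then vs ! (b - Suc a) else ?M b)"
    show "snd s = (\<lambda>b. if a \<le> b \<and> b < a + length (v # vs) then (v # vs) ! (b - a) else M b)"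
    proof
      fix b
      consider "b = a" | "b < a" | "Suc a \<le> b" by linarith
      then show "snd s b = (if a \<le> b \<and> b < a + length (v # vs) then (v # vs) ! (b - a) else M b)"
      proof cases
        case 3
        then have "b - a = Suc (b - Suc a)" by simp
        then show ?thesis using 3 s by simp
      qed (use s in simp_all)
    qed
  qed simp
  show ?case
    unfolding write_list.simps
    by (rule runs_block_Const, use Cons.prems in simp, rule runs_block_Const, use Cons.prems in simp,
        rule runs_block_Store, use rest in simp_all)
qed

text \<open>Register 3 is reset to 0 before the branch is entered, so that a branch starts
  from the original state.\<close>

definition if_equal :: "nat \<Rightarrow> nat \<Rightarrow> prog \<Rightarrow> prog \<Rightarrow> prog" where
  "if_equal r c P Q = Seq (Const 3 c) (IfLess r 3 (Seq (Const 3 0) Q)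
    (IfLess 3 r (Seq (Const 3 0) Q) (Seq (Const 3 0) P)))"

lemma runs_if_equal:
  assumes R: "R 3 = 0" "r \<noteq> 3" and c: "c < W"
    and P: "R r = c \<Longrightarrow> runs W P (R, M) b Q" and P': "R r \<noteq> c \<Longrightarrow> runs W P' (R, M) b Q"
  shows "runs W (if_equal r c P P') (R, M) (b + 4) Q"
proof -
  have restore: "R(3 := c, 3 := 0) = R" using R(1) by (simp add: fun_upd_idem)
  have reset: "runs W (Seq (Const 3 0) X) (R(3 := c), M) (b + 1) Q" if "runs W X (R, M) b Q" for X
    using c that restore by (intro runs_Seq[where b = 1] runs_Const) auto
  have second: "runs W (IfLess 3 r (Seq (Const 3 0) P') (Seq (Const 3 0) P)) (R(3 := c), M) (b + 2) Q"
    if "\<not> R r < c"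
    using that R(2) P P' by (intro runs_IfLess[where b = "b + 1"] reset) auto
  have "runs W (IfLess r 3 (Seq (Const 3 0) P') (IfLess 3 r (Seq (Const 3 0) P') (Seq (Const 3 0) P)))
      (R(3 := c), M) (b + 3) Q"
  proof (rule runs_IfLess[where b = "b + 2", rotated])
    assume "\<not> (R(3 := c)) r < (R(3 := c)) 3"
    then show "runs W (IfLess 3 r (Seq (Const 3 0) P') (Seq (Const 3 0) P)) (R(3 := c), M) (b + 2) Q"
      using R(2) by (intro second) simp
  next
    assume "(R(3 := c)) r < (R(3 := c)) 3"
    then have "R r \<noteq> c" using R(2) by simp
    then have "runs W (Seq (Const 3 0) P') (R(3 := c), M) (b + 1) Q" by (intro reset P')
    then show "runs W (Seq (Const 3 0) P') (R(3 := c), M) (b + 2) Q" by (rule runs_weaken) auto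
  qed simp
  then show ?thesis
    unfolding if_equal_def using c by (intro runs_Seq[where b = 1 and b' = "b + 3"] runs_Const) auto
qed

definition valid_instance :: "nat \<times> nat \<times> nat \<Rightarrow> bool" where
  "valid_instance = (\<lambda>(q, n, k). 2 \<le> q \<and> 1 \<le> n \<and> 1 \<le> k \<and> k * n < q ^ n)"

lemma valid_instance_pos: "valid_instance (q, n, k) \<Longrightarrow> 2 \<le> q * n * k"
proof -
  assume v: "valid_instance (q, n, k)"
  then have "2 * 1 * 1 \<le> q * n * k" unfolding valid_instance_def by (intro mult_le_mono) auto
  then show ?thesis by simp
qed

text \<open>The values and addresses of the table and the numbers tested are below \<open>2 ^ e\<close>, so raising the
  exponent of the word bound by \<open>e\<close> makes room for them in every instance.\<close>

lemma add_hardwired_instance: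
  assumes P: "\<And>q n k. (q, n, k) \<in> X \<Longrightarrow> solves c P d q n k"
    and X: "\<And>q n k. (q, n, k) \<in> X \<Longrightarrow> valid_instance (q, n, k)"
    and inst: "valid_instance (q0, n0, k0)"
    and S: "S \<subseteq> necklaces q0 n0" "card S = k0"
  shows "\<exists>P' c' d'. \<forall>(q, n, k)\<in>insert (q0, n0, k0) X. solves c' P' d' q n k"
proof -
  obtain Z where Z: "Z \<subseteq> necklaces q0 n0" "card Z = k0" "centre_cost q0 n0 Z = centre_opt q0 n0 k0"
    using centre_opt_attained[OF S] by blast
  have "finite Z" using Z(1) by (rule finite_centres)
  then obtain Ns where Ns: "set Ns = Z" "distinct Ns" by (metis finite_distinct_list)
  have len: "length Ns = k0" using Ns Z(2) distinct_card by fastforce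
  obtain r where r: "\<And>N. N \<in> Z \<Longrightarrow> r N \<in> words q0 n0 \<and> shift_rel q0 n0 `` {r N} = N"
    using representatives[OF Z(1)] by blast
  \<comment> \<open>The concatenated representatives of an optimal set of centres.\<close>
  define vs where "vs = map (\<lambda>a. r (Ns ! (a div n0)) ! (a mod n0)) [0..<k0 * n0]"
  define T where "T = block (write_list 0 vs)"
  define e where "e = q0 + n0 + k0 + k0 * n0"
  define P' where "P' = if_equal 0 n0 (if_equal 1 q0 (if_equal 2 k0 T P) P) P"
  have n0: "1 \<le> n0" and k0: "1 \<le> k0" using inst by (auto simp: valid_instance_def)
  have vs_less: "v < q0" if v: "v \<in> set vs" for v
  proof -
    obtain a where a: "a < k0 * n0" "v = r (Ns ! (a div n0)) ! (a mod n0)"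
      using v by (auto simp: vs_def)
    have "a div n0 < k0" using a(1) by (rule less_mult_imp_div_less)
    then have "Ns ! (a div n0) \<in> Z" using len Ns(1) nth_mem by blast
    then have w: "r (Ns ! (a div n0)) \<in> words q0 n0" using r by blast
    then have "v \<in> set (r (Ns ! (a div n0)))" using n0 by (simp add: a(2) length_words)
    then show ?thesis using w by (auto simp: words_def)
  qed
  have out: "output_set q0 n0 k0 s = Z" if s: "\<And>b. b < k0 * n0 \<Longrightarrow> snd s b = vs ! b" for s
  proof -
    have "map (\<lambda>j. snd s (i * n0 + j)) [0..<n0] = r (Ns ! i)" if i: "i < k0" for i
    proof -
      have "Ns ! i \<in> Z" using i len Ns(1) nth_mem by blast
      then have "length (r (Ns ! i)) = n0" using r length_words by blast
      moreover have "snd s (i * n0 + j) = r (Ns ! i) ! j" if "j < n0" for j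
      proof -
        have "i * n0 + n0 \<le> k0 * n0" using mult_le_mono1[of "Suc i" k0 n0] i by simp
        then have "i * n0 + j < k0 * n0" using that by simp
        then show ?thesis using s that by (simp add: vs_def)
      qed
      ultimately show ?thesis by (intro nth_equalityI) auto
    qed
    then have "output_set q0 n0 k0 s = (\<lambda>i. shift_rel q0 n0 `` {r (Ns ! i)}) ` {..<k0}"
      unfolding output_set_def by (intro image_cong) auto
    also have "\<dots> = (\<lambda>i. Ns ! i) ` {..<k0}"
    proof (rule image_cong[OF refl])
      fix i assume "i \<in> {..<k0}"
      then have "Ns ! i \<in> Z" using len Ns(1) nth_mem by blast
      then show "shift_rel q0 n0 `` {r (Ns ! i)} = Ns ! i" using r by blast
    qed
    also have "\<dots> = Z" using len Ns(1) by (auto simp: set_conv_nth image_def)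
    finally show ?thesis .
  qed
  have "solves (c + 16) P' (d + e) q n k" if qnk: "(q, n, k) \<in> insert (q0, n0, k0) X" for q n k
  proof -
    have v: "valid_instance (q, n, k)" using qnk X inst by auto
    have nk: "1 \<le> n * k" using v by (simp add: valid_instance_def)
    define W where "W = (q * n * k) ^ (d + e)"
    have "e < 2 ^ e" by (rule less_exp)
    also have "\<dots> \<le> 2 ^ (d + e)" by (intro power_increasing) auto
    also have "\<dots> \<le> W" unfolding W_def using valid_instance_pos[OF v] by (intro power_mono) auto
    finally have eW: "e < W" .
    define Q where "Q = (\<lambda>s. output_set q n k s \<subseteq> necklaces q n \<and> card (output_set q n k s) = k \<and>
      centre_cost q n (output_set q n k s) \<le> (1 + approx_err q n k) * centre_opt q n k)"
    obtain R M where RM: "input_state q n k = (R, M)" by (cases "input_state q n k")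
    have R: "R 0 = n" "R 1 = q" "R 2 = k" "R 3 = 0"
      using RM by (auto simp: input_state_def)
    have T: "runs W T (R, M) ((c + 4) * (n * k)) Q" if "(q, n, k) = (q0, n0, k0)"
    proof -
      have "runs W T (R, M) (3 * length vs + 1)
          (\<lambda>s. snd s = (\<lambda>b. if 0 \<le> b \<and> b < 0 + length vs then vs ! (b - 0) else M b))"
        unfolding T_def
      proof (rule runs_write_list)
        fix v assume "v \<in> set vs"
        then show "v < W" using vs_less eW by (fastforce simp: e_def)
      qed (use eW in \<open>simp add: vs_def e_def\<close>)
      then show ?thesis
      proof (rule runs_weaken)
        have "length vs = n * k" using that by (simp add: vs_def)
        then show "3 * length vs + 1 \<le> (c + 4) * (n * k)"
          using nk unfolding add_mult_distrib by linarith
      next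
        fix s :: state
        assume "snd s = (\<lambda>b. if 0 \<le> b \<and> b < 0 + length vs then vs ! (b - 0) else M b)"
        then have Z_out: "output_set q0 n0 k0 s = Z" by (intro out) (simp add: vs_def)
        define L where "L = log q0 (real k0 * real n0)"
        have L: "0 \<le> L" "L < real n0"
          using L_bounds[of q0 n0 k0] inst by (auto simp: valid_instance_def L_def)
        have "Z \<noteq> {}" using Z(2) k0 by auto
        then have "0 \<le> centre_opt q0 n0 k0"
          using centre_cost_bounds(1)[OF _ Z(1)] Z(3) inst by (auto simp: valid_instance_def)
        then have "1 * centre_opt q0 n0 k0 \<le> (1 + approx_err q0 n0 k0) * centre_opt q0 n0 k0"
          using approx_err_tolerance(2)[OF L_def L] by (intro mult_right_mono) auto
        then show "Q s" using Z Z_out that by (simp add: Q_def)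
      qed
    qed
    have P_runs: "runs W P (R, M) ((c + 4) * (n * k)) Q" if "(q, n, k) \<noteq> (q0, n0, k0)"
    proof -
      have "(q, n, k) \<in> X" using qnk that by blast
      moreover have "1 \<le> q * n * k" using valid_instance_pos[OF v] by linarith
      ultimately have "solves (c + 4) P (d + e) q n k"
        by (intro solves_mono[OF P le_add1 le_add1])
      then show ?thesis unfolding solves_iff_runs RM W_def Q_def .
    qed
    have c: "n0 < W" "q0 < W" "k0 < W" using eW by (auto simp: e_def)
    let ?b = "(c + 4) * (n * k)"
    have "runs W P' (R, M) (?b + 4 + 4 + 4) Q"
      unfolding P'_def
    proof (rule runs_if_equal[where R = R, OF R(4) _ c(1)])
      show "runs W P (R, M) (?b + 4 + 4) Q" if "R 0 \<noteq> n0"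
      proof (rule runs_weaken)
        show "runs W P (R, M) ?b Q" using P_runs that R by simp
      qed simp_all
      show "runs W (if_equal 1 q0 (if_equal 2 k0 T P) P) (R, M) (?b + 4 + 4) Q" if "R 0 = n0"
      proof (rule runs_if_equal[where R = R, OF R(4) _ c(2)])
        show "runs W P (R, M) (?b + 4) Q" if "R 1 \<noteq> q0"
        proof (rule runs_weaken)
          show "runs W P (R, M) ?b Q" using P_runs that R by simp
        qed simp_all
        show "runs W (if_equal 2 k0 T P) (R, M) (?b + 4) Q" if "R 1 = q0"
          using T P_runs R that \<open>R 0 = n0\<close> by (intro runs_if_equal[where R = R, OF R(4) _ c(3)]) auto
      qed simp
    qed simp
    then have "runs W P' (R, M) ((c + 16) * (n * k)) Q"
    proof (rule runs_weaken)
      show "?b + 4 + 4 + 4 \<le> (c + 16) * (n * k)" using nk unfolding add_mult_distrib by linarith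
    qed
    then show ?thesis unfolding solves_iff_runs RM W_def Q_def .
  qed
  then show ?thesis by blast
qed


lemma add_hardwired_instances:
  assumes "finite Y"
    and base: "\<And>q n k. (q, n, k) \<in> X \<Longrightarrow> solves c P d q n k"
    and valid: "\<And>q n k. (q, n, k) \<in> Y \<union> X \<Longrightarrow> valid_instance (q, n, k)"
  shows "\<exists>P' c' d'. \<forall>(q, n, k)\<in>Y \<union> X. solves c' P' d' q n k"
  using assms(1) valid
proof (induction Y rule: finite_induct)
  case empty
  then show ?case using base by (intro exI[of _ P] exI[of _ c] exI[of _ d]) auto
next
  case (insert y Y)
  obtain q0 n0 k0 where y: "y = (q0, n0, k0)" by (cases y)
  obtain P' c' d' where P': "\<forall>(q, n, k)\<in>Y \<union> X. solves c' P' d' q n k"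
    using insert.IH insert.prems by blast
  have inst: "valid_instance (q0, n0, k0)" using insert.prems y by blast
  then obtain s where s: "output_set q0 n0 k0 s \<subseteq> necklaces q0 n0" "card (output_set q0 n0 k0 s) = k0"
    using centres_prog_correct[of q0 n0 k0] unfolding valid_instance_def by auto
  have "solves c' P' d' q n k" if "(q, n, k) \<in> Y \<union> X" for q n k
    using P' that by blast
  moreover have "valid_instance (q, n, k)" if "(q, n, k) \<in> Y \<union> X" for q n k
    using insert.prems that by blast
  ultimately have "\<exists>P'' c'' d''. \<forall>(q, n, k)\<in>insert (q0, n0, k0) (Y \<union> X). solves c'' P'' d'' q n k"
    using inst s by (rule add_hardwired_instance)
  then show ?case by (simp add: y)
qed

section \<open>The approximation theorem\<close>

lemma approx_err_tendsto_0:
  assumes "2 \<le> q" "1 \<le> k"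
  shows "(\<lambda>n. approx_err q n k) \<longlonglongrightarrow> 0"
proof -
  have q: "ln (real q) > 0" and k: "real k > 0" using assms by auto
  have "(\<lambda>n. ln (real k * real n) / ln (real q) / (real n - ln (real k * real n) / ln (real q))
     - (ln (real k * real n) / ln (real q))\<^sup>2
       / (2 * real n * (real n - ln (real k * real n) / ln (real q)))) \<longlonglongrightarrow> 0"
    using q k by real_asymp
  then show ?thesis by (simp add: approx_err_def log_def)
qed

theorem theorem9:
  "(\<exists>P c d. \<forall>q n k :: nat. q \<ge> 2 \<and> n \<ge> 1 \<and> k \<ge> 1 \<and> k * n < q ^ n \<longrightarrow>
      (\<exists>t s. exec ((q * n * k) ^ d) P (input_state q n k) t s
           \<and> t \<le> c * (n * k)
           \<and> output_set q n k s \<subseteq> necklaces q n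
           \<and> card (output_set q n k s) = k
           \<and> centre_cost q n (output_set q n k s) \<le> (1 + approx_err q n k) * centre_opt q n k))
   \<and> (\<forall>q k :: nat. q \<ge> 2 \<and> k \<ge> 1 \<longrightarrow> (\<lambda>n. approx_err q n k) \<longlonglongrightarrow> 0)"
proof -
  obtain N where N: "\<And>q n k. 2 \<le> q \<Longrightarrow> 1 \<le> n \<Longrightarrow> 1 \<le> k \<Longrightarrow> k * n < q ^ n \<Longrightarrow> N \<le> n \<or> N \<le> q \<Longrightarrow>
    far_word_exists q n k (tolerance n (log q (real k * real n)))"
    using far_word_exists_eventually by blast
  define X where "X = {(q, n, k). valid_instance (q, n, k) \<and> (N \<le> n \<or> N \<le> q)}"
  define Y where "Y = {(q, n, k). valid_instance (q, n, k) \<and> n < N \<and> q < N}"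
  have "Y \<subseteq> {..<N} \<times> {..<N} \<times> {..<N ^ N}"
  proof (clarsimp simp: Y_def valid_instance_def)
    fix q n k :: nat assume *: "n < N" "q < N" "2 \<le> q" "Suc 0 \<le> n" "k * n < q ^ n"
    have "k \<le> k * n" using *(4) by simp
    also have "\<dots> < q ^ n" by fact
    also have "\<dots> \<le> N ^ n" using * by (intro power_mono) auto
    also have "\<dots> \<le> N ^ N" using * by (intro power_increasing) auto
    finally show "k < N ^ N" .
  qed
  then have finY: "finite Y" by (rule finite_subset) auto
  have base: "solves 50 centres_prog 3 q n k" if "(q, n, k) \<in> X" for q n k
  proof -
    have v: "2 \<le> q" "1 \<le> n" "1 \<le> k" "k * n < q ^ n" and big: "N \<le> n \<or> N \<le> q"
      using that by (auto simp: X_def valid_instance_def)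
    show ?thesis
      unfolding solves_def using centres_prog_correct[OF v] any_centres_good[OF v N[OF v big]] by blast
  qed
  have valid: "valid_instance (q, n, k)" if "(q, n, k) \<in> Y \<union> X" for q n k
    using that by (auto simp: X_def Y_def)
  obtain P c d where P: "\<forall>(q, n, k)\<in>Y \<union> X. solves c P d q n k"
    using add_hardwired_instances[OF finY base valid] by blast
  have "solves c P d q n k" if "q \<ge> 2 \<and> n \<ge> 1 \<and> k \<ge> 1 \<and> k * n < q ^ n" for q n k
  proof -
    have "(q, n, k) \<in> Y \<union> X" using that by (auto simp: X_def Y_def valid_instance_def)
    then show ?thesis using P by blast
  qed
  then have "\<exists>P c d. \<forall>q n k. q \<ge> 2 \<and> n \<ge> 1 \<and> k \<ge> 1 \<and> k * n < q ^ n \<longrightarrow> solves c P d q n k"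
    by blast
  moreover have "\<forall>q k. q \<ge> 2 \<and> k \<ge> 1 \<longrightarrow> (\<lambda>n. approx_err q n k) \<longlonglongrightarrow> 0"
    using approx_err_tendsto_0 by blast
  ultimately show ?thesis unfolding solves_def by (rule conjI)
qed

end
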